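(* Assume the standing setting below (Hypothesis H). Let $\beta>0$, $R>0$, $\lambda\in\mathbb{R}$. (i) (Spherical model.) As $N\to\infty$, $\frac1N\log Z^{sf}_N(\beta,R)$ converges almost surely, and $A^{sf}_N(\beta,R)$ converges, to $$A^{sf}(\beta,R^2)=\min_{q\ge\beta\bar\lambda}\Big(qR^2-\frac12\int_{-\bar\lambda}^{\bar\lambda}\rho(\mu)\log(q-\beta\mu)\,d\mu-\frac12\log R^2-\frac12-\frac12\log 2\Big).$$ (ii) (Gaussian model.) As $N\to\infty$, $\frac1N\log Z^{g}_N(\beta,\lambda)$ converges almost surely, and $A^{g}_N(\beta,\lambda)$ converges, to $$A^{g}(\beta,\lambda)=\max_{R^2\in(0,\infty)}\Big(A^{sf}(\beta,R^2)-\frac{\beta^2R^4}{4}+\frac{(\lambda-1)R^2}{2}+\frac12\log R^2+\frac12\Big),$$ where $A^{sf}(\beta,R^2)$ is the limit in (i).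
   Context: Standing setting (Hypothesis H). For each $N\ge1$, $J=J^{(N)}=(J_{ij})_{i,j=1}^N$ is a random real symmetric matrix from the symmetric Wigner ensemble (entries $J_{ij}$, $i\le j$, independent, $J_{ji}=J_{ij}$) with $\mathbb{E}J_{ij}=0$, $\mathbb{E}J_{ij}^2=J^2>0$, and there is $\theta_0>0$ with $\sup_{N,i,j}\mathbb{E}\,e^{\theta_0 J_{ij}^2/N}<\infty$; all matrices are defined on a common probability space. Let $\lambda_1,\dots,\lambda_N$ denote the eigenvalues of $J/\sqrt N$. Hypothesis H further requires: (1) there are constants $\bar\lambda>0$, $C_1>0$, $\theta>0$ such that for every $a>\bar\lambda$ and every eigenvalue $\lambda$ of $J/\sqrt N$, $P(|\lambda|\ge a)\le C_1e^{-\theta a^2N}$; (2) the empirical spectral distribution $\frac1N\sum_i\delta_{\lambda_i}$ converges as $N\to\infty$ to the semicircle law with density $\rho(\mu)=\frac{2\sqrt{\bar\lambda^2-\mu^2}}{\pi\bar\lambda^2}$ on $[-\bar\lambda,\bar\lambda]$. For $z\in\mathbb{R}^N$ the Hamiltonian is $H_N(z,J)=-\frac1{\sqrt N}\sum_{i,j=1}^N J_{ij}z_iz_j=-\langle z,(J/\sqrt N)z\rangle$, which in an orthonormal eigenbasis of $J/\sqrt N$ reads $-\sum_i\lambda_iz_i^2$. $\beta>0$ is the inverse temperature. Spherical model: for $R>0$, $\sigma_{R,N}$ is the uniform probability measure on the sphere $\{z\in\mathbb{R}^N:\|z\|=R\sqrt N\}$; $Z^{sf}_N(\beta,R)=\int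 e^{-\beta H_N(z,J)}\,d\sigma_{R,N}(z)$ and $A^{sf}_N(\beta,R)=\frac1N\mathbb{E}\log Z^{sf}_N(\beta,R)$. Gaussian model: for $\lambda\in\mathbb{R}$, $Z^g_N(\beta,\lambda)=\int_{\mathbb{R}^N}\frac{e^{-\|z\|^2/2}}{(2\pi)^{N/2}}\exp\big(-\beta H_N(z,J)-\frac{\beta^2}{4N}\|z\|^4+\frac{\lambda}{2}\|z\|^2\big)\,dz$ and $A^g_N(\beta,\lambda)=\frac1N\mathbb{E}\log Z^g_N(\beta,\lambda)$. *)

theory Defs
  imports "HOL-Probability.Probability" "Jordan_Normal_Form.Char_Poly"
begin

definition lebN :: "nat \<Rightarrow> (nat \<Rightarrow> real) measure" where
  "lebN N = PiM {..<N} (\<lambda>_. lborel)"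

definition sqnorm :: "nat \<Rightarrow> (nat \<Rightarrow> real) \<Rightarrow> real" where
  "sqnorm N z = (\<Sum>i<N. (z i)\<^sup>2)"

text \<open>Uniform probability measure on the sphere of radius r in R^N (normalised cone measure:
  radial projection of the uniform distribution on the unit ball).\<close>
definition sphere_measure :: "nat \<Rightarrow> real \<Rightarrow> (nat \<Rightarrow> real) measure" where
  "sphere_measure N r =
     distr (uniform_measure (lebN N) {z \<in> space (lebN N). sqnorm N z \<le> 1}) (lebN N)
           (\<lambda>z. restrict (\<lambda>i. r * z i / sqrt (sqnorm N z)) {..<N})"

definition hamiltonian :: "nat \<Rightarrow> (nat \<Rightarrow> nat \<Rightarrow> real) \<Rightarrow> (nat \<Rightarrow> real) \<Rightarrow> real" where
  "hamiltonian N J z = - (1 / sqrt N) * (\<Sum>i<N. \<Sum>j<N. J i j * z i * z j)"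

definition Z_sf :: "nat \<Rightarrow> (nat \<Rightarrow> nat \<Rightarrow> real) \<Rightarrow> real \<Rightarrow> real \<Rightarrow> real" where
  "Z_sf N J \<beta> R = (\<integral>z. exp (- \<beta> * hamiltonian N J z) \<partial>sphere_measure N (R * sqrt N))"

definition Z_g :: "nat \<Rightarrow> (nat \<Rightarrow> nat \<Rightarrow> real) \<Rightarrow> real \<Rightarrow> real \<Rightarrow> real" where
  "Z_g N J \<beta> l = (\<integral>z. exp (- sqnorm N z / 2) / (2 * pi) powr (real N / 2) *
        exp (- \<beta> * hamiltonian N J z - \<beta>\<^sup>2 / (4 * real N) * (sqnorm N z)\<^sup>2 + l / 2 * sqnorm N z)
      \<partial>lebN N)"

definition scaled_mat :: "nat \<Rightarrow> (nat \<Rightarrow> nat \<Rightarrow> real) \<Rightarrow> real mat" where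
  "scaled_mat N J = mat N N (\<lambda>(i, j). J i j / sqrt N)"

definition semicircle :: "real \<Rightarrow> real \<Rightarrow> real" where
  "semicircle lb \<mu> = 2 * sqrt (lb\<^sup>2 - \<mu>\<^sup>2) / (pi * lb\<^sup>2)"

text \<open>The variational functional in (i), for s = R^2.\<close>
definition sf_functional :: "real \<Rightarrow> real \<Rightarrow> real \<Rightarrow> real \<Rightarrow> real" where
  "sf_functional lb \<beta> s q =
     q * s - 1/2 * (LBINT \<mu>:{-lb..lb}. semicircle lb \<mu> * ln (q - \<beta> * \<mu>))
       - 1/2 * ln s - 1/2 - 1/2 * ln 2"

definition A_sf :: "real \<Rightarrow> real \<Rightarrow> real \<Rightarrow> real" where
  "A_sf lb \<beta> s = Inf (sf_functional lb \<beta> s ` {q. q \<ge> \<beta> * lb})"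

definition g_functional :: "real \<Rightarrow> real \<Rightarrow> real \<Rightarrow> real \<Rightarrow> real" where
  "g_functional lb \<beta> l s =
     A_sf lb \<beta> s - \<beta>\<^sup>2 * s\<^sup>2 / 4 + (l - 1) * s / 2 + 1/2 * ln s + 1/2"

definition A_g :: "real \<Rightarrow> real \<Rightarrow> real \<Rightarrow> real" where
  "A_g lb \<beta> l = Sup (g_functional lb \<beta> l ` {0<..})"

end

theory Submission
  imports Defs "HOL-Real_Asymp.Real_Asymp"
begin

text \<open>
  Let \<open>A\<close> be the scaled matrix \<open>J / sqrt N\<close> and \<open>g(q) = ln pi / 2 - 1/2 \<integral> \<rho>(\<mu>) ln (q - \<beta> \<mu>) d\<mu>\<close>. For
  \<open>q > \<beta> \<lambda>\<close>, with \<open>\<lambda>\<close> the spectral edge, the Gaussian integral of \<open>exp (- \<langle>z, (q - \<beta> A) z\<rangle>)\<close> equals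
  \<open>pi^(N/2) / sqrt (det (q - \<beta> A))\<close>, so the convergence of the empirical spectral distribution
  says that it grows like \<open>exp (N g(q))\<close>. Bounding the indicator of a ball by
  \<open>exp (q (N s - |z|^2))\<close> yields the upper bound \<open>inf_q (q s + g(q))\<close> for the exponential rate of the
  integral of \<open>exp (\<beta> \<langle>z, A z\<rangle>)\<close> over a thin shell \<open>|z|^2 \<approx> N s\<close>, which is the spherical partition
  function up to an explicit volume.

  For the lower bound, under the Gaussian measure with parameter \<open>q\<close> the quantity \<open>|z|^2 / N\<close>
  concentrates at \<open>- g'(q)\<close>. If some \<open>q\<close> satisfies \<open>- g'(q) = s\<close>, this is enough. Otherwise
  \<open>- g'(q) < s\<close> for all \<open>q\<close> (condensation), and the missing mass is put on an eigenvector \<open>v\<close> whose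
  eigenvalue is close to the edge: one translates \<open>z\<close> by \<open>sqrt (N (s + g'(q))) v\<close>, where the component of \<open>z\<close> along \<open>v\<close>
  is negligible because it is a Gaussian variable of bounded variance, and lets \<open>q\<close> decrease to
  the edge. No diagonalisation of \<open>A\<close> is needed.

  The Gaussian model is a Laplace integral over the radius of the spherical one. The expectations
  converge by dominated convergence, because the edge bound makes the supremum over \<open>N\<close> of the
  squared spectral norms integrable.
\<close>

section \<open>Lebesgue measure and Gaussian integrals on finite products\<close>

abbreviation fmat :: "nat \<Rightarrow> (nat \<Rightarrow> nat \<Rightarrow> 'a) \<Rightarrow> 'a mat" where
  "fmat N A \<equiv> mat N N (\<lambda>(i, j). A i j)"

abbreviation roots :: "nat \<Rightarrow> (nat \<Rightarrow> nat \<Rightarrow> real) \<Rightarrow> real multiset" where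
  "roots N A \<equiv> proots (char_poly (fmat N A))"

definition quad :: "nat \<Rightarrow> (nat \<Rightarrow> nat \<Rightarrow> real) \<Rightarrow> (nat \<Rightarrow> real) \<Rightarrow> real" where
  "quad N A z = (\<Sum>i<N. \<Sum>j<N. A i j * z i * z j)"

lemma measurable_lebN_component: "i < N \<Longrightarrow> (\<lambda>z. z i) \<in> borel_measurable (lebN N)"
  unfolding lebN_def by measurable

lemma measurable_lebN_restrict:
  "(\<And>i. i < N \<Longrightarrow> (\<lambda>z. f z i) \<in> borel_measurable M) \<Longrightarrow>
    (\<lambda>z. restrict (f z) {..<N}) \<in> measurable M (lebN N)"
  unfolding lebN_def by (intro measurable_restrict) auto

lemma sqnorm_measurable [measurable]: "sqnorm N \<in> borel_measurable (lebN N)"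
  unfolding sqnorm_def by (intro borel_measurable_sum borel_measurable_power measurable_lebN_component) simp

lemma quad_measurable [measurable]: "quad N A \<in> borel_measurable (lebN N)"
  unfolding quad_def by (intro borel_measurable_sum borel_measurable_times borel_measurable_const measurable_lebN_component) auto

lemma quad_cong: "(\<And>i. i < N \<Longrightarrow> z i = z' i) \<Longrightarrow> quad N A z = quad N A z'"
  unfolding quad_def by (auto intro!: sum.cong)

lemma sqnorm_cong: "(\<And>i. i < N \<Longrightarrow> z i = z' i) \<Longrightarrow> sqnorm N z = sqnorm N z'"
  unfolding sqnorm_def by (auto intro!: sum.cong)

lemma quad_restrict [simp]: "quad N A (restrict z {..<N}) = quad N A z"
  by (rule quad_cong) simp

lemma sqnorm_restrict [simp]: "sqnorm N (restrict z {..<N}) = sqnorm N z"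
  by (rule sqnorm_cong) simp

lemma sqnorm_nonneg [simp]: "0 \<le> sqnorm N z"
  unfolding sqnorm_def by (intro sum_nonneg) simp

interpretation lborel_prod: product_sigma_finite "\<lambda>_::nat. lborel :: real measure"
  by standard

lemma sigma_finite_lebN: "sigma_finite_measure (lebN N)"
  unfolding lebN_def by (rule lborel_prod.sigma_finite) simp

lemma nn_integral_lebN_Suc:
  assumes "f \<in> borel_measurable (lebN (Suc N))"
  shows "(\<integral>\<^sup>+z. f z \<partial>lebN (Suc N)) = (\<integral>\<^sup>+z. (\<integral>\<^sup>+y. f (z(N := y)) \<partial>lborel) \<partial>lebN N)"
  using assms unfolding lebN_def lessThan_Suc
  by (intro lborel_prod.product_nn_integral_insert) auto

lemma nn_integral_lebN_affine:
  assumes "f \<in> borel_measurable (lebN N)" and c: "c > 0"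
  shows "(\<integral>\<^sup>+z. f z \<partial>lebN N) =
    ennreal (c ^ N) * (\<integral>\<^sup>+z. f (restrict (\<lambda>i. w i + c * z i) {..<N}) \<partial>lebN N)"
  using assms(1)
proof (induction N arbitrary: f)
  case 0
  have "space (lebN 0) = {\<lambda>_. undefined}" by (simp add: lebN_def space_PiM)
  then have "(\<integral>\<^sup>+z. f z \<partial>lebN 0) = (\<integral>\<^sup>+z. f (restrict (\<lambda>i. w i + c * z i) {..<0}) \<partial>lebN 0)"
    by (intro nn_integral_cong) (auto simp: restrict_def)
  then show ?case by (simp only: power_0 ennreal_1 mult_1)
next
  case (Suc N)
  note [measurable] = Suc.prems
  have upd [measurable]: "(\<lambda>(z, y). z(N := y)) \<in> measurable (lebN N \<Otimes>\<^sub>M lborel) (lebN (Suc N))"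
    unfolding lebN_def lessThan_Suc by measurable
  have upd1 [measurable]: "(\<lambda>y. z(N := y)) \<in> measurable borel (lebN (Suc N))" if "z \<in> space (lebN N)" for z
    using measurable_compose[OF measurable_Pair1'[OF that] upd] by simp
  have shift [measurable]: "(\<lambda>z. restrict (\<lambda>i. w i + c * z i) {..<N}) \<in> measurable (lebN N) (lebN N)"
    by (intro measurable_lebN_restrict borel_measurable_add borel_measurable_times borel_measurable_const
        measurable_lebN_component) auto
  have shift' [measurable]: "(\<lambda>z. restrict (\<lambda>i. w i + c * z i) {..<Suc N}) \<in> measurable (lebN (Suc N)) (lebN (Suc N))"
    by (intro measurable_lebN_restrict borel_measurable_add borel_measurable_times borel_measurable_const
        measurable_lebN_component) auto
  have "(\<integral>\<^sup>+z. f z \<partial>lebN (Suc N)) = (\<integral>\<^sup>+z. (\<integral>\<^sup>+y. f (z(N := y)) \<partial>lborel) \<partial>lebN N)"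
    by (rule nn_integral_lebN_Suc) simp
  also have "\<dots> = (\<integral>\<^sup>+z. ennreal c * (\<integral>\<^sup>+y. f (z(N := w N + c * y)) \<partial>lborel) \<partial>lebN N)"
  proof (intro nn_integral_cong)
    fix z assume z: "z \<in> space (lebN N)"
    note [measurable] = upd1[OF z]
    show "(\<integral>\<^sup>+y. f (z(N := y)) \<partial>lborel) = ennreal c * (\<integral>\<^sup>+y. f (z(N := w N + c * y)) \<partial>lborel)"
      by (subst nn_integral_real_affine[where c=c and t="w N"]) (use c in auto)
  qed
  also have "\<dots> = ennreal (c ^ N) * (\<integral>\<^sup>+z. ennreal c *
      (\<integral>\<^sup>+y. f ((restrict (\<lambda>i. w i + c * z i) {..<N})(N := w N + c * y)) \<partial>lborel) \<partial>lebN N)"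
    by (rule Suc.IH) measurable
  also have "\<dots> = ennreal (c ^ N) * (ennreal c * (\<integral>\<^sup>+z.
      (\<integral>\<^sup>+y. f ((restrict (\<lambda>i. w i + c * z i) {..<N})(N := w N + c * y)) \<partial>lborel) \<partial>lebN N))"
    by (intro arg_cong[where f="\<lambda>x. _ * x"] nn_integral_cmult) measurable
  also have "\<dots> = ennreal (c ^ Suc N) * (\<integral>\<^sup>+z.
      (\<integral>\<^sup>+y. f ((restrict (\<lambda>i. w i + c * z i) {..<N})(N := w N + c * y)) \<partial>lborel) \<partial>lebN N)"
    using c by (simp add: mult.assoc[symmetric] ennreal_mult[symmetric] mult.commute)
  also have "(\<integral>\<^sup>+z. (\<integral>\<^sup>+y. f ((restrict (\<lambda>i. w i + c * z i) {..<N})(N := w N + c * y)) \<partial>lborel) \<partial>lebN N)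
     = (\<integral>\<^sup>+z. f (restrict (\<lambda>i. w i + c * z i) {..<Suc N}) \<partial>lebN (Suc N))"
  proof (subst nn_integral_lebN_Suc)
    show "(\<lambda>z. f (\<lambda>i\<in>{..<Suc N}. w i + c * z i)) \<in> borel_measurable (lebN (Suc N))" by measurable
    have "(restrict (\<lambda>i. w i + c * z i) {..<N})(N := w N + c * y) =
       restrict (\<lambda>i. w i + c * (z(N := y)) i) {..<Suc N}" for z y
      by (auto simp: restrict_def fun_eq_iff)
    then show "(\<integral>\<^sup>+z. (\<integral>\<^sup>+y. f ((restrict (\<lambda>i. w i + c * z i) {..<N})(N := w N + c * y)) \<partial>lborel) \<partial>lebN N)
      = (\<integral>\<^sup>+z. (\<integral>\<^sup>+y. f (restrict (\<lambda>i. w i + c * (z(N := y)) i) {..<Suc N}) \<partial>lborel) \<partial>lebN N)"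
      by simp
  qed
  finally show ?case .
qed

lemma nn_integral_gauss_1d:
  fixes b c :: real assumes c: "c > 0"
  shows "(\<integral>\<^sup>+y. ennreal (exp (- c * (y + b)\<^sup>2)) \<partial>lborel) = ennreal (sqrt (pi / c))"
proof -
  define \<sigma> where "\<sigma> = sqrt (1 / (2 * c))"
  have \<sigma>: "\<sigma> > 0" "\<sigma>\<^sup>2 = 1 / (2 * c)" using c by (auto simp: \<sigma>_def)
  interpret prob_space "density lborel (\<lambda>x. ennreal (normal_density (- b) \<sigma> x))"
    by (rule prob_space_normal_density) (use \<sigma> in auto)
  have "(\<integral>\<^sup>+y. ennreal (exp (- c * (y + b)\<^sup>2)) \<partial>lborel)
     = (\<integral>\<^sup>+y. ennreal (sqrt (pi / c)) * ennreal (normal_density (- b) \<sigma> y) \<partial>lborel)"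
    using c by (intro nn_integral_cong)
      (auto simp: normal_density_def \<sigma> ennreal_mult[symmetric] real_sqrt_divide field_simps)
  also have "\<dots> = ennreal (sqrt (pi / c)) * (\<integral>\<^sup>+y. ennreal (normal_density (- b) \<sigma> y) \<partial>lborel)"
    by (rule nn_integral_cmult) auto
  also have "(\<integral>\<^sup>+y. ennreal (normal_density (- b) \<sigma> y) \<partial>lborel) = 1"
    using emeasure_space_1 by (simp add: emeasure_density)
  finally show ?thesis by simp
qed

definition pos_def :: "nat \<Rightarrow> (nat \<Rightarrow> nat \<Rightarrow> real) \<Rightarrow> bool" where
  "pos_def N Q \<longleftrightarrow> (\<forall>z. (\<exists>i<N. z i \<noteq> 0) \<longrightarrow> quad N Q z > 0)"

definition schur_compl :: "nat \<Rightarrow> (nat \<Rightarrow> nat \<Rightarrow> real) \<Rightarrow> nat \<Rightarrow> nat \<Rightarrow> real" where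
  "schur_compl N Q i j = Q i j - Q i N * Q j N / Q N N"

lemma quad_Suc_schur:
  assumes sym: "\<And>i. i < N \<Longrightarrow> Q N i = Q i N" and c: "Q N N \<noteq> 0"
  shows "quad (Suc N) Q z =
    quad N (schur_compl N Q) z + Q N N * (z N + (\<Sum>i<N. Q i N * z i) / Q N N)\<^sup>2"
proof -
  define b where "b = (\<Sum>i<N. Q i N * z i)"
  have 1: "quad (Suc N) Q z = quad N Q z + 2 * z N * b + Q N N * (z N)\<^sup>2"
  proof -
    have "(\<Sum>j<N. Q N j * z N * z j) = z N * b"
      unfolding b_def sum_distrib_left by (intro sum.cong) (auto simp: sym)
    moreover have "(\<Sum>i<N. Q i N * z i * z N) = z N * b"
      unfolding b_def sum_distrib_left by (intro sum.cong) auto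
    ultimately show ?thesis
      by (simp add: quad_def sum.distrib power2_eq_square)
  qed
  have "b * b = (\<Sum>i<N. \<Sum>j<N. Q i N * z i * (Q j N * z j))"
    unfolding b_def by (rule sum_product)
  then have 2: "quad N (schur_compl N Q) z = quad N Q z - b * b / Q N N"
    unfolding quad_def schur_compl_def
    by (simp add: sum_subtractf[symmetric] sum_divide_distrib algebra_simps)
  show ?thesis unfolding 1 2 b_def[symmetric] using c
    by (simp add: power2_eq_square field_simps)
qed

lemma det_schur_compl:
  fixes Q :: "nat \<Rightarrow> nat \<Rightarrow> real"
  assumes c: "Q N N \<noteq> 0"
  shows "Determinant.det (mat (Suc N) (Suc N) (\<lambda>(i, j). if i < N \<and> j < N then Q i j else if j < N then Q j N else Q i N)) =
    Q N N * Determinant.det (fmat N (schur_compl N Q))"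
proof -
  define S where "S = fmat N (schur_compl N Q)"
  define B where "B = mat N 1 (\<lambda>(i, j). Q i N / Q N N)"
  define C where "C = mat 1 N (\<lambda>(i, j). Q j N)"
  define D where "D = mat 1 1 (\<lambda>(i, j). Q N N)"
  have car: "S \<in> carrier_mat N N" "B \<in> carrier_mat N 1" "C \<in> carrier_mat 1 N" "D \<in> carrier_mat 1 1"
    by (auto simp: S_def B_def C_def D_def)
  have "mat (Suc N) (Suc N) (\<lambda>(i, j). if i < N \<and> j < N then Q i j else if j < N then Q j N else Q i N) =
     four_block_mat (1\<^sub>m N) B (0\<^sub>m 1 N) (1\<^sub>m 1) * four_block_mat S (0\<^sub>m N 1) C D"
    (is "?L = ?P * ?R")
  proof -
    have "?P * ?R = four_block_mat (1\<^sub>m N * S + B * C) (1\<^sub>m N * 0\<^sub>m N 1 + B * D)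
        (0\<^sub>m 1 N * S + 1\<^sub>m 1 * C) (0\<^sub>m 1 N * 0\<^sub>m N 1 + 1\<^sub>m 1 * D)"
      by (rule mult_four_block_mat) (use car in auto)
    also have "\<dots> = four_block_mat (S + B * C) (B * D) C D"
      using car by simp
    also have "\<dots> = ?L"
      using c by (intro eq_matI)
        (auto simp: S_def B_def C_def D_def schur_compl_def scalar_prod_def less_Suc_eq)
    finally show ?thesis by simp
  qed
  moreover have "Determinant.det ?P = 1"
    by (subst det_four_block_mat_lower_left_zero[where n=N and m=1]) (use car in auto)
  moreover have "Determinant.det ?R = Determinant.det S * Q N N"
    by (subst det_four_block_mat_upper_right_zero[where n=N and m=1])
      (use car in \<open>auto simp: D_def det_single\<close>)
  moreover have "Determinant.det (?P * ?R) = Determinant.det ?P * Determinant.det ?R"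
    by (rule det_mult[where n="N+1"]) (use car in \<open>auto intro!: four_block_carrier_mat\<close>)
  ultimately show ?thesis by (simp add: S_def)
qed

theorem nn_integral_gauss:
  assumes "\<And>i j. i < N \<Longrightarrow> j < N \<Longrightarrow> Q i j = Q j i" and "pos_def N Q"
  shows "Determinant.det (fmat N Q) > 0 \<and>
    (\<integral>\<^sup>+z. ennreal (exp (- quad N Q z)) \<partial>lebN N) =
      ennreal (sqrt (pi ^ N / Determinant.det (fmat N Q)))"
  using assms
proof (induction N arbitrary: Q)
  case 0
  then show ?case
    by (simp add: lebN_def quad_def PiM_empty)
next
  case (Suc N)
  let ?b = "\<lambda>z. \<Sum>i<N. Q i N * z i"
  define c where "c = Q N N"
  define S where "S = schur_compl N Q"
  have sym: "Q i j = Q j i" if "i \<le> N" "j \<le> N" for i j using Suc.prems(1) that by simp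
  have c: "c > 0"
  proof -
    have "quad (Suc N) Q (\<lambda>i. if i = N then 1 else 0) > 0"
      using Suc.prems(2) by (auto simp: pos_def_def)
    then show ?thesis by (simp add: quad_def c_def)
  qed
  have eq: "quad (Suc N) Q z = quad N S z + c * (z N + ?b z / c)\<^sup>2" for z
    unfolding S_def c_def by (rule quad_Suc_schur) (use sym c in \<open>auto simp: c_def\<close>)
  have "pos_def N S"
    unfolding pos_def_def
  proof (intro allI impI)
    fix z :: "nat \<Rightarrow> real" assume z: "\<exists>i<N. z i \<noteq> 0"
    define z' where "z' = z(N := - ?b z / c)"
    have "quad (Suc N) Q z' > 0"
      using Suc.prems(2) z unfolding pos_def_def z'_def
      by (metis fun_upd_other less_Suc_eq less_irrefl_nat)
    moreover have "?b z' = ?b z" by (intro sum.cong) (auto simp: z'_def)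
    moreover have "quad N S z' = quad N S z" by (rule quad_cong) (auto simp: z'_def)
    ultimately show "quad N S z > 0" by (simp add: eq) (simp add: z'_def)
  qed
  moreover have "S i j = S j i" if "i < N" "j < N" for i j
    using sym[of i j] that by (simp add: S_def schur_compl_def)
  ultimately have IH: "Determinant.det (fmat N S) > 0"
      "(\<integral>\<^sup>+z. ennreal (exp (- quad N S z)) \<partial>lebN N) = ennreal (sqrt (pi ^ N / Determinant.det (fmat N S)))"
    using Suc.IH[of S] by auto
  have "fmat (Suc N) Q =
      mat (Suc N) (Suc N) (\<lambda>(i, j). if i < N \<and> j < N then Q i j else if j < N then Q j N else Q i N)"
    by (intro eq_matI) (auto simp: less_Suc_eq sym)
  then have det: "Determinant.det (fmat (Suc N) Q) = c * Determinant.det (fmat N S)"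
    using det_schur_compl[of Q N] c by (simp add: c_def S_def)
  have "(\<integral>\<^sup>+z. ennreal (exp (- quad (Suc N) Q z)) \<partial>lebN (Suc N)) =
     (\<integral>\<^sup>+z. \<integral>\<^sup>+y. ennreal (exp (- quad (Suc N) Q (z(N := y)))) \<partial>lborel \<partial>lebN N)"
    by (rule nn_integral_lebN_Suc) measurable
  also have "\<dots> = (\<integral>\<^sup>+z. ennreal (exp (- quad N S z)) * ennreal (sqrt (pi / c)) \<partial>lebN N)"
  proof (intro nn_integral_cong)
    fix z
    have "quad (Suc N) Q (z(N := y)) = quad N S z + c * (y + ?b z / c)\<^sup>2" for y
    proof -
      have "?b (z(N := y)) = ?b z" by (intro sum.cong) auto
      moreover have "quad N S (z(N := y)) = quad N S z" by (rule quad_cong) auto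
      ultimately show ?thesis by (simp add: eq)
    qed
    then have "(\<integral>\<^sup>+y. ennreal (exp (- quad (Suc N) Q (z(N := y)))) \<partial>lborel) =
        (\<integral>\<^sup>+y. ennreal (exp (- quad N S z)) * ennreal (exp (- c * (y + ?b z / c)\<^sup>2)) \<partial>lborel)"
      by (simp add: ennreal_mult[symmetric] exp_add[symmetric])
    also have "\<dots> = ennreal (exp (- quad N S z)) * ennreal (sqrt (pi / c))"
      by (subst nn_integral_cmult) (use nn_integral_gauss_1d[OF c] in auto)
    finally show "(\<integral>\<^sup>+y. ennreal (exp (- quad (Suc N) Q (z(N := y)))) \<partial>lborel) = \<dots>" .
  qed
  also have "\<dots> = (\<integral>\<^sup>+z. ennreal (exp (- quad N S z)) \<partial>lebN N) * ennreal (sqrt (pi / c))"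
    by (rule nn_integral_multc) measurable
  also have "\<dots> = ennreal (sqrt (pi ^ Suc N / Determinant.det (fmat (Suc N) Q)))"
    unfolding IH det using c IH(1)
    by (subst ennreal_mult[symmetric]) (auto simp: real_sqrt_mult[symmetric] mult_ac)
  finally show ?case using det c IH(1) by simp
qed

section \<open>Spectra of real symmetric matrices\<close>

definition dotp :: "nat \<Rightarrow> (nat \<Rightarrow> real) \<Rightarrow> (nat \<Rightarrow> real) \<Rightarrow> real" where
  "dotp N z w = (\<Sum>i<N. z i * w i)"

definition matvec :: "nat \<Rightarrow> (nat \<Rightarrow> nat \<Rightarrow> real) \<Rightarrow> (nat \<Rightarrow> real) \<Rightarrow> nat \<Rightarrow> real" where
  "matvec N A v i = (\<Sum>j<N. A i j * v j)"

definition symmetric_on :: "nat \<Rightarrow> (nat \<Rightarrow> nat \<Rightarrow> real) \<Rightarrow> bool" where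
  "symmetric_on N A \<longleftrightarrow> (\<forall>i<N. \<forall>j<N. A i j = A j i)"

lemma sqnorm_add: "sqnorm N (\<lambda>i. v i + t * w i) = sqnorm N v + 2 * t * dotp N w v + t\<^sup>2 * sqnorm N w"
  unfolding sqnorm_def dotp_def
  by (simp add: power2_eq_square algebra_simps sum.distrib sum_distrib_left)

lemma sqnorm_scale: "sqnorm N (\<lambda>i. c * z i) = c\<^sup>2 * sqnorm N z"
  unfolding sqnorm_def by (simp add: power_mult_distrib sum_distrib_left)

lemma quad_scale: "quad N A (\<lambda>i. c * z i) = c\<^sup>2 * quad N A z"
  unfolding quad_def by (simp add: power2_eq_square sum_distrib_left mult_ac)

lemma quad_eq_dotp: "quad N A z = dotp N z (matvec N A z)"
  unfolding quad_def dotp_def matvec_def by (simp add: sum_distrib_left mult_ac)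

lemma quad_add:
  assumes "symmetric_on N A"
  shows "quad N A (\<lambda>i. v i + t * w i) = quad N A v + 2 * t * dotp N w (matvec N A v) + t\<^sup>2 * quad N A w"
proof -
  have "(\<Sum>i<N. \<Sum>j<N. A i j * v i * w j) = (\<Sum>i<N. \<Sum>j<N. A j i * v i * w j)"
    using assms by (intro sum.cong) (auto simp: symmetric_on_def)
  also have "\<dots> = (\<Sum>j<N. \<Sum>i<N. A j i * v i * w j)"
    by (rule sum.swap)
  finally have 1: "(\<Sum>i<N. \<Sum>j<N. A i j * v i * w j) = dotp N w (matvec N A v)"
    by (simp add: dotp_def matvec_def sum_distrib_left mult_ac)
  have 2: "(\<Sum>i<N. \<Sum>j<N. A i j * w i * v j) = dotp N w (matvec N A v)"
    by (simp add: dotp_def matvec_def sum_distrib_left mult_ac)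
  have "quad N A (\<lambda>i. v i + t * w i) = (\<Sum>i<N. \<Sum>j<N. A i j * v i * v j + t * (A i j * v i * w j)
       + t * (A i j * w i * v j) + t\<^sup>2 * (A i j * w i * w j))"
    unfolding quad_def by (intro sum.cong) (auto simp: algebra_simps power2_eq_square)
  also have "\<dots> = quad N A v + t * (\<Sum>i<N. \<Sum>j<N. A i j * v i * w j)
      + t * (\<Sum>i<N. \<Sum>j<N. A i j * w i * v j) + t\<^sup>2 * quad N A w"
    by (simp add: sum.distrib quad_def sum_distrib_left)
  finally show ?thesis unfolding 1 2 by simp
qed

lemma sqnorm_pos_iff: "sqnorm N z > 0 \<longleftrightarrow> (\<exists>i<N. z i \<noteq> 0)"
proof -
  have "sqnorm N z = 0 \<longleftrightarrow> (\<forall>i<N. z i = 0)"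
    unfolding sqnorm_def by (subst sum_nonneg_eq_0_iff) auto
  moreover have "sqnorm N z > 0 \<longleftrightarrow> sqnorm N z \<noteq> 0" using sqnorm_nonneg[of N z] by linarith
  ultimately show ?thesis by auto
qed

lemma eigenvalue_mat_iff:
  fixes A :: "nat \<Rightarrow> nat \<Rightarrow> 'a :: comm_ring_1"
  shows "eigenvalue (fmat N A) x \<longleftrightarrow>
    (\<exists>v. (\<exists>i<N. v i \<noteq> 0) \<and> (\<forall>i<N. (\<Sum>j<N. A i j * v j) = x * v i))"
proof
  assume "eigenvalue (fmat N A) x"
  then obtain v where v: "v \<in> carrier_vec N" "v \<noteq> 0\<^sub>v N"
      "fmat N A *\<^sub>v v = x \<cdot>\<^sub>v v"
    by (auto simp: eigenvalue_def eigenvector_def)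
  have "\<exists>i<N. vec_index v i \<noteq> 0"
  proof (rule ccontr)
    assume "\<not> ?thesis"
    then have "v = 0\<^sub>v N" using v(1) by (intro eq_vecI) auto
    then show False using v(2) by simp
  qed
  moreover have "(\<Sum>j<N. A i j * vec_index v j) = x * vec_index v i" if "i < N" for i
    using arg_cong[OF v(3), of "\<lambda>u. vec_index u i"] v(1) that
    by (simp add: scalar_prod_def atLeast0LessThan carrier_vecD)
  ultimately show "\<exists>v. (\<exists>i<N. v i \<noteq> 0) \<and> (\<forall>i<N. (\<Sum>j<N. A i j * v j) = x * v i)"
    by blast
next
  assume "\<exists>v. (\<exists>i<N. v i \<noteq> 0) \<and> (\<forall>i<N. (\<Sum>j<N. A i j * v j) = x * v i)"
  then obtain v where v: "\<exists>i<N. v i \<noteq> 0" "\<And>i. i < N \<Longrightarrow> (\<Sum>j<N. A i j * v j) = x * v i"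
    by blast
  have "eigenvector (fmat N A) (Matrix.vec N v) x"
    unfolding eigenvector_def
  proof (intro conjI)
    show "Matrix.vec N v \<noteq> 0\<^sub>v (dim_row (fmat N A))"
      using v(1) by (metis dim_row_mat(1) index_vec index_zero_vec(1))
    show "fmat N A *\<^sub>v Matrix.vec N v = x \<cdot>\<^sub>v Matrix.vec N v"
      using v(2) by (intro eq_vecI) (auto simp: scalar_prod_def atLeast0LessThan)
  qed simp
  then show "eigenvalue (fmat N A) x" by (auto simp: eigenvalue_def)
qed

lemma symmetric_complex_eigenvalue_real:
  assumes "symmetric_on N A" "eigenvalue (mat N N (\<lambda>(i, j). complex_of_real (A i j))) a"
  shows "a \<in> \<real>"
proof -
  obtain v where v: "\<exists>i<N. v i \<noteq> 0" "\<And>i. i < N \<Longrightarrow> (\<Sum>j<N. complex_of_real (A i j) * v j) = a * v i"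
    using assms(2) unfolding eigenvalue_mat_iff by blast
  define S where "S = (\<Sum>i<N. \<Sum>j<N. cnj (v i) * complex_of_real (A i j) * v j)"
  define r where "r = (\<Sum>i<N. (cmod (v i))\<^sup>2)"
  have "cnj S = (\<Sum>i<N. \<Sum>j<N. v i * complex_of_real (A i j) * cnj (v j))"
    by (simp add: S_def)
  also have "\<dots> = (\<Sum>j<N. \<Sum>i<N. v i * complex_of_real (A i j) * cnj (v j))"
    by (rule sum.swap)
  also have "\<dots> = S"
    unfolding S_def using assms(1) by (intro sum.cong) (auto simp: symmetric_on_def)
  finally have "S \<in> \<real>" by (simp add: Reals_cnj_iff)
  have "S = (\<Sum>i<N. cnj (v i) * (\<Sum>j<N. complex_of_real (A i j) * v j))"
    by (simp add: S_def sum_distrib_left mult_ac)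
  also have "\<dots> = (\<Sum>i<N. cnj (v i) * (a * v i))"
    by (intro sum.cong) (auto simp: v(2))
  also have "\<dots> = a * of_real r"
    unfolding r_def of_real_sum sum_distrib_left
    by (intro sum.cong) (auto simp: complex_norm_square mult_ac simp del: of_real_power)
  finally have S: "S = a * of_real r" .
  have "r > 0"
  proof -
    obtain i where "i < N" "v i \<noteq> 0" using v(1) by blast
    then show ?thesis unfolding r_def by (intro sum_pos2[of _ i]) auto
  qed
  then have "a = S / of_real r" using S by simp
  then show ?thesis using \<open>S \<in> \<real>\<close> by simp
qed

lemma symmetric_char_poly_splits:
  assumes "symmetric_on N A"
  shows "char_poly (fmat N A) =
    (\<Prod>x\<in>#roots N A. [:- x, 1:])"
    and "size (roots N A) = N"
proof -
  let ?A = "fmat N A"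
  let ?C = "mat N N (\<lambda>(i, j). complex_of_real (A i j))"
  interpret p: map_poly_inj_idom_hom "of_real :: real \<Rightarrow> complex" ..
  have C: "?C = map_mat of_real ?A" by (intro eq_matI) auto
  have car: "?A \<in> carrier_mat N N" "?C \<in> carrier_mat N N" by auto
  obtain as where as: "char_poly ?C = (\<Prod>a\<leftarrow>as. [:- a, 1:])" "length as = N"
    using char_poly_factorized[OF car(2)] by blast
  have real: "complex_of_real (Re a) = a" if "a \<in> set as" for a
  proof -
    have "poly (char_poly ?C) a = 0"
      unfolding as(1) poly_prod_list using that by (auto simp: prod_list_zero_iff)
    then have "eigenvalue ?C a" using eigenvalue_root_char_poly[OF car(2)] by blast
    then show ?thesis using symmetric_complex_eigenvalue_real[OF assms] by (simp add: of_real_Re)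
  qed
  have "map_poly of_real (char_poly ?A) = (\<Prod>a\<leftarrow>as. [:- a, 1:])"
    using of_real_hom.char_poly_hom[where ?'a=complex, OF car(1)] as(1) C by simp
  also have "\<dots> = (\<Prod>a\<leftarrow>as. map_poly of_real [:- Re a, 1:])"
    by (intro arg_cong[where f=prod_list] map_cong) (auto simp: real)
  also have "\<dots> = map_poly of_real (\<Prod>a\<leftarrow>map Re as. [:- a, 1:])"
    by (simp add: p.hom_prod_list o_def)
  finally have eq: "char_poly ?A = (\<Prod>a\<leftarrow>map Re as. [:- a, 1:])"
    by (rule p.injectivity)
  have pr: "proots (\<Prod>a\<leftarrow>xs. [:- a, 1:]) = mset xs" for xs :: "real list"
  proof (induction xs)
    case (Cons x xs)
    have "(\<Prod>a\<leftarrow>xs. [:- a, 1:]) \<noteq> 0" by (auto simp: prod_list_zero_iff)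
    then show ?case using Cons by (simp add: proots_mult del: mult_pCons_left)
  qed simp
  show "char_poly ?A = (\<Prod>x\<in>#proots (char_poly ?A). [:- x, 1:])"
    unfolding eq pr by (simp add: prod_mset_prod_list[symmetric] image_mset.compositionality o_def)
  show "size (proots (char_poly ?A)) = N"
    unfolding eq pr using as(2) by simp
qed

lemma det_shifted_symmetric:
  assumes "symmetric_on N A" and b: "b > 0"
  shows "Determinant.det (mat N N (\<lambda>(i, j). (if i = j then q else 0) - b * A i j)) =
    (\<Prod>x\<in>#roots N A. q - b * x)"
proof -
  let ?A = "fmat N A"
  have car: "?A \<in> carrier_mat N N" by simp
  have "mat N N (\<lambda>(i, j). (if i = j then q else 0) - b * A i j) = b \<cdot>\<^sub>m (- char_matrix ?A (q / b))"
    using b by (intro eq_matI) (auto simp: char_matrix_def field_simps)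
  then have "Determinant.det (mat N N (\<lambda>(i, j). (if i = j then q else 0) - b * A i j)) =
     b ^ N * poly (char_poly ?A) (q / b)"
    by (simp add: char_poly_matrix[OF car] char_matrix_def)
  also have "poly (char_poly ?A) (q / b) = (\<Prod>x\<in>#proots (char_poly ?A). q / b - x)"
    by (subst symmetric_char_poly_splits(1)[OF assms(1)]) (simp add: poly_prod_mset image_mset.compositionality o_def)
  also have "b ^ N * \<dots> = (\<Prod>x\<in>#proots (char_poly ?A). b * (q / b - x))"
    by (simp add: prod_mset.distrib prod_mset_constant symmetric_char_poly_splits(2)[OF assms(1)])
  also have "\<dots> = (\<Prod>x\<in>#proots (char_poly ?A). q - b * x)"
    using b by (simp add: algebra_simps)
  finally show ?thesis .
qed

lemma compact_unit_sphere_fun: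
  "compact {z :: nat \<Rightarrow> real. (\<forall>i\<ge>N. z i = 0) \<and> sqnorm N z = 1}"
proof -
  let ?S = "\<lambda>i. if i < N then {-1..1} else {0 :: real}"
  have "compactin (product_topology (\<lambda>_::nat. euclidean) UNIV) (PiE UNIV ?S)"
    unfolding compactin_PiE by auto
  then have "compact (PiE UNIV ?S)"
    by (simp add: euclidean_product_topology)
  moreover have "closed {z :: nat \<Rightarrow> real. sqnorm N z = 1}"
    unfolding sqnorm_def by (intro closed_Collect_eq continuous_intros) auto
  ultimately have "compact (PiE UNIV ?S \<inter> {z. sqnorm N z = 1})"
    by (rule compact_Int_closed)
  also have "PiE UNIV ?S \<inter> {z. sqnorm N z = 1} = {z. (\<forall>i\<ge>N. z i = 0) \<and> sqnorm N z = 1}"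
  proof -
    have "\<bar>z i\<bar> \<le> 1" if "sqnorm N z = 1" "i < N" for z :: "nat \<Rightarrow> real" and i
    proof -
      have "(z i)\<^sup>2 \<le> sqnorm N z" unfolding sqnorm_def
        by (rule member_le_sum) (use that in auto)
      then show ?thesis using that by (simp add: abs_le_square_iff[of _ 1, simplified])
    qed
    then show ?thesis by (auto simp: PiE_def Pi_def abs_le_iff split: if_splits)
  qed
  finally show ?thesis .
qed

lemma rayleigh_max_eigenvalue:
  assumes sym: "symmetric_on N A" and N: "N > 0"
  obtains x where "eigenvalue (fmat N A) x" "\<And>z. quad N A z \<le> x * sqnorm N z"
proof -
  let ?K = "{z :: nat \<Rightarrow> real. (\<forall>i\<ge>N. z i = 0) \<and> sqnorm N z = 1}"
  have "(\<lambda>i. if i = 0 then 1 else 0) \<in> ?K"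
    using N by (auto simp: sqnorm_def if_distrib[of "\<lambda>x. x\<^sup>2"] cong: if_cong)
  then have ne: "?K \<noteq> {}" by (intro notI) (simp only: empty_iff)
  have "continuous_on UNIV (quad N A)"
    unfolding quad_def by (intro continuous_intros) auto
  then have "continuous_on ?K (quad N A)" by (rule continuous_on_subset) simp
  from continuous_attains_sup[OF compact_unit_sphere_fun ne this]
  obtain v where v: "sqnorm N v = 1" "\<forall>i\<ge>N. v i = 0" and max: "\<And>z. z \<in> ?K \<Longrightarrow> quad N A z \<le> quad N A v"
    by blast
  define x where "x = quad N A v"
  have le: "quad N A z \<le> x * sqnorm N z" for z
  proof (cases "sqnorm N z > 0")
    case True
    define c where "c = 1 / sqrt (sqnorm N z)"
    define z' where "z' i = (if i < N then c * z i else 0)" for i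
    have c2: "c\<^sup>2 * sqnorm N z = 1" using True by (simp add: c_def power_divide)
    have "sqnorm N z' = c\<^sup>2 * sqnorm N z" "quad N A z' = c\<^sup>2 * quad N A z"
      unfolding sqnorm_scale[symmetric] quad_scale[symmetric]
      by (auto intro!: sqnorm_cong quad_cong simp: z'_def)
    with max[of z'] c2 have "c\<^sup>2 * quad N A z \<le> x" by (auto simp: z'_def x_def)
    then have "(c\<^sup>2 * quad N A z) * sqnorm N z \<le> x * sqnorm N z" using True by simp
    also have "(c\<^sup>2 * quad N A z) * sqnorm N z = quad N A z"
    proof -
      have "(c\<^sup>2 * quad N A z) * sqnorm N z = (c\<^sup>2 * sqnorm N z) * quad N A z" by simp
      then show ?thesis unfolding c2 by simp
    qed
    finally show ?thesis .
  next
    case False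
    then have "\<And>i. i < N \<Longrightarrow> z i = 0" "sqnorm N z = 0"
      using sqnorm_pos_iff[of N z] sqnorm_nonneg[of N z] by (auto simp: less_le)
    then show ?thesis by (simp add: quad_def)
  qed
  define u where "u i = x * v i - matvec N A v i" for i
  have "sqnorm N u = 0"
  proof (rule ccontr)
    assume "sqnorm N u \<noteq> 0"
    then have s: "sqnorm N u > 0" using sqnorm_nonneg[of N u] by linarith
    define C where "C = \<bar>x * sqnorm N u - quad N A u\<bar> + 1"
    define t where "t = - sqnorm N u / C"
    have C: "C > 0" by (simp add: C_def add_nonneg_pos)
    have "dotp N u u = x * dotp N u v - dotp N u (matvec N A v)"
      unfolding dotp_def sum_distrib_left sum_subtractf[symmetric]
      by (intro sum.cong) (auto simp: u_def algebra_simps)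
    moreover have "dotp N u u = sqnorm N u" by (simp add: dotp_def sqnorm_def power2_eq_square)
    ultimately have du: "x * dotp N u v - dotp N u (matvec N A v) = sqnorm N u" by simp
    have "quad N A (\<lambda>i. v i + t * u i) \<le> x * sqnorm N (\<lambda>i. v i + t * u i)" by (rule le)
    then have "0 \<le> 2 * t * (x * dotp N u v - dotp N u (matvec N A v)) + t\<^sup>2 * (x * sqnorm N u - quad N A u)"
      unfolding quad_add[OF sym] sqnorm_add using v(1) by (simp add: x_def algebra_simps)
    also have "\<dots> \<le> 2 * t * sqnorm N u + t\<^sup>2 * C"
      unfolding du by (intro add_left_mono mult_left_mono) (auto simp: C_def)
    also have "\<dots> = - (sqnorm N u)\<^sup>2 / C"
      using C by (simp add: t_def power2_eq_square field_simps)
    also have "\<dots> < 0" using s C by simp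
    finally show False by simp
  qed
  then have "\<forall>i<N. u i = 0" using sqnorm_pos_iff[of N u] by auto
  moreover have "\<exists>i<N. v i \<noteq> 0" using sqnorm_pos_iff[of N v] v(1) by simp
  ultimately have "eigenvalue (fmat N A) x"
    unfolding eigenvalue_mat_iff by (auto simp: u_def matvec_def)
  then show ?thesis using le that by blast
qed

lemma abs_quad_le_spectral:
  assumes sym: "symmetric_on N A"
    and L: "\<And>x. eigenvalue (fmat N A) x \<Longrightarrow> \<bar>x\<bar> \<le> L"
  shows "\<bar>quad N A z\<bar> \<le> L * sqnorm N z"
proof (cases "N = 0")
  case True
  then show ?thesis by (simp add: quad_def sqnorm_def)
next
  case False
  obtain x where x: "eigenvalue (fmat N A) x" "quad N A z \<le> x * sqnorm N z"
    using rayleigh_max_eigenvalue[OF sym] False by blast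
  have "symmetric_on N (\<lambda>i j. - A i j)" using sym by (simp add: symmetric_on_def)
  then obtain y where y: "eigenvalue (fmat N (\<lambda>i j. - A i j)) y"
      "quad N (\<lambda>i j. - A i j) z \<le> y * sqnorm N z"
    using rayleigh_max_eigenvalue False by blast
  have "eigenvalue (fmat N A) (- y)"
  proof -
    obtain v where v: "\<exists>i<N. v i \<noteq> 0" "\<And>i. i < N \<Longrightarrow> - (\<Sum>j<N. A i j * v j) = y * v i"
      using y(1) unfolding eigenvalue_mat_iff by (auto simp: sum_negf)
    have "(\<Sum>j<N. A i j * v j) = - y * v i" if "i < N" for i
      using v(2)[OF that] by linarith
    then show ?thesis unfolding eigenvalue_mat_iff using v(1) by blast
  qed
  then have "\<bar>y\<bar> \<le> L" using L by fastforce
  have "\<bar>x\<bar> \<le> L" using L x(1) by blast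
  have "quad N (\<lambda>i j. - A i j) z = - quad N A z" by (simp add: quad_def sum_negf)
  moreover have "x * sqnorm N z \<le> L * sqnorm N z" "y * sqnorm N z \<le> L * sqnorm N z"
    using \<open>\<bar>x\<bar> \<le> L\<close> \<open>\<bar>y\<bar> \<le> L\<close> by (auto intro!: mult_right_mono)
  ultimately show ?thesis using x(2) y(2) by linarith
qed

lemma eigenvalue_quad:
  assumes "eigenvalue (fmat N A) x"
  obtains v where "sqnorm N v = 1" "\<And>i. i < N \<Longrightarrow> matvec N A v i = x * v i" "quad N A v = x"
proof -
  obtain v where v: "\<exists>i<N. v i \<noteq> 0" "\<And>i. i < N \<Longrightarrow> matvec N A v i = x * v i"
    using assms unfolding eigenvalue_mat_iff matvec_def by blast
  define c where "c = 1 / sqrt (sqnorm N v)"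
  have c: "c\<^sup>2 * sqnorm N v = 1"
    using v(1) sqnorm_pos_iff[of N v] by (simp add: c_def power_divide)
  show ?thesis
  proof (rule that[of "\<lambda>i. c * v i"])
    show s: "sqnorm N (\<lambda>i. c * v i) = 1" using c by (simp add: sqnorm_scale)
    show m: "matvec N A (\<lambda>i. c * v i) i = x * (c * v i)" if "i < N" for i
    proof -
      have "matvec N A (\<lambda>i. c * v i) i = c * matvec N A v i"
        unfolding matvec_def sum_distrib_left by (intro sum.cong) auto
      then show ?thesis using v(2)[OF that] by simp
    qed
    have "quad N A (\<lambda>i. c * v i) = dotp N (\<lambda>i. c * v i) (\<lambda>i. x * (c * v i))"
      unfolding quad_eq_dotp dotp_def by (intro sum.cong) (auto simp: m)
    also have "\<dots> = x * sqnorm N (\<lambda>i. c * v i)"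
      by (simp add: dotp_def sqnorm_def sum_distrib_left power2_eq_square mult_ac)
    finally show "quad N A (\<lambda>i. c * v i) = x" using s by simp
  qed
qed

lemma finite_eigenvalues:
  fixes A :: "nat \<Rightarrow> nat \<Rightarrow> real"
  shows "finite {x. eigenvalue (fmat N A) x}"
proof -
  have "fmat N A \<in> carrier_mat N N" by simp
  moreover from degree_monic_char_poly[OF this] have "char_poly (fmat N A) \<noteq> 0"
    by (metis coeff_0 zero_neq_one)
  ultimately show ?thesis
    using poly_roots_finite by (subst eigenvalue_root_char_poly) auto
qed

definition rat_vectors :: "nat \<Rightarrow> (nat \<Rightarrow> real) set" where
  "rat_vectors N = PiE {..<N} (\<lambda>_. \<rat>)"

lemma countable_rat_vectors: "countable (rat_vectors N)"
  unfolding rat_vectors_def by (intro countable_PiE) (auto simp: countable_rat)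

lemma large_eigenvalue_iff_rat_vectors:
  assumes sym: "symmetric_on N A" and a: "a > 0"
  shows "(\<exists>x. eigenvalue (fmat N A) x \<and> \<bar>x\<bar> \<ge> a) \<longleftrightarrow>
    (\<forall>n. \<exists>z\<in>rat_vectors N. (a - 1 / real (Suc n)) * sqnorm N z < \<bar>quad N A z\<bar>)"
proof
  assume "\<exists>x. eigenvalue (fmat N A) x \<and> \<bar>x\<bar> \<ge> a"
  then obtain x v where x: "\<bar>x\<bar> \<ge> a" and v: "sqnorm N v = 1" "quad N A v = x"
    by (blast elim: eigenvalue_quad)
  show "\<forall>n. \<exists>z\<in>rat_vectors N. (a - 1 / real (Suc n)) * sqnorm N z < \<bar>quad N A z\<bar>"
  proof
    fix n
    have "\<exists>r\<in>\<rat>. v i < r \<and> r < v i + 1 / real (Suc k)" for i k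
      by (rule Rats_dense_in_real) simp
    then obtain r where r: "r i k \<in> \<rat>" "v i < r i k" "r i k < v i + 1 / real (Suc k)" for i k
      by metis
    have lim: "(\<lambda>k. r i k) \<longlonglongrightarrow> v i" for i
    proof (rule tendsto_sandwich[of "\<lambda>_. v i" _ _ "\<lambda>k. v i + 1 / real (Suc k)"])
      show "(\<lambda>k. v i + 1 / real (Suc k)) \<longlonglongrightarrow> v i"
        using tendsto_add[OF tendsto_const LIMSEQ_inverse_real_of_nat, of "v i"] by (simp add: inverse_eq_divide)
    qed (auto intro!: always_eventually less_imp_le r[simplified])
    have "(\<lambda>k. \<bar>quad N A (\<lambda>i. r i k)\<bar> - (a - 1 / real (Suc n)) * sqnorm N (\<lambda>i. r i k)) \<longlonglongrightarrow>
       \<bar>quad N A v\<bar> - (a - 1 / real (Suc n)) * sqnorm N v"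
      unfolding quad_def sqnorm_def by (intro tendsto_intros lim)
    moreover have "\<bar>quad N A v\<bar> - (a - 1 / real (Suc n)) * sqnorm N v > 0"
    proof -
      have "1 / real (Suc n) > 0" by simp
      then show ?thesis unfolding v mult_1_right using x by linarith
    qed
    ultimately have "eventually (\<lambda>k. \<bar>quad N A (\<lambda>i. r i k)\<bar> - (a - 1 / real (Suc n)) * sqnorm N (\<lambda>i. r i k) > 0) sequentially"
      by (rule order_tendstoD(1))
    then obtain k where k: "\<bar>quad N A (\<lambda>i. r i k)\<bar> - (a - 1 / real (Suc n)) * sqnorm N (\<lambda>i. r i k) > 0"
      by (auto simp: eventually_sequentially)
    show "\<exists>z\<in>rat_vectors N. (a - 1 / real (Suc n)) * sqnorm N z < \<bar>quad N A z\<bar>"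
      by (rule bexI[of _ "restrict (\<lambda>i. r i k) {..<N}"]) (use k r(1) in \<open>auto simp: rat_vectors_def\<close>)
  qed
next
  assume *: "\<forall>n. \<exists>z\<in>rat_vectors N. (a - 1 / real (Suc n)) * sqnorm N z < \<bar>quad N A z\<bar>"
  show "\<exists>x. eigenvalue (fmat N A) x \<and> \<bar>x\<bar> \<ge> a"
  proof (rule ccontr)
    assume no: "\<not> ?thesis"
    define E where "E = insert 0 (abs ` {x. eigenvalue (fmat N A) x})"
    have E: "finite E" "E \<noteq> {}" using finite_eigenvalues by (auto simp: E_def)
    have "Max E < a" using no a E by (subst Max_less_iff) (auto simp: E_def not_le)
    then obtain n where n: "1 / real (Suc n) < a - Max E"
      using reals_Archimedean[of "a - Max E"] by (auto simp: inverse_eq_divide)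
    obtain z where z: "(a - 1 / real (Suc n)) * sqnorm N z < \<bar>quad N A z\<bar>" using * by blast
    have "\<bar>quad N A z\<bar> \<le> Max E * sqnorm N z"
      by (rule abs_quad_le_spectral[OF sym]) (use E in \<open>auto simp: E_def intro!: Max_ge\<close>)
    also have "\<dots> \<le> (a - 1 / real (Suc n)) * sqnorm N z"
      using n by (intro mult_right_mono) auto
    finally show False using z by simp
  qed
qed

section \<open>Cone measure on the sphere\<close>

lemma unit_ball_vol_add2: "n \<ge> 0 \<Longrightarrow> unit_ball_vol (n + 2) = 2 * pi / (n + 2) * unit_ball_vol n"
proof -
  assume n: "n \<ge> 0"
  define G where "G = Gamma (n / 2 + 1)"
  have "n / 2 + 1 \<notin> \<int>\<^sub>\<le>\<^sub>0" using n by (auto dest: nonpos_Ints_nonpos)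
  then have 1: "Gamma ((n + 2) / 2 + 1) = (n / 2 + 1) * G"
    using Gamma_plus1[of "n / 2 + 1"] by (simp add: G_def add_divide_distrib)
  have 2: "pi powr ((n + 2) / 2) = pi * pi powr (n / 2)"
    by (simp add: add_divide_distrib powr_add)
  have "G > 0" using n by (simp add: G_def Gamma_real_pos)
  then show ?thesis unfolding unit_ball_vol_def 1 2 G_def[symmetric] using n
    by (simp add: divide_simps) 
qed

lemma unit_ball_vol_asymp:
  "(\<lambda>n. ln (unit_ball_vol (real n)) / real n + ln (real n) / 2) \<longlonglongrightarrow> 1/2 * ln pi + 1/2 + 1/2 * ln 2"
proof -
  define K where "K = 1/2 * ln pi + 1/2 + 1/2 * ln (2 :: real)"
  define u where "u n = ln (unit_ball_vol (real n)) + real n / 2 * ln (real n) - real n * K" for n :: nat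
  have step: "u (n + 2) \<le> u n" "u n - 2 / real n \<le> u (n + 2)" if "n \<ge> 2" for n
  proof -
    define x where "x = 2 / real n"
    have x: "x > 0" using that by (simp add: x_def)
    have "ln (unit_ball_vol (real (n + 2))) = ln 2 + ln pi - ln (real n + 2) + ln (unit_ball_vol (real n))"
    proof -
      have "unit_ball_vol (real n) \<noteq> 0" by (rule less_imp_neq[OF unit_ball_vol_pos, symmetric]) simp
      then show ?thesis using unit_ball_vol_add2[of "real n"]
        by (simp add: ln_mult ln_div add.commute)
    qed
    moreover have "ln (real n + 2) = ln (real n) + ln (1 + x)"
    proof -
      have "real n + 2 = real n * (1 + x)" using that by (simp add: x_def distrib_left)
      then show ?thesis using that x by (simp add: ln_mult_pos)
    qed
    ultimately have eq: "u (n + 2) - u n = real n / 2 * ln (1 + x) - 1"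
      by (simp add: u_def K_def algebra_simps add_divide_distrib)
    have "ln (1 + x) \<le> x" using x ln_add_one_self_le_self[of x] by simp
    then have "real n / 2 * ln (1 + x) \<le> real n / 2 * x" by (intro mult_left_mono) auto
    also have "\<dots> = 1" using that by (simp add: x_def)
    finally show "u (n + 2) \<le> u n" using eq by simp
    have "x - x\<^sup>2 \<le> ln (1 + x)"
      using x that by (intro ln_one_plus_pos_lower_bound) (auto simp: x_def)
    then have "real n / 2 * (x - x\<^sup>2) \<le> real n / 2 * ln (1 + x)" by (intro mult_left_mono) auto
    moreover have "real n / 2 * (x - x\<^sup>2) = 1 - 2 / real n"
      using that by (simp add: x_def field_simps power2_eq_square)
    ultimately show "u n - 2 / real n \<le> u (n + 2)" using eq by simp
  qed
  define c where "c = min (u 2) (u 3)"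
  define C where "C = max (u 2) (u 3)"
  have bounds: "c - 2 * ln (real n) \<le> u n \<and> u n \<le> C" if "n \<ge> 2" for n
    using that
  proof (induction n rule: less_induct)
    case (less n)
    show ?case
    proof (cases "n < 4")
      case True
      then have "n = 2 \<or> n = 3" using less.prems by auto
      moreover have "ln (real n) \<ge> 0" using less.prems by simp
      moreover have "c \<le> u 2" "c \<le> u 3" "u 2 \<le> C" "u 3 \<le> C" by (auto simp: c_def C_def)
      ultimately show ?thesis by (elim disjE) (auto intro: order_trans[of _ c])
    next
      case False
      define k where "k = n - 2"
      have k: "n = k + 2" "k \<ge> 2" using False by (auto simp: k_def)
      have IH: "c - 2 * ln (real k) \<le> u k" "u k \<le> C" using less.IH[of k] k by auto
      have "1 / real k \<le> ln (real (k + 2)) - ln (real k)"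
      proof -
        define y where "y = real k / (real k + 2)"
        have y: "y > 0" using k by (simp add: y_def)
        have "ln y \<le> y - 1" using y by (rule ln_le_minus_one)
        also have "y - 1 = - (2 / (real k + 2))" using k by (simp add: y_def field_simps)
        also have "\<dots> \<le> - (1 / real k)" using k by (simp add: field_simps)
        finally show ?thesis using k by (simp add: y_def ln_div add.commute)
      qed
      then show ?thesis using IH step[of k] k by auto
    qed
  qed
  have "(\<lambda>n. u n / real n) \<longlonglongrightarrow> 0"
  proof (rule tendsto_sandwich)
    show "eventually (\<lambda>n. (c - 2 * ln (real n)) / real n \<le> u n / real n) sequentially"
      using eventually_ge_at_top[of 2] by eventually_elim (use bounds in \<open>auto intro!: divide_right_mono\<close>)
    show "eventually (\<lambda>n. u n / real n \<le> C / real n) sequentially"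
      using eventually_ge_at_top[of 2] by eventually_elim (use bounds in \<open>auto intro!: divide_right_mono\<close>)
    show "(\<lambda>n. (c - 2 * ln (real n)) / real n) \<longlonglongrightarrow> 0" by real_asymp
    show "(\<lambda>n. C / real n) \<longlonglongrightarrow> 0" by real_asymp
  qed
  then have "(\<lambda>n. u n / real n + K) \<longlonglongrightarrow> 0 + K" by (intro tendsto_intros)
  then show ?thesis unfolding K_def[symmetric] add_0
  proof (rule Lim_transform_eventually)
    show "eventually (\<lambda>n. u n / real n + K = ln (unit_ball_vol (real n)) / real n + ln (real n) / 2) sequentially"
      using eventually_gt_at_top[of 0] by eventually_elim (auto simp: u_def field_simps)
  qed
qed

lemma emeasure_lebN_unit_ball:
  "emeasure (lebN N) {z \<in> space (lebN N). sqnorm N z \<le> 1} = ennreal (unit_ball_vol (real N))"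
proof -
  have "{z \<in> space (lebN N). sqnorm N z \<le> 1} =
      {f. sqrt (\<Sum>i<N. (f i)\<^sup>2) \<le> 1} \<inter> space (Pi\<^sub>M {..<N} (\<lambda>_. lborel))"
    by (auto simp: lebN_def sqnorm_def)
  then show ?thesis using emeasure_cball_aux[of "{..<N}" 1] by (simp add: lebN_def)
qed

definition ball_int :: "nat \<Rightarrow> (nat \<Rightarrow> nat \<Rightarrow> real) \<Rightarrow> real \<Rightarrow> ennreal" where
  "ball_int N A k = (\<integral>\<^sup>+z. ennreal (exp (k * (quad N A z / sqnorm N z))) * indicator {..1} (sqnorm N z) \<partial>lebN N)"

lemma nn_integral_lebN_scale:
  assumes "f \<in> borel_measurable (lebN N)" "c > 0"
  shows "(\<integral>\<^sup>+z. f z \<partial>lebN N) = ennreal (c ^ N) * (\<integral>\<^sup>+z. f (restrict (\<lambda>i. c * z i) {..<N}) \<partial>lebN N)"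
  using nn_integral_lebN_affine[OF assms, of "\<lambda>_. 0"] by simp

lemma ball_int_scale:
  assumes c: "c > 0"
  shows "(\<integral>\<^sup>+z. ennreal (exp (k * (quad N A z / sqnorm N z))) * indicator {..c\<^sup>2} (sqnorm N z) \<partial>lebN N) =
    ennreal (c ^ N) * ball_int N A k"
proof -
  have "indicator {..c\<^sup>2} (c\<^sup>2 * x) = (indicator {..1} x :: ennreal)" for x
    using c by (auto simp: indicator_def)
  then show ?thesis
    unfolding ball_int_def using c
    by (subst nn_integral_lebN_scale[where c=c]) (simp_all add: quad_scale sqnorm_scale)
qed

lemma ball_int_bounds:
  assumes L: "\<And>z. \<bar>quad N A z\<bar> \<le> L * sqnorm N z" and "k \<ge> 0" "L \<ge> 0"
  shows "ennreal (exp (- (k * L)) * unit_ball_vol (real N)) \<le> ball_int N A k"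
    and "ball_int N A k \<le> ennreal (exp (k * L) * unit_ball_vol (real N))"
proof -
  have B: "(\<integral>\<^sup>+z. ennreal x * indicator {..1} (sqnorm N z) \<partial>lebN N) = ennreal (x * unit_ball_vol (real N))" if "x \<ge> 0" for x
  proof -
    have "(\<integral>\<^sup>+z. ennreal x * indicator {..1} (sqnorm N z) \<partial>lebN N) =
       (\<integral>\<^sup>+z. ennreal x * indicator {z \<in> space (lebN N). sqnorm N z \<le> 1} z \<partial>lebN N)"
      by (intro nn_integral_cong) (auto simp: indicator_def)
    also have "\<dots> = ennreal x * ennreal (unit_ball_vol (real N))"
      by (subst nn_integral_cmult_indicator) (simp_all add: emeasure_lebN_unit_ball)
    finally show ?thesis using that by (simp add: ennreal_mult)
  qed
  have ang: "\<bar>quad N A z / sqnorm N z\<bar> \<le> L" for z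
  proof (cases "sqnorm N z = 0")
    case False
    then have "sqnorm N z > 0" using sqnorm_nonneg[of N z] by linarith
    then show ?thesis using L[of z] by (simp add: abs_divide divide_le_eq)
  qed (use assms in auto)
  have *: "- (k * L) \<le> k * (quad N A z / sqnorm N z)" "k * (quad N A z / sqnorm N z) \<le> k * L" for z
  proof -
    have "- L \<le> quad N A z / sqnorm N z" "quad N A z / sqnorm N z \<le> L" using ang[of z] by linarith+
    from this[THEN mult_left_mono, OF assms(2)]
    show "- (k * L) \<le> k * (quad N A z / sqnorm N z)" "k * (quad N A z / sqnorm N z) \<le> k * L" by simp_all
  qed
  show "ennreal (exp (- (k * L)) * unit_ball_vol (real N)) \<le> ball_int N A k"
    unfolding ball_int_def B[symmetric, OF less_imp_le[OF exp_gt_zero]]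
    by (intro nn_integral_mono mult_right_mono ennreal_leI) (use * in auto)
  show "ball_int N A k \<le> ennreal (exp (k * L) * unit_ball_vol (real N))"
    unfolding ball_int_def B[symmetric, OF less_imp_le[OF exp_gt_zero]]
    by (intro nn_integral_mono mult_right_mono ennreal_leI) (use * in auto)
qed

lemma hamiltonian_eq: "hamiltonian N J z = - quad N (\<lambda>i j. J i j / sqrt (real N)) z"
  unfolding hamiltonian_def quad_def by (simp add: sum_distrib_left sum_negf)

lemma hamiltonian_measurable [measurable]: "hamiltonian N J \<in> borel_measurable (lebN N)"
  unfolding hamiltonian_eq[abs_def] by measurable

lemma sphere_proj_measurable [measurable]:
  "(\<lambda>z. restrict (\<lambda>i. r * z i / sqrt (sqnorm N z)) {..<N}) \<in> measurable (lebN N) (lebN N)"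
proof (rule measurable_lebN_restrict)
  fix i assume "i < N"
  note [measurable] = measurable_lebN_component[OF this]
  show "(\<lambda>z. r * z i / sqrt (sqnorm N z)) \<in> borel_measurable (lebN N)" by measurable
qed

lemma Z_sf_eq_ball_int:
  assumes "R > 0"
  shows "Z_sf N J \<beta> R = enn2real (ball_int N (\<lambda>i j. J i j / sqrt (real N)) (\<beta> * (R\<^sup>2 * real N)) /
    ennreal (unit_ball_vol (real N)))"
proof -
  let ?A = "\<lambda>i j. J i j / sqrt (real N)"
  let ?B = "{z \<in> space (lebN N). sqnorm N z \<le> 1}"
  let ?p = "\<lambda>z. restrict (\<lambda>i. R * sqrt (real N) * z i / sqrt (sqnorm N z)) {..<N}"
  have B [measurable]: "?B \<in> sets (lebN N)" by measurable
  have "Z_sf N J \<beta> R = enn2real (\<integral>\<^sup>+z. ennreal (exp (- \<beta> * hamiltonian N J z)) \<partial>sphere_measure N (R * sqrt N))"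
    unfolding Z_sf_def
    by (intro integral_eq_nn_integral) (auto simp: sphere_measure_def)
  also have "(\<integral>\<^sup>+z. ennreal (exp (- \<beta> * hamiltonian N J z)) \<partial>sphere_measure N (R * sqrt N)) =
      (\<integral>\<^sup>+z. ennreal (exp (- \<beta> * hamiltonian N J (?p z))) \<partial>uniform_measure (lebN N) ?B)"
    unfolding sphere_measure_def by (subst nn_integral_distr) auto
  also have "\<dots> = (\<integral>\<^sup>+z. ennreal (exp (- \<beta> * hamiltonian N J (?p z))) * indicator ?B z \<partial>lebN N) / emeasure (lebN N) ?B"
    by (rule nn_integral_uniform_measure) measurable
  also have "(\<integral>\<^sup>+z. ennreal (exp (- \<beta> * hamiltonian N J (?p z))) * indicator ?B z \<partial>lebN N) =
      ball_int N ?A (\<beta> * (R\<^sup>2 * real N))"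
    unfolding ball_int_def
  proof (intro nn_integral_cong)
    fix z assume z: "z \<in> space (lebN N)"
    have "hamiltonian N J (?p z) = - quad N ?A (\<lambda>i. (R * sqrt (real N) / sqrt (sqnorm N z)) * z i)"
      unfolding hamiltonian_eq quad_restrict by (simp add: mult.commute)
    also have "\<dots> = - ((R * sqrt (real N) / sqrt (sqnorm N z))\<^sup>2 * quad N ?A z)"
      by (simp only: quad_scale)
    also have "(R * sqrt (real N) / sqrt (sqnorm N z))\<^sup>2 = R\<^sup>2 * real N / sqnorm N z"
      by (simp add: power_divide power_mult_distrib)
    finally have h: "hamiltonian N J (?p z) = - (R\<^sup>2 * real N / sqnorm N z * quad N ?A z)" .
    have "- \<beta> * hamiltonian N J (?p z) = \<beta> * (R\<^sup>2 * real N) * (quad N ?A z / sqnorm N z)"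
      unfolding h by simp
    moreover have "indicator ?B z = (indicator {..1} (sqnorm N z) :: ennreal)"
      using z by (auto simp: indicator_def)
    ultimately show "ennreal (exp (- \<beta> * hamiltonian N J (?p z))) * indicator ?B z =
        ennreal (exp (\<beta> * (R\<^sup>2 * real N) * (quad N ?A z / sqnorm N z))) * indicator {..1} (sqnorm N z)"
      by simp
  qed
  finally show ?thesis by (simp add: emeasure_lebN_unit_ball)
qed

lemma Z_sf_bounds:
  assumes R: "R > 0" and b: "\<beta> > 0" and L: "L \<ge> 0" "\<And>z. \<bar>quad N (\<lambda>i j. J i j / sqrt (real N)) z\<bar> \<le> L * sqnorm N z"
  shows "exp (- (\<beta> * (R\<^sup>2 * real N) * L)) \<le> Z_sf N J \<beta> R" "Z_sf N J \<beta> R \<le> exp (\<beta> * (R\<^sup>2 * real N) * L)"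
    "ball_int N (\<lambda>i j. J i j / sqrt (real N)) (\<beta> * (R\<^sup>2 * real N)) = ennreal (Z_sf N J \<beta> R * unit_ball_vol (real N))"
proof -
  let ?k = "\<beta> * (R\<^sup>2 * real N)"
  let ?I = "ball_int N (\<lambda>i j. J i j / sqrt (real N)) ?k"
  let ?v = "unit_ball_vol (real N)"
  have v: "?v > 0" by simp
  have k: "?k \<ge> 0" using b by simp
  note bd = ball_int_bounds[OF L(2) k L(1)]
  have "?I < \<infinity>" using bd(2) by (simp add: le_less_trans[OF _ ennreal_less_top])
  then obtain x where x: "?I = ennreal x" "x \<ge> 0" by (cases ?I) auto
  have Z: "Z_sf N J \<beta> R = x / ?v"
    unfolding Z_sf_eq_ball_int[OF R] x(1) using v x(2) by (simp add: divide_ennreal)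
  have "exp (- (?k * L)) * ?v \<le> x" "x \<le> exp (?k * L) * ?v"
    using bd x by (auto simp: ennreal_le_iff2 mult_le_0_iff)
  then show "exp (- (?k * L)) \<le> Z_sf N J \<beta> R" "Z_sf N J \<beta> R \<le> exp (?k * L)"
    unfolding Z using v by (auto simp: field_simps)
  show "?I = ennreal (Z_sf N J \<beta> R * ?v)" unfolding Z x(1) using less_imp_neq[OF v] by simp
qed

definition shell_int :: "nat \<Rightarrow> (nat \<Rightarrow> nat \<Rightarrow> real) \<Rightarrow> real \<Rightarrow> real \<Rightarrow> real \<Rightarrow> ennreal" where
  "shell_int N A \<beta> a b = (\<integral>\<^sup>+z. ennreal (exp (\<beta> * quad N A z)) * indicator {real N * a<..real N * b} (sqnorm N z) \<partial>lebN N)"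

lemma shell_int_Z_sf:
  assumes R: "R > 0" and b: "\<beta> > 0" and L: "L \<ge> 0" "\<And>z. \<bar>quad N (\<lambda>i j. J i j / sqrt (real N)) z\<bar> \<le> L * sqnorm N z"
    and d: "0 < d" "d < 1" and N: "N > 0"
  defines "v \<equiv> unit_ball_vol (real N) * (sqrt (real N * (R\<^sup>2 * (1 + d))) ^ N - sqrt (real N * (R\<^sup>2 * (1 - d))) ^ N)"
  shows "ennreal (exp (- (\<beta> * L * d * R\<^sup>2 * real N)) * (Z_sf N J \<beta> R * v)) \<le>
      shell_int N (\<lambda>i j. J i j / sqrt (real N)) \<beta> (R\<^sup>2 * (1 - d)) (R\<^sup>2 * (1 + d))"
    and "shell_int N (\<lambda>i j. J i j / sqrt (real N)) \<beta> (R\<^sup>2 * (1 - d)) (R\<^sup>2 * (1 + d)) \<le>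
      ennreal (exp (\<beta> * L * d * R\<^sup>2 * real N) * (Z_sf N J \<beta> R * v))"
proof -
  let ?A = "\<lambda>i j. J i j / sqrt (real N)"
  let ?k = "\<beta> * (R\<^sup>2 * real N)"
  let ?f = "\<lambda>z. ennreal (exp (?k * (quad N ?A z / sqnorm N z)))"
  define p where "p = sqrt (real N * (R\<^sup>2 * (1 - d)))"
  define r where "r = sqrt (real N * (R\<^sup>2 * (1 + d)))"
  have p: "p > 0" "p\<^sup>2 = real N * (R\<^sup>2 * (1 - d))" using R N d by (auto simp: p_def)
  have r: "r > 0" "r\<^sup>2 = real N * (R\<^sup>2 * (1 + d))" using R N d by (auto simp: r_def)
  have pr: "p \<le> r" using R N d by (auto simp: p_def r_def)
  have pr2: "p\<^sup>2 \<le> r\<^sup>2" using pr p by (intro power_mono) auto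
  note Z = Z_sf_bounds[OF R b L]
  have Zv: "Z_sf N J \<beta> R * unit_ball_vol (real N) \<ge> 0"
    using less_imp_le[OF less_le_trans[OF exp_gt_zero Z(1)]] by simp
  define Y where "Y = (\<integral>\<^sup>+z. ?f z * indicator {p\<^sup>2<..r\<^sup>2} (sqnorm N z) \<partial>lebN N)"
  have "ennreal (r ^ N * (Z_sf N J \<beta> R * unit_ball_vol (real N))) = (\<integral>\<^sup>+z. ?f z * indicator {..r\<^sup>2} (sqnorm N z) \<partial>lebN N)"
    using ball_int_scale[OF r(1), of N ?k ?A] Z(3) r Zv by (simp add: ennreal_mult)
  also have "\<dots> = (\<integral>\<^sup>+z. ?f z * indicator {..p\<^sup>2} (sqnorm N z) + ?f z * indicator {p\<^sup>2<..r\<^sup>2} (sqnorm N z) \<partial>lebN N)"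
    using pr2 by (intro nn_integral_cong) (auto simp: indicator_def)
  also have "\<dots> = (\<integral>\<^sup>+z. ?f z * indicator {..p\<^sup>2} (sqnorm N z) \<partial>lebN N) + Y"
    unfolding Y_def by (rule nn_integral_add) measurable
  also have "(\<integral>\<^sup>+z. ?f z * indicator {..p\<^sup>2} (sqnorm N z) \<partial>lebN N) = ennreal (p ^ N * (Z_sf N J \<beta> R * unit_ball_vol (real N)))"
    using ball_int_scale[OF p(1), of N ?k ?A] Z(3) p Zv by (simp add: ennreal_mult)
  finally have eq: "ennreal (r ^ N * (Z_sf N J \<beta> R * unit_ball_vol (real N))) =
      ennreal (p ^ N * (Z_sf N J \<beta> R * unit_ball_vol (real N))) + Y" .
  have Y: "Y = ennreal (Z_sf N J \<beta> R * v)"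
  proof -
    have "Y \<noteq> \<infinity>" using eq by auto
    then obtain y where y: "Y = ennreal y" "y \<ge> 0" by (cases Y) auto
    have "r ^ N * (Z_sf N J \<beta> R * unit_ball_vol (real N)) = p ^ N * (Z_sf N J \<beta> R * unit_ball_vol (real N)) + y"
    proof -
      have "ennreal (r ^ N * (Z_sf N J \<beta> R * unit_ball_vol (real N))) =
          ennreal (p ^ N * (Z_sf N J \<beta> R * unit_ball_vol (real N)) + y)"
        unfolding eq y(1) using p Zv y(2) by (intro ennreal_plus[symmetric]) auto
      then show ?thesis using p r Zv y(2) by (subst (asm) ennreal_inj) auto
    qed
    then show ?thesis unfolding y(1) v_def p_def[symmetric] r_def[symmetric] by (simp add: algebra_simps)
  qed
  have est: "\<bar>\<beta> * quad N ?A z - ?k * (quad N ?A z / sqnorm N z)\<bar> \<le> \<beta> * L * d * R\<^sup>2 * real N"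
    if "sqnorm N z \<in> {p\<^sup>2<..r\<^sup>2}" for z
  proof -
    have "p\<^sup>2 < sqnorm N z" using that by simp
    then have s: "sqnorm N z > 0" using zero_less_power[OF p(1), of 2] by linarith
    have dd: "\<bar>sqnorm N z - R\<^sup>2 * real N\<bar> \<le> d * R\<^sup>2 * real N"
      using that unfolding p r by (auto simp: abs_le_iff algebra_simps)
    have "\<beta> * quad N ?A z - ?k * (quad N ?A z / sqnorm N z) = \<beta> * (quad N ?A z / sqnorm N z) * (sqnorm N z - R\<^sup>2 * real N)"
      using s by (simp add: field_simps)
    also have "\<bar>\<dots>\<bar> = \<beta> * \<bar>quad N ?A z / sqnorm N z\<bar> * \<bar>sqnorm N z - R\<^sup>2 * real N\<bar>"
      using b by (simp add: abs_mult)
    also have "\<dots> \<le> \<beta> * L * (d * R\<^sup>2 * real N)"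
      using L(2)[of z] s b dd L(1) by (intro mult_mono) (auto simp: abs_divide divide_le_eq)
    finally show ?thesis by (simp add: mult_ac)
  qed
  have shell: "shell_int N ?A \<beta> (R\<^sup>2 * (1 - d)) (R\<^sup>2 * (1 + d)) =
     (\<integral>\<^sup>+z. ennreal (exp (\<beta> * quad N ?A z)) * indicator {p\<^sup>2<..r\<^sup>2} (sqnorm N z) \<partial>lebN N)"
    unfolding shell_int_def p(2) r(2) ..
  have vv: "v \<ge> 0" unfolding v_def p_def[symmetric] r_def[symmetric]
    using pr p by (intro mult_nonneg_nonneg) (auto intro!: power_mono)
  then have Zvv: "Z_sf N J \<beta> R * v \<ge> 0" using less_imp_le[OF less_le_trans[OF exp_gt_zero Z(1)]] by simp
  have cm: "(\<integral>\<^sup>+z. ennreal x * (?f z * indicator {p\<^sup>2<..r\<^sup>2} (sqnorm N z)) \<partial>lebN N) =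
      ennreal (x * (Z_sf N J \<beta> R * v))" if "x \<ge> 0" for x
  proof -
    have "(\<integral>\<^sup>+z. ennreal x * (?f z * indicator {p\<^sup>2<..r\<^sup>2} (sqnorm N z)) \<partial>lebN N) = ennreal x * Y"
      unfolding Y_def by (rule nn_integral_cmult) measurable
    also have "\<dots> = ennreal (x * (Z_sf N J \<beta> R * v))"
      unfolding Y using that Zvv by (intro ennreal_mult[symmetric])
    finally show ?thesis .
  qed
  have "ennreal (exp (- (\<beta> * L * d * R\<^sup>2 * real N)) * (Z_sf N J \<beta> R * v)) =
      (\<integral>\<^sup>+z. ennreal (exp (- (\<beta> * L * d * R\<^sup>2 * real N))) * (?f z * indicator {p\<^sup>2<..r\<^sup>2} (sqnorm N z)) \<partial>lebN N)"
    by (simp only: cm[OF less_imp_le[OF exp_gt_zero]])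
  also have "\<dots> \<le> shell_int N ?A \<beta> (R\<^sup>2 * (1 - d)) (R\<^sup>2 * (1 + d))"
    unfolding shell
  proof (intro nn_integral_mono)
    fix z
    show "ennreal (exp (- (\<beta> * L * d * R\<^sup>2 * real N))) * (?f z * indicator {p\<^sup>2<..r\<^sup>2} (sqnorm N z)) \<le>
        ennreal (exp (\<beta> * quad N ?A z)) * indicator {p\<^sup>2<..r\<^sup>2} (sqnorm N z)"
      using est[of z] by (auto simp: indicator_def ennreal_mult[symmetric] exp_add[symmetric] abs_le_iff intro!: ennreal_leI)
  qed
  finally show "ennreal (exp (- (\<beta> * L * d * R\<^sup>2 * real N)) * (Z_sf N J \<beta> R * v)) \<le>
      shell_int N ?A \<beta> (R\<^sup>2 * (1 - d)) (R\<^sup>2 * (1 + d))" .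
  have "shell_int N ?A \<beta> (R\<^sup>2 * (1 - d)) (R\<^sup>2 * (1 + d)) \<le>
      (\<integral>\<^sup>+z. ennreal (exp (\<beta> * L * d * R\<^sup>2 * real N)) * (?f z * indicator {p\<^sup>2<..r\<^sup>2} (sqnorm N z)) \<partial>lebN N)"
    unfolding shell
  proof (intro nn_integral_mono)
    fix z
    show "ennreal (exp (\<beta> * quad N ?A z)) * indicator {p\<^sup>2<..r\<^sup>2} (sqnorm N z) \<le>
       ennreal (exp (\<beta> * L * d * R\<^sup>2 * real N)) * (?f z * indicator {p\<^sup>2<..r\<^sup>2} (sqnorm N z))"
      using est[of z] by (auto simp: indicator_def ennreal_mult[symmetric] exp_add[symmetric] abs_le_iff intro!: ennreal_leI)
  qed
  also have "\<dots> = ennreal (exp (\<beta> * L * d * R\<^sup>2 * real N) * (Z_sf N J \<beta> R * v))"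
    by (simp only: cm[OF less_imp_le[OF exp_gt_zero]])
  finally show "shell_int N ?A \<beta> (R\<^sup>2 * (1 - d)) (R\<^sup>2 * (1 + d)) \<le>
      ennreal (exp (\<beta> * L * d * R\<^sup>2 * real N) * (Z_sf N J \<beta> R * v))" .
qed

lemma shell_volume_asymp:
  assumes s: "s > 0" and d: "0 < d" "d < 1"
  shows "(\<lambda>N. ln (unit_ball_vol (real N) * (sqrt (real N * (s * (1 + d))) ^ N - sqrt (real N * (s * (1 - d))) ^ N)) / real N)
    \<longlonglongrightarrow> 1/2 * ln pi + 1/2 + 1/2 * ln 2 + 1/2 * ln (s * (1 + d))"
    and "N > 0 \<Longrightarrow> 0 < unit_ball_vol (real N) * (sqrt (real N * (s * (1 + d))) ^ N - sqrt (real N * (s * (1 - d))) ^ N)"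
proof -
  define x where "x = sqrt ((1 - d) / (1 + d))"
  have x: "0 < x" "x < 1" using d by (auto simp: x_def)
  have eq: "sqrt (real N * (s * (1 + d))) ^ N - sqrt (real N * (s * (1 - d))) ^ N = sqrt (real N * (s * (1 + d))) ^ N * (1 - x ^ N)" for N
  proof -
    have "real N * (s * (1 - d)) = real N * (s * (1 + d)) * ((1 - d) / (1 + d))" using d by simp
    then have "sqrt (real N * (s * (1 - d))) = sqrt (real N * (s * (1 + d))) * x"
      by (simp only: x_def real_sqrt_mult)
    then show ?thesis by (simp add: power_mult_distrib right_diff_distrib)
  qed
  have xN: "0 < 1 - x ^ N" "1 - x \<le> 1 - x ^ N" "1 - x ^ N \<le> 1" if "N > 0" for N
    using x that power_decreasing[of 1 N x] by (auto simp: power_Suc_less_one power_less_one_iff)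
  show "0 < unit_ball_vol (real N) * (sqrt (real N * (s * (1 + d))) ^ N - sqrt (real N * (s * (1 - d))) ^ N)" if "N > 0"
    unfolding eq using xN[OF that] that s d by (intro mult_pos_pos) auto
  have "(\<lambda>N. ln (1 - x ^ N) / real N) \<longlonglongrightarrow> 0"
  proof (rule tendsto_sandwich)
    show "eventually (\<lambda>N. ln (1 - x) / real N \<le> ln (1 - x ^ N) / real N) sequentially"
      using eventually_gt_at_top[of 0] by eventually_elim (use xN x in \<open>auto intro!: divide_right_mono\<close>)
    show "eventually (\<lambda>N. ln (1 - x ^ N) / real N \<le> 0) sequentially"
      using eventually_gt_at_top[of 0] by eventually_elim (use xN x in \<open>auto intro!: divide_nonpos_nonneg simp: ln_le_zero_iff\<close>)
    show "(\<lambda>N. ln (1 - x) / real N) \<longlonglongrightarrow> 0" by real_asymp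
  qed simp
  then have lim: "(\<lambda>N. (ln (unit_ball_vol (real N)) / real N + ln (real N) / 2) + ln (s * (1 + d)) / 2 + ln (1 - x ^ N) / real N) \<longlonglongrightarrow>
     (1/2 * ln pi + 1/2 + 1/2 * ln 2) + ln (s * (1 + d)) / 2 + 0"
    by (intro tendsto_intros unit_ball_vol_asymp)
  have ev: "eventually (\<lambda>N. (ln (unit_ball_vol (real N)) / real N + ln (real N) / 2) + ln (s * (1 + d)) / 2 + ln (1 - x ^ N) / real N =
      ln (unit_ball_vol (real N) * (sqrt (real N * (s * (1 + d))) ^ N - sqrt (real N * (s * (1 - d))) ^ N)) / real N) sequentially"
    using eventually_gt_at_top[of 0]
  proof eventually_elim
    case (elim N)
    have "ln (unit_ball_vol (real N) * (sqrt (real N * (s * (1 + d))) ^ N * (1 - x ^ N))) =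
       ln (unit_ball_vol (real N)) + (real N * (ln (real N) + ln (s * (1 + d))) / 2 + ln (1 - x ^ N))"
      using elim xN[OF elim] s d
      by (subst ln_mult_pos, simp, simp, subst ln_mult_pos, simp, simp)
        (simp add: ln_realpow ln_sqrt ln_mult_pos)
    then show ?case unfolding eq using elim by (simp add: field_simps)
  qed
  show "(\<lambda>N. ln (unit_ball_vol (real N) * (sqrt (real N * (s * (1 + d))) ^ N - sqrt (real N * (s * (1 - d))) ^ N)) / real N)
    \<longlonglongrightarrow> 1/2 * ln pi + 1/2 + 1/2 * ln 2 + 1/2 * ln (s * (1 + d))"
    using Lim_transform_eventually[OF lim ev] by simp
qed

section \<open>The semicircle law and its Legendre transforms\<close>

lemma continuous_coercive_attains_min:
  fixes f :: "real \<Rightarrow> real"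
  assumes "continuous_on {a..} f" and c: "c > 0" and ge: "\<And>x. x \<ge> a \<Longrightarrow> c * x - K \<le> f x"
  obtains x where "x \<ge> a" "\<And>y. y \<ge> a \<Longrightarrow> f x \<le> f y"
proof -
  define b where "b = max a ((f a + K) / c)"
  have "continuous_on {a..b} f" by (rule continuous_on_subset[OF assms(1)]) auto
  then obtain x where x: "x \<in> {a..b}" "\<And>y. y \<in> {a..b} \<Longrightarrow> f x \<le> f y"
    using continuous_attains_inf[of "{a..b}" f] by (auto simp: b_def)
  have "f x \<le> f y" if "y \<ge> a" for y
  proof (cases "y \<le> b")
    case False
    then have "(f a + K) / c \<le> y" by (simp add: b_def)
    then have "f a \<le> c * y - K" using c by (simp add: field_simps)
    then show ?thesis using ge[OF that] x(2)[of a] by (simp add: b_def)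
  qed (use x that in auto)
  then show ?thesis using x that by auto
qed

definition sc_measure :: "real \<Rightarrow> real measure" where
  "sc_measure lb = density lborel (\<lambda>\<mu>. ennreal (indicator {-lb..lb} \<mu> * semicircle lb \<mu>))"

locale semicircle_params =
  fixes lb \<beta> :: real
  assumes lb_pos: "lb > 0" and beta_pos: "\<beta> > 0"
begin

abbreviation "S \<equiv> sc_measure lb"

lemma semicircle_nonneg: "\<mu> \<in> {-lb..lb} \<Longrightarrow> semicircle lb \<mu> \<ge> 0"
  unfolding semicircle_def using lb_pos
  by (auto intro!: divide_nonneg_pos real_sqrt_ge_zero abs_le_square_iff[THEN iffD1, of \<mu> lb, simplified])

lemma semicircle_measurable [measurable]: "semicircle lb \<in> borel_measurable borel"
  unfolding semicircle_def by measurable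

lemma semicircle_le: "\<mu> \<in> {-lb..lb} \<Longrightarrow> semicircle lb \<mu> \<le> 2 * lb / (pi * lb\<^sup>2)"
  unfolding semicircle_def using lb_pos
  by (auto intro!: divide_right_mono real_le_lsqrt)

lemma ind_sc_nonneg: "0 \<le> indicator {-lb..lb} \<mu> * semicircle lb \<mu>"
  using semicircle_nonneg by (auto simp: indicator_def)

lemma sets_sc [measurable_cong, simp]: "sets S = sets borel"
  by (simp add: sc_measure_def)

lemma space_sc [simp]: "space S = UNIV"
  by (simp add: sc_measure_def)

lemma integral_sc:
  fixes f :: "real \<Rightarrow> real"
  assumes [measurable]: "f \<in> borel_measurable borel"
  shows "(LBINT \<mu>:{-lb..lb}. semicircle lb \<mu> * f \<mu>) = (\<integral>\<mu>. f \<mu> \<partial>S)"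
  unfolding sc_measure_def set_lebesgue_integral_def
  by (subst integral_density) (auto simp: ind_sc_nonneg mult.assoc)

lemma finite_measure_sc: "finite_measure S"
proof
  have "emeasure S (space S) = (\<integral>\<^sup>+\<mu>. ennreal (indicator {-lb..lb} \<mu> * semicircle lb \<mu>) \<partial>lborel)"
    by (simp add: sc_measure_def emeasure_density)
  also have "\<dots> \<le> (\<integral>\<^sup>+\<mu>. ennreal (2 * lb / (pi * lb\<^sup>2)) * indicator {-lb..lb} \<mu> \<partial>lborel)"
    using semicircle_le by (intro nn_integral_mono) (auto simp: indicator_def intro!: ennreal_leI)
  also have "\<dots> = ennreal (2 * lb / (pi * lb\<^sup>2)) * ennreal (2 * lb)"
    using lb_pos by (simp add: nn_integral_cmult_indicator)
  also have "\<dots> < \<infinity>" by (simp add: ennreal_mult_less_top)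
  finally show "emeasure S (space S) \<noteq> \<infinity>" by simp
qed

sublocale SC: finite_measure S by (rule finite_measure_sc)

lemma AE_sc: "AE \<mu> in S. -lb < \<mu> \<and> \<mu> < lb"
proof -
  have "AE \<mu> in lborel. \<mu> \<noteq> lb \<and> \<mu> \<noteq> -lb"
    by (intro AE_conjI AE_lborel_singleton)
  then show ?thesis unfolding sc_measure_def
    by (subst AE_density) (auto elim!: AE_mp simp: indicator_def split: if_splits)
qed

lemma integral_sc_mono:
  fixes f h :: "real \<Rightarrow> real"
  assumes "\<And>x. - lb < x \<and> x < lb \<Longrightarrow> f x \<le> h x" "integrable S f" "integrable S h"
  shows "(\<integral>\<mu>. f \<mu> \<partial>S) \<le> (\<integral>\<mu>. h \<mu> \<partial>S)"
  using assms AE_sc by (intro integral_mono_AE) auto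

definition mass :: real where "mass = measure S UNIV"

lemma measure_sc_right_pos:
  assumes "c < lb"
  shows "0 < measure S {c<..}"
proof -
  define a where "a = (max c 0 + lb) / 2"
  define b where "b = (a + lb) / 2"
  have ab: "c < a" "0 < a" "a < b" "b < lb" using assms lb_pos by (auto simp: a_def b_def)
  define k where "k = semicircle lb b"
  have k: "k > 0" using ab lb_pos unfolding k_def semicircle_def
    by (intro divide_pos_pos) (auto intro!: power_strict_mono)
  have ge: "semicircle lb x \<ge> k" if "a \<le> x" "x \<le> b" for x
    unfolding k_def semicircle_def using that ab lb_pos
    by (intro divide_right_mono mult_left_mono real_sqrt_le_mono diff_left_mono power_mono) auto
  have "0 < ennreal (k * (b - a))" using ab k by simp
  also have "\<dots> = (\<integral>\<^sup>+\<mu>. ennreal k * indicator {a..b} \<mu> \<partial>lborel)"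
    using ab k by (simp add: nn_integral_cmult_indicator ennreal_mult)
  also have "\<dots> \<le> (\<integral>\<^sup>+\<mu>. ennreal (indicator {-lb..lb} \<mu> * semicircle lb \<mu>) * indicator {c<..} \<mu> \<partial>lborel)"
    using ab ge by (intro nn_integral_mono) (auto simp: indicator_def intro!: ennreal_leI)
  also have "\<dots> = emeasure S {c<..}"
    by (simp add: sc_measure_def emeasure_density)
  finally show ?thesis
    by (simp add: SC.emeasure_eq_measure)
qed

lemma mass_pos: "mass > 0"
proof -
  have "measure S {0<..} \<le> mass" unfolding mass_def by (rule SC.finite_measure_mono) auto
  then show ?thesis using measure_sc_right_pos[of 0] lb_pos by simp
qed

lemma sqrt_abs_ln_le:
  fixes y :: real assumes "y > 0" shows "sqrt y * \<bar>ln y\<bar> \<le> 2 + 2 * y"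
proof -
  have s: "sqrt y > 0" using assms by simp
  have 1: "ln y = 2 * ln (sqrt y)" using assms by (simp add: ln_sqrt)
  have "ln (sqrt y) \<le> sqrt y" using ln_le_minus_one[OF s] by simp
  then have "sqrt y * ln y \<le> sqrt y * (2 * sqrt y)" unfolding 1 using s by (intro mult_left_mono) auto
  also have "\<dots> = 2 * y" using assms by simp
  finally have a: "sqrt y * ln y \<le> 2 * y" .
  have "ln (1 / sqrt y) \<le> 1 / sqrt y" using ln_le_minus_one[of "1 / sqrt y"] s by simp
  then have "sqrt y * (- ln y) \<le> sqrt y * (2 * (1 / sqrt y))"
    unfolding 1 using s by (intro mult_left_mono) (auto simp: ln_div)
  also have "\<dots> = 2" using s by simp
  finally have "sqrt y * (- ln y) \<le> 2" .
  with a assms show ?thesis by (simp add: abs_if)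
qed

lemma integrable_ln_edge: "integrable S (\<lambda>\<mu>. ln (\<beta> * lb - \<beta> * \<mu>))"
proof -
  define K where "K = sqrt (2 * lb) / sqrt \<beta> * (2 + 2 * (\<beta> * (2 * lb))) * (2 / (pi * lb\<^sup>2))"
  have "integrable lborel (\<lambda>\<mu>. indicator {-lb..lb} \<mu> *\<^sub>R (semicircle lb \<mu> * ln (\<beta> * lb - \<beta> * \<mu>)))"
  proof (rule integrableI_bounded_set_indicator[where B=K])
    show "AE x in lborel. x \<in> {-lb..lb} \<longrightarrow> norm (semicircle lb x * ln (\<beta> * lb - \<beta> * x)) \<le> K"
    proof (rule AE_mp[OF AE_lborel_singleton[of lb]], intro AE_I2 impI)
      fix x :: real assume x: "x \<noteq> lb" "x \<in> {-lb..lb}"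
      define y where "y = \<beta> * (lb - x)"
      have y: "y > 0" "y \<le> \<beta> * (2 * lb)" using x beta_pos by (auto simp: y_def)
      have "y / \<beta> = lb - x" using beta_pos by (simp add: y_def)
      moreover have "lb\<^sup>2 - x\<^sup>2 = (lb + x) * (lb - x)" by (simp add: power2_eq_square algebra_simps)
      ultimately have "lb\<^sup>2 - x\<^sup>2 = (lb + x) * (y / \<beta>)" by simp
      then have "sqrt (lb\<^sup>2 - x\<^sup>2) = sqrt (lb + x) * (sqrt y / sqrt \<beta>)"
        by (simp add: real_sqrt_mult real_sqrt_divide)
      moreover have "ln (\<beta> * lb - \<beta> * x) = ln y" by (simp add: y_def algebra_simps)
      ultimately have "norm (semicircle lb x * ln (\<beta> * lb - \<beta> * x)) =
          sqrt (lb + x) / sqrt \<beta> * (sqrt y * \<bar>ln y\<bar>) * (2 / (pi * lb\<^sup>2))"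
        using x y beta_pos by (simp add: semicircle_def abs_mult)
      also have "\<dots> \<le> sqrt (2 * lb) / sqrt \<beta> * (2 + 2 * (\<beta> * (2 * lb))) * (2 / (pi * lb\<^sup>2))"
        using x y beta_pos sqrt_abs_ln_le[OF y(1)]
        by (intro mult_right_mono mult_mono divide_right_mono) auto
      finally show "norm (semicircle lb x * ln (\<beta> * lb - \<beta> * x)) \<le> K" by (simp add: K_def)
    qed
  qed (auto simp: emeasure_lborel_Icc_eq)
  then show ?thesis unfolding sc_measure_def
    by (subst integrable_density) (auto simp: ind_sc_nonneg mult.assoc)
qed

lemma arg_bounds:
  assumes "-lb < \<mu>" "\<mu> < lb" "q \<ge> \<beta> * lb"
  shows "0 < q - \<beta> * \<mu>" "q - \<beta> * lb < q - \<beta> * \<mu>" "q - \<beta> * \<mu> < q + \<beta> * lb"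
proof -
  have "\<beta> * \<mu> < \<beta> * lb" "\<beta> * (-lb) < \<beta> * \<mu>"
    using assms beta_pos mult_strict_left_mono[of "-lb" \<mu> \<beta>] by auto
  then show "0 < q - \<beta> * \<mu>" "q - \<beta> * lb < q - \<beta> * \<mu>" "q - \<beta> * \<mu> < q + \<beta> * lb"
    using assms by auto
qed

lemma integrable_ln:
  assumes q: "q \<ge> \<beta> * lb"
  shows "integrable S (\<lambda>\<mu>. ln (q - \<beta> * \<mu>))"
proof (rule Bochner_Integration.integrable_bound)
  show "integrable S (\<lambda>\<mu>. \<bar>ln (\<beta> * lb - \<beta> * \<mu>)\<bar> + \<bar>ln (q + \<beta> * lb)\<bar>)"
    by (intro Bochner_Integration.integrable_add integrable_abs integrable_ln_edge) simp
  show "AE x in S. norm (ln (q - \<beta> * x)) \<le> norm (\<bar>ln (\<beta> * lb - \<beta> * x)\<bar> + \<bar>ln (q + \<beta> * lb)\<bar>)"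
  proof (rule AE_mp[OF AE_sc], intro AE_I2 impI)
    fix x assume "- lb < x \<and> x < lb"
    then have "ln (\<beta> * lb - \<beta> * x) \<le> ln (q - \<beta> * x)" "ln (q - \<beta> * x) \<le> ln (q + \<beta> * lb)"
      using arg_bounds[of x q] arg_bounds[of x "\<beta> * lb"] q by (auto simp: ln_le_cancel_iff)
    then show "norm (ln (q - \<beta> * x)) \<le> norm (\<bar>ln (\<beta> * lb - \<beta> * x)\<bar> + \<bar>ln (q + \<beta> * lb)\<bar>)"
      by auto
  qed
qed measurable

lemma integrable_inverse:
  assumes q: "q > \<beta> * lb"
  shows "integrable S (\<lambda>\<mu>. 1 / (q - \<beta> * \<mu>))"
proof (rule SC.integrable_const_bound[where B="1 / (q - \<beta> * lb)"])
  show "AE x in S. norm (1 / (q - \<beta> * x)) \<le> 1 / (q - \<beta> * lb)"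
  proof (rule AE_mp[OF AE_sc], intro AE_I2 impI)
    fix x assume "- lb < x \<and> x < lb"
    then show "norm (1 / (q - \<beta> * x)) \<le> 1 / (q - \<beta> * lb)"
      using arg_bounds[of x q] q by (auto intro!: divide_left_mono)
  qed
qed measurable

definition g :: "real \<Rightarrow> real" where
  "g q = 1/2 * ln pi - 1/2 * (\<integral>\<mu>. ln (q - \<beta> * \<mu>) \<partial>S)"

definition slope :: "real \<Rightarrow> real" where
  "slope q = 1/2 * (\<integral>\<mu>. 1 / (q - \<beta> * \<mu>) \<partial>S)"

lemma g_tangent:
  assumes q: "q > \<beta> * lb" and p: "p \<ge> \<beta> * lb"
  shows "g q - slope q * (p - q) \<le> g p"
proof -
  have "(\<integral>\<mu>. ln (p - \<beta> * \<mu>) \<partial>S) \<le> (\<integral>\<mu>. ln (q - \<beta> * \<mu>) + (p - q) * (1 / (q - \<beta> * \<mu>)) \<partial>S)"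
  proof (rule integral_sc_mono)
    fix x assume "- lb < x \<and> x < lb"
    then have pos: "0 < q - \<beta> * x" "0 < p - \<beta> * x" using arg_bounds[of x] q p by auto
    have "ln ((p - \<beta> * x) / (q - \<beta> * x)) \<le> (p - \<beta> * x) / (q - \<beta> * x) - 1"
      using pos by (intro ln_le_minus_one) simp
    then show "ln (p - \<beta> * x) \<le> ln (q - \<beta> * x) + (p - q) * (1 / (q - \<beta> * x))"
      using pos by (simp add: ln_div field_simps)
  next
    show "integrable S (\<lambda>\<mu>. ln (q - \<beta> * \<mu>) + (p - q) * (1 / (q - \<beta> * \<mu>)))"
      using integrable_ln[of q] integrable_inverse[OF q] q
      by (intro Bochner_Integration.integrable_add integrable_mult_right) auto
  qed (use integrable_ln p in auto)
  also have "\<dots> = (\<integral>\<mu>. ln (q - \<beta> * \<mu>) \<partial>S) + (p - q) * (\<integral>\<mu>. 1 / (q - \<beta> * \<mu>) \<partial>S)"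
    using integrable_ln[of q] integrable_inverse[OF q] q
    by (subst Bochner_Integration.integral_add) (auto intro!: integrable_mult_right simp del: times_divide_eq_right)
  finally show ?thesis by (simp add: g_def slope_def field_simps)
qed

lemma g_quadratic:
  assumes q: "q > \<beta> * lb"
  shows "\<exists>C. \<forall>e. \<bar>e\<bar> \<le> (q - \<beta> * lb) / 2 \<longrightarrow> g (q + e) \<le> g q - slope q * e + C * e\<^sup>2"
proof (intro exI allI impI)
  define k where "k = q - \<beta> * lb"
  have k: "k > 0" using q by (simp add: k_def)
  fix e assume e: "\<bar>e\<bar> \<le> (q - \<beta> * lb) / 2"
  have qe: "q + e \<ge> \<beta> * lb" using e k by (auto simp: k_def abs_le_iff)
  have "(\<integral>\<mu>. ln (q - \<beta> * \<mu>) + e * (1 / (q - \<beta> * \<mu>)) - 2 * e\<^sup>2 / k\<^sup>2 \<partial>S) \<le> (\<integral>\<mu>. ln (q + e - \<beta> * \<mu>) \<partial>S)"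
  proof (rule integral_sc_mono)
    fix x assume "- lb < x \<and> x < lb"
    then have pos: "0 < q - \<beta> * x" "k \<le> q - \<beta> * x" "0 < q + e - \<beta> * x"
      using arg_bounds[of x q] arg_bounds[of x "q + e"] q qe by (auto simp: k_def)
    define t where "t = e / (q - \<beta> * x)"
    have "\<bar>t\<bar> \<le> \<bar>e\<bar> / k" unfolding t_def abs_divide using pos k by (intro divide_left_mono) auto
    also have "\<dots> \<le> 1 / 2" using e k by (simp add: k_def field_simps)
    finally have t: "\<bar>t\<bar> \<le> 1 / 2" .
    have t2: "t\<^sup>2 \<le> e\<^sup>2 / k\<^sup>2"
      using \<open>\<bar>t\<bar> \<le> \<bar>e\<bar> / k\<close> k by (metis abs_le_square_iff abs_divide abs_of_pos power_divide)
    have "(q - \<beta> * x) * (1 + t) = q + e - \<beta> * x"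
      using pos by (simp add: t_def distrib_left)
    then have "ln (q + e - \<beta> * x) = ln ((q - \<beta> * x) * (1 + t))" by simp
    also have "\<dots> = ln (q - \<beta> * x) + ln (1 + t)"
      using pos t by (intro ln_mult_pos) (auto simp: abs_le_iff)
    finally show "ln (q - \<beta> * x) + e * (1 / (q - \<beta> * x)) - 2 * e\<^sup>2 / k\<^sup>2 \<le> ln (q + e - \<beta> * x)"
      using abs_ln_one_plus_x_minus_x_bound[OF t] t2 by (simp add: t_def abs_le_iff)
  next
    show "integrable S (\<lambda>\<mu>. ln (q - \<beta> * \<mu>) + e * (1 / (q - \<beta> * \<mu>)) - 2 * e\<^sup>2 / k\<^sup>2)"
      using integrable_ln[of q] integrable_inverse[OF q] q
      by (intro Bochner_Integration.integrable_diff Bochner_Integration.integrable_add integrable_mult_right) auto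
  qed (use integrable_ln qe in auto)
  moreover have "(\<integral>\<mu>. ln (q - \<beta> * \<mu>) + e * (1 / (q - \<beta> * \<mu>)) - 2 * e\<^sup>2 / k\<^sup>2 \<partial>S) =
     (\<integral>\<mu>. ln (q - \<beta> * \<mu>) \<partial>S) + e * (\<integral>\<mu>. 1 / (q - \<beta> * \<mu>) \<partial>S) - mass * (2 * e\<^sup>2 / k\<^sup>2)"
  proof -
    have i: "integrable S (\<lambda>\<mu>. ln (q - \<beta> * \<mu>))" "integrable S (\<lambda>\<mu>. e * (1 / (q - \<beta> * \<mu>)))"
      using integrable_ln[of q] integrable_mult_right[OF integrable_inverse[OF q], of e] q by auto
    have "(\<integral>\<mu>. ln (q - \<beta> * \<mu>) + e * (1 / (q - \<beta> * \<mu>)) - 2 * e\<^sup>2 / k\<^sup>2 \<partial>S) =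
       (\<integral>\<mu>. ln (q - \<beta> * \<mu>) + e * (1 / (q - \<beta> * \<mu>)) \<partial>S) - (\<integral>\<mu>. 2 * e\<^sup>2 / k\<^sup>2 \<partial>S)"
      by (rule Bochner_Integration.integral_diff[OF Bochner_Integration.integrable_add[OF i]]) simp
    also have "(\<integral>\<mu>. ln (q - \<beta> * \<mu>) + e * (1 / (q - \<beta> * \<mu>)) \<partial>S) =
       (\<integral>\<mu>. ln (q - \<beta> * \<mu>) \<partial>S) + (\<integral>\<mu>. e * (1 / (q - \<beta> * \<mu>)) \<partial>S)"
      by (rule Bochner_Integration.integral_add[OF i])
    also have "(\<integral>\<mu>. e * (1 / (q - \<beta> * \<mu>)) \<partial>S) = e * (\<integral>\<mu>. 1 / (q - \<beta> * \<mu>) \<partial>S)"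
      by (rule integral_mult_right_zero)
    also have "(\<integral>\<mu>. 2 * e\<^sup>2 / k\<^sup>2 \<partial>S) = mass * (2 * e\<^sup>2 / k\<^sup>2)"
      by (simp add: mass_def)
    finally show ?thesis .
  qed
  moreover have "mass * (2 * e\<^sup>2 / k\<^sup>2) = 2 * (mass / k\<^sup>2 * e\<^sup>2)" by simp
  moreover have "1/2 * (\<integral>\<mu>. 1 / (q - \<beta> * \<mu>) \<partial>S) * e = 1/2 * (e * (\<integral>\<mu>. 1 / (q - \<beta> * \<mu>) \<partial>S))" by simp
  ultimately show "g (q + e) \<le> g q - slope q * e + (mass / k\<^sup>2) * e\<^sup>2"
    unfolding g_def slope_def by linarith
qed

lemma g_antimono: "\<beta> * lb \<le> p \<Longrightarrow> p \<le> q \<Longrightarrow> g q \<le> g p"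
proof -
  assume pq: "\<beta> * lb \<le> p" "p \<le> q"
  have "(\<integral>\<mu>. ln (p - \<beta> * \<mu>) \<partial>S) \<le> (\<integral>\<mu>. ln (q - \<beta> * \<mu>) \<partial>S)"
  proof (rule integral_sc_mono)
    fix x assume "- lb < x \<and> x < lb"
    then show "ln (p - \<beta> * x) \<le> ln (q - \<beta> * x)" using arg_bounds(1)[of x p] pq by simp
  qed (use pq integrable_ln in auto)
  then show ?thesis by (simp add: g_def)
qed

lemma g_convex:
  assumes p: "\<beta> * lb \<le> p" and q: "\<beta> * lb \<le> q" and e: "0 \<le> e" "e \<le> 1"
  shows "g ((1 - e) * p + e * q) \<le> (1 - e) * g p + e * g q"
proof -
  have pq: "\<beta> * lb \<le> (1 - e) * p + e * q"
  proof -
    have "(1 - e) * (\<beta> * lb) + e * (\<beta> * lb) \<le> (1 - e) * p + e * q"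
      using assms by (intro add_mono mult_left_mono) auto
    then show ?thesis by (simp add: algebra_simps)
  qed
  have "(\<integral>\<mu>. (1 - e) * ln (p - \<beta> * \<mu>) + e * ln (q - \<beta> * \<mu>) \<partial>S) \<le> (\<integral>\<mu>. ln ((1 - e) * p + e * q - \<beta> * \<mu>) \<partial>S)"
  proof (rule integral_sc_mono)
    fix x assume "- lb < x \<and> x < lb"
    then have "0 < p - \<beta> * x" "0 < q - \<beta> * x" using arg_bounds(1)[of x] p q by auto
    then have "(1 - e) * ln (p - \<beta> * x) + e * ln (q - \<beta> * x) \<le> ln ((1 - e) *\<^sub>R (p - \<beta> * x) + e *\<^sub>R (q - \<beta> * x))"
      using concave_onD[OF ln_concave] e by auto
    also have "(1 - e) *\<^sub>R (p - \<beta> * x) + e *\<^sub>R (q - \<beta> * x) = (1 - e) * p + e * q - \<beta> * x"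
      by (simp add: algebra_simps)
    finally show "(1 - e) * ln (p - \<beta> * x) + e * ln (q - \<beta> * x) \<le> ln ((1 - e) * p + e * q - \<beta> * x)" .
  qed (use integrable_ln p q pq in \<open>auto intro!: Bochner_Integration.integrable_add integrable_mult_right\<close>)
  moreover have "(\<integral>\<mu>. (1 - e) * ln (p - \<beta> * \<mu>) + e * ln (q - \<beta> * \<mu>) \<partial>S) =
     (1 - e) * (\<integral>\<mu>. ln (p - \<beta> * \<mu>) \<partial>S) + e * (\<integral>\<mu>. ln (q - \<beta> * \<mu>) \<partial>S)"
    using integrable_ln p q by (subst Bochner_Integration.integral_add) auto
  ultimately show ?thesis by (simp add: g_def field_simps)
qed

lemma g_continuous: "continuous_on {\<beta> * lb..} g"
proof -
  have "continuous_on {\<beta> * lb..} (\<lambda>q. \<integral>\<mu>. ln (q - \<beta> * \<mu>) \<partial>S)"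
    unfolding continuous_on_sequentially comp_def
  proof (intro ballI allI impI)
    fix X q assume q: "q \<in> {\<beta> * lb..}" and X: "(\<forall>n. X n \<in> {\<beta> * lb..}) \<and> X \<longlonglongrightarrow> q"
    have "Bseq X" using X convergent_imp_Bseq convergent_def by blast
    then obtain K where K: "\<And>n. \<bar>X n\<bar> \<le> K" by (auto simp: Bseq_def)
    show "(\<lambda>n. \<integral>\<mu>. ln (X n - \<beta> * \<mu>) \<partial>S) \<longlonglongrightarrow> (\<integral>\<mu>. ln (q - \<beta> * \<mu>) \<partial>S)"
    proof (rule integral_dominated_convergence)
      show "integrable S (\<lambda>\<mu>. \<bar>ln (\<beta> * lb - \<beta> * \<mu>)\<bar> + \<bar>ln (K + \<beta> * lb)\<bar>)"
        by (intro Bochner_Integration.integrable_add integrable_abs integrable_ln_edge) simp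
      show "AE x in S. (\<lambda>n. ln (X n - \<beta> * x)) \<longlonglongrightarrow> ln (q - \<beta> * x)"
      proof (rule AE_mp[OF AE_sc], intro AE_I2 impI)
        fix x assume "- lb < x \<and> x < lb"
        then have "q - \<beta> * x \<noteq> 0" using arg_bounds(1)[of x q] q by auto
        then show "(\<lambda>n. ln (X n - \<beta> * x)) \<longlonglongrightarrow> ln (q - \<beta> * x)"
          using X by (intro tendsto_intros) auto
      qed
      show "AE x in S. norm (ln (X n - \<beta> * x)) \<le> \<bar>ln (\<beta> * lb - \<beta> * x)\<bar> + \<bar>ln (K + \<beta> * lb)\<bar>" for n
      proof (rule AE_mp[OF AE_sc], intro AE_I2 impI)
        fix x assume x: "- lb < x \<and> x < lb"
        have Xn: "X n \<ge> \<beta> * lb" "X n \<le> K" using X K[of n] by (auto simp: abs_le_iff)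
        then have "ln (\<beta> * lb - \<beta> * x) \<le> ln (X n - \<beta> * x)" "ln (X n - \<beta> * x) \<le> ln (K + \<beta> * lb)"
          using arg_bounds[of x "X n"] arg_bounds[of x "\<beta> * lb"] x by (auto simp: ln_le_cancel_iff)
        then show "norm (ln (X n - \<beta> * x)) \<le> \<bar>ln (\<beta> * lb - \<beta> * x)\<bar> + \<bar>ln (K + \<beta> * lb)\<bar>"
          by auto
      qed
    qed (measurable, measurable)
  qed
  then show ?thesis unfolding g_def by (intro continuous_intros)
qed

lemma g_coercive:
  assumes s: "s > 0"
  shows "\<exists>K. \<forall>q\<ge>\<beta> * lb. s / 2 * q - K \<le> q * s + g q"
proof -
  define c where "c = s / mass"
  have c: "c > 0" using s mass_pos by (simp add: c_def)
  define K where "K = - (1/2 * ln pi) + mass / 2 * (c * (\<beta> * lb) - 1 - ln c)"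
  show ?thesis
  proof (intro exI[of _ K] allI impI)
    fix q assume q: "q \<ge> \<beta> * lb"
    have "(\<integral>\<mu>. ln (q - \<beta> * \<mu>) \<partial>S) \<le> (\<integral>\<mu>. c * (q + \<beta> * lb) - 1 - ln c \<partial>S)"
    proof (rule integral_sc_mono)
      fix x assume x: "- lb < x \<and> x < lb"
      then have b: "0 < q - \<beta> * x" "q - \<beta> * x \<le> q + \<beta> * lb" using arg_bounds[of x q] q by auto
      have "ln (c * (q - \<beta> * x)) \<le> c * (q - \<beta> * x) - 1" using b c by (intro ln_le_minus_one) simp
      also have "\<dots> \<le> c * (q + \<beta> * lb) - 1" using b c by (intro diff_right_mono mult_left_mono) auto
      finally show "ln (q - \<beta> * x) \<le> c * (q + \<beta> * lb) - 1 - ln c" using b c by (simp add: ln_mult)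
    qed (use integrable_ln q in auto)
    also have "\<dots> = mass * (c * (q + \<beta> * lb) - 1 - ln c)" by (simp add: mass_def)
    also have "\<dots> = s * q + mass * (c * (\<beta> * lb) - 1 - ln c)"
      using mass_pos by (simp add: c_def field_simps)
    finally show "s / 2 * q - K \<le> q * s + g q"
      by (simp add: g_def K_def field_simps)
  qed
qed

lemma slope_pos: assumes q: "q > \<beta> * lb" shows "slope q > 0"
proof -
  have "0 < q + \<beta> * lb" using q mult_pos_pos[OF beta_pos lb_pos] by linarith
  then have "0 < mass / (q + \<beta> * lb)" using mass_pos by simp
  also have "\<dots> = (\<integral>\<mu>. 1 / (q + \<beta> * lb) \<partial>S)" by (simp add: mass_def)
  also have "\<dots> \<le> (\<integral>\<mu>. 1 / (q - \<beta> * \<mu>) \<partial>S)"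
  proof (rule integral_sc_mono)
    fix x assume x: "- lb < x \<and> x < lb"
    then show "1 / (q + \<beta> * lb) \<le> 1 / (q - \<beta> * x)"
      using arg_bounds[of x q] q by (intro divide_left_mono) auto
  qed (use integrable_inverse[OF q] in auto)
  finally show ?thesis by (simp add: slope_def)
qed

lemma slope_le: assumes q: "q > \<beta> * lb" shows "slope q \<le> mass / (q - \<beta> * lb)"
proof -
  have "(\<integral>\<mu>. 1 / (q - \<beta> * \<mu>) \<partial>S) \<le> (\<integral>\<mu>. 1 / (q - \<beta> * lb) \<partial>S)"
  proof (rule integral_sc_mono)
    fix x assume x: "- lb < x \<and> x < lb"
    then show "1 / (q - \<beta> * x) \<le> 1 / (q - \<beta> * lb)"
      using arg_bounds[of x q] q by (intro divide_left_mono) auto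
  qed (use integrable_inverse[OF q] in auto)
  also have "\<dots> = mass / (q - \<beta> * lb)" by (simp add: mass_def)
  finally have "2 * slope q \<le> mass / (q - \<beta> * lb)" by (simp add: slope_def)
  then show ?thesis using slope_pos[OF q] by simp
qed

lemma slope_continuous: "continuous_on {\<beta> * lb<..} slope"
  unfolding continuous_on_sequentially comp_def
proof (intro ballI allI impI)
  fix X q assume q: "q \<in> {\<beta> * lb<..}" and X: "(\<forall>n. X n \<in> {\<beta> * lb<..}) \<and> X \<longlonglongrightarrow> q"
  define k where "k = (q - \<beta> * lb) / 2"
  have k: "k > 0" using q by (simp add: k_def)
  have "eventually (\<lambda>n. X n > q - k) sequentially"
    using X k by (intro order_tendstoD(1)[of _ q]) auto
  then obtain n0 where n0: "\<And>n. n \<ge> n0 \<Longrightarrow> X n > q - k" by (auto simp: eventually_sequentially)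
  have "(\<lambda>n. \<integral>\<mu>. 1 / (X (n + n0) - \<beta> * \<mu>) \<partial>S) \<longlonglongrightarrow> (\<integral>\<mu>. 1 / (q - \<beta> * \<mu>) \<partial>S)"
  proof (rule integral_dominated_convergence)
    show "integrable S (\<lambda>\<mu>. 1 / k)" by simp
    show "AE x in S. (\<lambda>n. 1 / (X (n + n0) - \<beta> * x)) \<longlonglongrightarrow> 1 / (q - \<beta> * x)"
    proof (rule AE_mp[OF AE_sc], intro AE_I2 impI)
      fix x assume "- lb < x \<and> x < lb"
      then have "q - \<beta> * x \<noteq> 0" using arg_bounds(1)[of x q] q by auto
      then show "(\<lambda>n. 1 / (X (n + n0) - \<beta> * x)) \<longlonglongrightarrow> 1 / (q - \<beta> * x)"
        using LIMSEQ_ignore_initial_segment[of X q n0] X by (intro tendsto_intros) auto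
    qed
    show "AE x in S. norm (1 / (X (n + n0) - \<beta> * x)) \<le> 1 / k" for n
    proof (rule AE_mp[OF AE_sc], intro AE_I2 impI)
      fix x assume x: "- lb < x \<and> x < lb"
      have "X (n + n0) > q - k" using n0 by simp
      moreover have "q - k = \<beta> * lb + k" by (simp add: k_def field_simps)
      ultimately have "k \<le> X (n + n0) - \<beta> * x"
        using arg_bounds(2)[of x "X (n + n0)"] x k by simp
      then show "norm (1 / (X (n + n0) - \<beta> * x)) \<le> 1 / k" using k by (auto intro!: divide_left_mono)
    qed
  qed (measurable, measurable)
  then have "(\<lambda>n. slope (X (n + n0))) \<longlonglongrightarrow> slope q"
    unfolding slope_def by (intro tendsto_intros)
  then show "(\<lambda>n. slope (X n)) \<longlonglongrightarrow> slope q" by (rule LIMSEQ_offset)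
qed

lemma slope_dichotomy:
  assumes s: "s > 0"
  shows "(\<exists>q>\<beta> * lb. slope q = s) \<or> (\<forall>q>\<beta> * lb. slope q < s)"
proof (rule disjCI)
  assume "\<not> (\<forall>q>\<beta> * lb. slope q < s)"
  then obtain p where p: "p > \<beta> * lb" "slope p \<ge> s" by (auto simp: not_less)
  define r where "r = max p (\<beta> * lb + mass / s)"
  have r: "r \<ge> p" "r > \<beta> * lb" using p by (auto simp: r_def)
  have "mass / s \<le> r - \<beta> * lb" by (simp add: r_def)
  then have "mass / (r - \<beta> * lb) \<le> s" using s r by (simp add: field_simps)
  then have "slope r \<le> s" using slope_le[OF r(2)] by simp
  moreover have "continuous_on {p..r} slope"
    by (rule continuous_on_subset[OF slope_continuous]) (use p in auto)
  ultimately obtain x where "p \<le> x" "slope x = s"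
    using p r IVT2'[of slope r s p] by auto
  then show "\<exists>q>\<beta> * lb. slope q = s" using p(1) by (intro exI[of _ x]) auto
qed

definition legendre :: "real \<Rightarrow> real" where
  "legendre s = Inf ((\<lambda>q. q * s + g q) ` {q. q \<ge> \<beta> * lb})"

lemma legendre_attained:
  assumes "s > 0"
  obtains q where "q \<ge> \<beta> * lb" "q * s + g q = legendre s" "\<And>p. p \<ge> \<beta> * lb \<Longrightarrow> legendre s \<le> p * s + g p"
proof -
  obtain K where K: "\<And>q. q \<ge> \<beta> * lb \<Longrightarrow> s / 2 * q - K \<le> q * s + g q"
    using g_coercive[OF assms] by blast
  have "continuous_on {\<beta> * lb..} (\<lambda>q. q * s + g q)" by (intro continuous_intros g_continuous)
  then obtain q where q: "q \<ge> \<beta> * lb" "\<And>p. p \<ge> \<beta> * lb \<Longrightarrow> q * s + g q \<le> p * s + g p"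
    using continuous_coercive_attains_min[of "\<beta> * lb" "\<lambda>q. q * s + g q" "s / 2" K] assms K by auto
  then have "legendre s = q * s + g q"
    unfolding legendre_def by (intro cInf_eq_minimum) auto
  then show ?thesis using that q by auto
qed

lemma legendre_le: "s > 0 \<Longrightarrow> q \<ge> \<beta> * lb \<Longrightarrow> legendre s \<le> q * s + g q"
  by (meson legendre_attained)

lemma sf_functional_eq:
  "sf_functional lb \<beta> s q = q * s + g q - (1/2 * ln pi + 1/2 * ln s + 1/2 + 1/2 * ln 2)"
  unfolding sf_functional_def g_def by (subst integral_sc) auto

lemma A_sf_attained:
  assumes "s > 0"
  shows "\<exists>q\<ge>\<beta> * lb. sf_functional lb \<beta> s q = A_sf lb \<beta> s"
    and "A_sf lb \<beta> s = legendre s - (1/2 * ln pi + 1/2 * ln s + 1/2 + 1/2 * ln 2)"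
proof -
  obtain q where q: "q \<ge> \<beta> * lb" "q * s + g q = legendre s" "\<And>p. p \<ge> \<beta> * lb \<Longrightarrow> legendre s \<le> p * s + g p"
    using legendre_attained[OF assms] by blast
  have "A_sf lb \<beta> s = sf_functional lb \<beta> s q"
    unfolding A_sf_def
  proof (intro cInf_eq_minimum)
    show "sf_functional lb \<beta> s q \<in> sf_functional lb \<beta> s ` {q. \<beta> * lb \<le> q}" using q(1) by blast
  qed (use q in \<open>auto simp: sf_functional_eq\<close>)
  then show "\<exists>q\<ge>\<beta> * lb. sf_functional lb \<beta> s q = A_sf lb \<beta> s"
    and "A_sf lb \<beta> s = legendre s - (1/2 * ln pi + 1/2 * ln s + 1/2 + 1/2 * ln 2)"
    using q by (auto simp: sf_functional_eq)
qed

definition pot :: "real \<Rightarrow> real \<Rightarrow> real" where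
  "pot l s = \<beta>\<^sup>2 * s\<^sup>2 / 4 + (1 - l) / 2 * s"

definition pot_conj :: "real \<Rightarrow> real \<Rightarrow> real" where
  "pot_conj l q = (max 0 (q - (1 - l) / 2))\<^sup>2 / \<beta>\<^sup>2"

lemma pot_conj_ge:
  assumes "s \<ge> 0" shows "q * s - pot l s \<le> pot_conj l q"
proof -
  define m where "m = max 0 (q - (1 - l) / 2)"
  have "(q - (1 - l) / 2) * s \<le> m * s" using assms by (intro mult_right_mono) (auto simp: m_def)
  moreover have "0 \<le> (m / \<beta> - \<beta> * s / 2)\<^sup>2" by simp
  then have "m * s - \<beta>\<^sup>2 * s\<^sup>2 / 4 \<le> m\<^sup>2 / \<beta>\<^sup>2"
    using beta_pos by (simp add: power2_diff power_divide power_mult_distrib)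
  ultimately show ?thesis by (simp add: pot_def pot_conj_def m_def algebra_simps)
qed

lemma g_functional_eq:
  assumes "s > 0"
  shows "g_functional lb \<beta> l s = legendre s - pot l s - 1/2 * ln (2 * pi)"
  unfolding g_functional_def A_sf_attained(2)[OF assms] pot_def by (simp add: ln_mult field_simps)

text \<open>The maximisation over the radius is dual to a convex minimisation over the multiplier,
  whose first-order condition exhibits the maximiser explicitly.\<close>

lemma A_g_dual:
  obtains q s where "q \<ge> \<beta> * lb" "s > 0" "legendre s = q * s + g q"
    "g_functional lb \<beta> l s = A_g lb \<beta> l" "A_g lb \<beta> l = g q + pot_conj l q - 1/2 * ln (2 * pi)"
proof -
  obtain K where K: "\<And>q. q \<ge> \<beta> * lb \<Longrightarrow> 1 / 2 * q - K \<le> q * 1 + g q"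
    using g_coercive[of 1] by auto
  have "continuous_on {\<beta> * lb..} (\<lambda>q. g q + pot_conj l q)"
    unfolding pot_conj_def using beta_pos by (intro continuous_intros g_continuous) auto
  moreover have "1 / 2 * q - (K + pot l 1) \<le> g q + pot_conj l q" if "q \<ge> \<beta> * lb" for q
    using K[OF that] pot_conj_ge[of 1 q l] by simp
  ultimately obtain q where q: "q \<ge> \<beta> * lb" and
      min: "\<And>p. p \<ge> \<beta> * lb \<Longrightarrow> g q + pot_conj l q \<le> g p + pot_conj l p"
    using continuous_coercive_attains_min[of "\<beta> * lb" "\<lambda>q. g q + pot_conj l q" "1 / 2" "K + pot l 1"] by auto
  define m where "m = max 0 (q - (1 - l) / 2)"
  define s where "s = 2 * m / \<beta>\<^sup>2"
  have first_order: "q * s + g q \<le> p * s + g p" if p: "p \<ge> \<beta> * lb" for p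
  proof (rule ccontr)
    assume neg: "\<not> ?thesis"
    define d where "d = (q * s + g q) - (p * s + g p)"
    define D where "D = (p - q)\<^sup>2 / \<beta>\<^sup>2"
    have d: "d > 0" using neg by (simp add: d_def)
    have D: "D \<ge> 0" by (simp add: D_def)
    define e where "e = min 1 (d / (2 * (D + 1)))"
    have e: "0 < e" "e \<le> 1" "e \<le> d / (2 * (D + 1))" using d D by (auto simp: e_def)
    define r where "r = (1 - e) * q + e * p"
    have r: "r \<ge> \<beta> * lb"
    proof -
      have "(1 - e) * (\<beta> * lb) + e * (\<beta> * lb) \<le> r"
        unfolding r_def using e p q by (intro add_mono mult_left_mono) auto
      then show ?thesis by (simp add: algebra_simps)
    qed
    have "(max 0 (r - (1 - l) / 2))\<^sup>2 \<le> (m + e * (p - q))\<^sup>2"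
    proof -
      have "r - (1 - l) / 2 = (q - (1 - l) / 2) + e * (p - q)" by (simp add: r_def algebra_simps)
      then have "r - (1 - l) / 2 \<le> m + e * (p - q)" by (simp add: m_def)
      then show ?thesis by (cases "r - (1 - l) / 2 \<le> 0") (auto simp: max_def intro!: power_mono)
    qed
    then have "pot_conj l r \<le> (m + e * (p - q))\<^sup>2 / \<beta>\<^sup>2"
      unfolding pot_conj_def by (rule divide_right_mono) simp
    also have "\<dots> = pot_conj l q + e * (s * (p - q)) + e\<^sup>2 * D"
      unfolding pot_conj_def m_def[symmetric] s_def D_def using beta_pos
      by (simp add: power2_eq_square field_simps)
    finally have "pot_conj l r \<le> pot_conj l q + e * (s * (p - q)) + e\<^sup>2 * D" .
    moreover have "g r \<le> (1 - e) * g q + e * g p"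
      unfolding r_def using q p e by (intro g_convex) auto
    ultimately have "0 \<le> e * (g p - g q) + e * (s * (p - q)) + e\<^sup>2 * D"
      using min[OF r] by (simp add: algebra_simps)
    also have "\<dots> = e * (e * D - d)" by (simp add: d_def power2_eq_square algebra_simps)
    finally have "d \<le> e * D" using e by (simp add: zero_le_mult_iff)
    also have "\<dots> \<le> d / (2 * (D + 1)) * D" using e D by (intro mult_right_mono) auto
    also have "\<dots> < d"
    proof -
      have "d * D < d * (2 * (D + 1))" using d D by (intro mult_strict_left_mono) auto
      then show ?thesis using D by (simp add: field_simps)
    qed
    finally show False by simp
  qed
  have "m \<noteq> 0"
  proof
    assume "m = 0"
    then have "g q \<le> g (q + 1)" using first_order[of "q + 1"] q by (simp add: s_def)
    moreover have "g (q + 1) + slope (q + 1) \<le> g q" using g_tangent[of "q + 1" q] q by simp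
    ultimately show False using slope_pos[of "q + 1"] q by simp
  qed
  then have m: "m > 0" "m = q - (1 - l) / 2" by (auto simp: m_def max_def split: if_splits)
  then have s: "s > 0" using beta_pos by (simp add: s_def)
  have leg: "legendre s = q * s + g q"
    unfolding legendre_def using q first_order by (intro cInf_eq_minimum) auto
  have "pot l s = q * s - pot_conj l q"
  proof -
    have lm: "(1 - l) / 2 = q - m" using m(2) by simp
    show ?thesis
      unfolding pot_def pot_conj_def m_def[symmetric] s_def lm using beta_pos m(1)
      by (simp add: power2_eq_square field_simps)
  qed
  then have val: "g_functional lb \<beta> l s = g q + pot_conj l q - 1/2 * ln (2 * pi)"
    unfolding g_functional_eq[OF s] leg by simp
  have "A_g lb \<beta> l = g_functional lb \<beta> l s"
    unfolding A_g_def
  proof (rule cSup_eq_maximum)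
    fix x assume "x \<in> g_functional lb \<beta> l ` {0<..}"
    then obtain t where t: "t > 0" "x = g_functional lb \<beta> l t" by auto
    show "x \<le> g_functional lb \<beta> l s"
      unfolding t(2) val unfolding g_functional_eq[OF t(1)]
      using legendre_le[OF t(1) q] pot_conj_ge[of t q l] t(1) by simp
  qed (use s in auto)
  then show ?thesis using that[of q s] q s leg val by simp
qed

end

section \<open>Tilted Gaussian measures\<close>

definition gauss_int :: "nat \<Rightarrow> (nat \<Rightarrow> nat \<Rightarrow> real) \<Rightarrow> real \<Rightarrow> real \<Rightarrow> ennreal" where
  "gauss_int N A \<beta> q = (\<integral>\<^sup>+z. ennreal (exp (\<beta> * quad N A z - q * sqnorm N z)) \<partial>lebN N)"

lemma quad_diag: "quad N (\<lambda>i j. (if i = j then q else 0) - b * A i j) z = q * sqnorm N z - b * quad N A z"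
proof -
  have "(\<Sum>j<N. ((if i = j then q else 0) - b * A i j) * z i * z j) = q * (z i)\<^sup>2 - b * (\<Sum>j<N. A i j * z i * z j)" if "i < N" for i
  proof -
    have "(\<Sum>j<N. ((if i = j then q else 0) - b * A i j) * z i * z j) =
       (\<Sum>j<N. (if i = j then q * z i * z j else 0)) - (\<Sum>j<N. b * (A i j * z i * z j))"
      unfolding sum_subtractf[symmetric] by (intro sum.cong) (auto simp: algebra_simps)
    then show ?thesis using that by (simp add: sum_distrib_left power2_eq_square)
  qed
  then show ?thesis unfolding quad_def sqnorm_def
    by (simp add: sum_subtractf sum_distrib_left)
qed

lemma eigenvalue_abs_le:
  assumes "\<And>z. \<bar>quad N A z\<bar> \<le> L * sqnorm N z" "eigenvalue (fmat N A) x"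
  shows "\<bar>x\<bar> \<le> L"
proof -
  obtain v where "sqnorm N v = 1" "quad N A v = x" using eigenvalue_quad[OF assms(2)] by blast
  then show ?thesis using assms(1)[of v] by simp
qed

lemma proots_char_poly_eigenvalue:
  fixes A :: "nat \<Rightarrow> nat \<Rightarrow> real"
  assumes "x \<in># roots N A"
  shows "eigenvalue (fmat N A) x"
proof -
  have car: "fmat N A \<in> carrier_mat N N" by simp
  from degree_monic_char_poly[OF this] have "char_poly (fmat N A) \<noteq> 0"
    by (metis coeff_0 zero_neq_one)
  then have "poly (char_poly (fmat N A)) x = 0" using assms by simp
  then show ?thesis using eigenvalue_root_char_poly[OF car] by simp
qed

lemma gauss_int_eq:
  assumes sym: "symmetric_on N A" and b: "\<beta> > 0" and q: "q > \<beta> * L"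
    and L: "\<And>z. \<bar>quad N A z\<bar> \<le> L * sqnorm N z" and N: "N > 0"
  shows "gauss_int N A \<beta> q = ennreal (exp (real N *
    (1/2 * ln pi - 1/2 * ((\<Sum>x\<in>#roots N A. ln (q - \<beta> * x)) / real N))))"
proof -
  let ?Q = "\<lambda>i j. (if i = j then q else 0) - \<beta> * A i j"
  let ?R = "roots N A"
  define P where "P = (\<Prod>x\<in>#?R. q - \<beta> * x)"
  have pd: "pos_def N ?Q"
    unfolding pos_def_def quad_diag
  proof (intro allI impI)
    fix z :: "nat \<Rightarrow> real" assume "\<exists>i<N. z i \<noteq> 0"
    then have s: "sqnorm N z > 0" by (simp add: sqnorm_pos_iff)
    have "\<beta> * quad N A z \<le> \<beta> * (L * sqnorm N z)" using L[of z] b by (intro mult_left_mono) auto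
    also have "\<dots> < q * sqnorm N z" using q s by (simp add: mult.assoc[symmetric])
    finally show "0 < q * sqnorm N z - \<beta> * quad N A z" by simp
  qed
  have symQ: "?Q i j = ?Q j i" if "i < N" "j < N" for i j
    using sym that by (simp add: symmetric_on_def)
  have det: "Determinant.det (fmat N ?Q) = P"
    unfolding P_def by (rule det_shifted_symmetric[OF sym b])
  have "P > 0 \<and> (\<integral>\<^sup>+z. ennreal (exp (- quad N ?Q z)) \<partial>lebN N) = ennreal (sqrt (pi ^ N / P))"
    using nn_integral_gauss[OF symQ pd] unfolding det by simp
  then have P: "P > 0" and int: "gauss_int N A \<beta> q = ennreal (sqrt (pi ^ N / P))"
    unfolding gauss_int_def quad_diag by simp_all
  have pos: "q - \<beta> * x > 0" if "x \<in># ?R" for x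
  proof -
    have "\<bar>x\<bar> \<le> L" using eigenvalue_abs_le[OF L proots_char_poly_eigenvalue[OF that]] .
    then have "\<beta> * x \<le> \<beta> * L" using b by (intro mult_left_mono) auto
    then show ?thesis using q by simp
  qed
  have "ln (\<Prod>x\<in>#M. q - \<beta> * x) = (\<Sum>x\<in>#M. ln (q - \<beta> * x)) \<and> (\<Prod>x\<in>#M. q - \<beta> * x) > 0"
    if "\<forall>x\<in>#M. q - \<beta> * x > 0" for M
    using that by (induction M) (auto simp: ln_mult_pos)
  then have lnP: "ln P = (\<Sum>x\<in>#?R. ln (q - \<beta> * x))" unfolding P_def using pos by blast
  have "sqrt (pi ^ N / P) = exp (ln (sqrt (pi ^ N / P)))" using P by simp
  also have "ln (sqrt (pi ^ N / P)) = (real N * ln pi - ln P) / 2"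
    using P by (simp add: ln_sqrt ln_div ln_realpow)
  also have "\<dots> = real N * (1/2 * ln pi - 1/2 * (ln P / real N))"
    using N by (simp add: field_simps)
  finally show ?thesis unfolding int lnP by simp
qed

lemma nn_integral_le_gauss_int:
  assumes "\<And>z. sqnorm N z \<in> B \<Longrightarrow> f z \<le> c + (\<beta> * quad N A z - q * sqnorm N z)"
  shows "(\<integral>\<^sup>+z. ennreal (exp (f z)) * indicator B (sqnorm N z) \<partial>lebN N) \<le> ennreal (exp c) * gauss_int N A \<beta> q"
proof -
  have "(\<integral>\<^sup>+z. ennreal (exp (f z)) * indicator B (sqnorm N z) \<partial>lebN N) \<le>
      (\<integral>\<^sup>+z. ennreal (exp c) * ennreal (exp (\<beta> * quad N A z - q * sqnorm N z)) \<partial>lebN N)"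
    using assms by (intro nn_integral_mono)
      (auto simp: indicator_def ennreal_mult[symmetric] exp_add[symmetric] intro!: ennreal_leI)
  also have "\<dots> = ennreal (exp c) * gauss_int N A \<beta> q"
    unfolding gauss_int_def by (rule nn_integral_cmult) measurable
  finally show ?thesis .
qed

lemma shell_int_le_gauss:
  assumes "q \<ge> 0"
  shows "shell_int N A \<beta> a b \<le> ennreal (exp (real N * (q * b))) * gauss_int N A \<beta> q"
  unfolding shell_int_def
proof (rule nn_integral_le_gauss_int)
  fix z assume "sqnorm N z \<in> {real N * a<..real N * b}"
  then have "q * sqnorm N z \<le> q * (real N * b)" using assms by (intro mult_left_mono) auto
  then show "\<beta> * quad N A z \<le> real N * (q * b) + (\<beta> * quad N A z - q * sqnorm N z)" by (simp add: mult_ac)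
qed

lemma gauss_upper_tail:
  assumes "e \<ge> 0"
  shows "(\<integral>\<^sup>+z. ennreal (exp (\<beta> * quad N A z - q * sqnorm N z)) * indicator {real N * s<..} (sqnorm N z) \<partial>lebN N)
    \<le> ennreal (exp (- (real N * (e * s)))) * gauss_int N A \<beta> (q - e)"
proof (rule nn_integral_le_gauss_int)
  fix z assume "sqnorm N z \<in> {real N * s<..}"
  then have "e * (real N * s) \<le> e * sqnorm N z" using assms by (intro mult_left_mono) auto
  then show "\<beta> * quad N A z - q * sqnorm N z \<le> - (real N * (e * s)) + (\<beta> * quad N A z - (q - e) * sqnorm N z)"
    by (simp add: algebra_simps)
qed

lemma gauss_lower_tail:
  assumes "e \<ge> 0"
  shows "(\<integral>\<^sup>+z. ennreal (exp (\<beta> * quad N A z - q * sqnorm N z)) * indicator {..real N * s} (sqnorm N z) \<partial>lebN N)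
    \<le> ennreal (exp (real N * (e * s))) * gauss_int N A \<beta> (q + e)"
proof (rule nn_integral_le_gauss_int)
  fix z assume "sqnorm N z \<in> {..real N * s}"
  then have "e * sqnorm N z \<le> e * (real N * s)" using assms by (intro mult_left_mono) auto
  then show "\<beta> * quad N A z - q * sqnorm N z \<le> real N * (e * s) + (\<beta> * quad N A z - (q + e) * sqnorm N z)"
    by (simp add: algebra_simps)
qed

lemma dotp_measurable [measurable]: "(\<lambda>z. dotp N z v) \<in> borel_measurable (lebN N)"
  unfolding dotp_def by (intro borel_measurable_sum borel_measurable_times) (auto simp: measurable_lebN_component)

lemma dotp_commute: "dotp N z w = dotp N w z"
  by (simp add: dotp_def mult.commute)

lemma dotp_matvec_sym:
  assumes "symmetric_on N A"
  shows "dotp N w (matvec N A v) = dotp N v (matvec N A w)"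
proof -
  have "dotp N w (matvec N A v) = (\<Sum>i<N. \<Sum>j<N. w i * (A i j * v j))"
    by (simp add: dotp_def matvec_def sum_distrib_left)
  also have "\<dots> = (\<Sum>j<N. \<Sum>i<N. w i * (A i j * v j))" by (rule sum.swap)
  also have "\<dots> = (\<Sum>j<N. \<Sum>i<N. v j * (A j i * w i))"
    using assms by (intro sum.cong) (auto simp: symmetric_on_def)
  finally show ?thesis by (simp add: dotp_def matvec_def sum_distrib_left)
qed

lemma quad_add_eigenvector:
  assumes sym: "symmetric_on N A" and v: "sqnorm N v = 1" "\<And>i. i < N \<Longrightarrow> matvec N A v i = x * v i" "quad N A v = x"
  shows "quad N A (\<lambda>i. z i + t * v i) = quad N A z + 2 * t * x * dotp N z v + t\<^sup>2 * x"
    and "sqnorm N (\<lambda>i. z i + t * v i) = sqnorm N z + 2 * t * dotp N z v + t\<^sup>2"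
proof -
  have "dotp N v (matvec N A z) = dotp N z (matvec N A v)" by (rule dotp_matvec_sym[OF sym])
  also have "\<dots> = x * dotp N z v"
    unfolding dotp_def sum_distrib_left by (intro sum.cong) (auto simp: v(2))
  finally show "quad N A (\<lambda>i. z i + t * v i) = quad N A z + 2 * t * x * dotp N z v + t\<^sup>2 * x"
    using quad_add[OF sym, of z t v] v by simp
  show "sqnorm N (\<lambda>i. z i + t * v i) = sqnorm N z + 2 * t * dotp N z v + t\<^sup>2"
    using sqnorm_add[of N z t v] v by (simp add: dotp_commute)
qed

lemma nn_integral_lebN_translate:
  assumes "f \<in> borel_measurable (lebN N)"
  shows "(\<integral>\<^sup>+z. f z \<partial>lebN N) = (\<integral>\<^sup>+z. f (restrict (\<lambda>i. z i + w i) {..<N}) \<partial>lebN N)"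
  using nn_integral_lebN_affine[OF assms, of 1 w] by (simp add: add.commute)

lemma gauss_eigenvector_tail:
  assumes sym: "symmetric_on N A" and v: "sqnorm N v = 1" "\<And>i. i < N \<Longrightarrow> matvec N A v i = x * v i" "quad N A v = x"
    and k: "q - \<beta> * x \<ge> 0" and d: "d \<ge> 0"
  shows "(\<integral>\<^sup>+z. ennreal (exp (\<beta> * quad N A z - q * sqnorm N z)) * indicator {d * sqrt (real N)..} (dotp N z v) \<partial>lebN N)
    \<le> ennreal (exp (- (real N * ((q - \<beta> * x) * d\<^sup>2)))) * gauss_int N A \<beta> q"
proof -
  define t where "t = - (d * sqrt (real N))"
  have t2: "t\<^sup>2 = real N * d\<^sup>2" by (simp add: t_def power_mult_distrib)
  let ?E = "\<lambda>z. \<beta> * quad N A z - q * sqnorm N z"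
  have "(\<integral>\<^sup>+z. ennreal (exp (?E z)) * indicator {d * sqrt (real N)..} (dotp N z v) \<partial>lebN N)
    \<le> (\<integral>\<^sup>+z. ennreal (exp (- (real N * ((q - \<beta> * x) * d\<^sup>2)))) * ennreal (exp (?E (\<lambda>i. z i + t * v i))) \<partial>lebN N)"
  proof (intro nn_integral_mono)
    fix z
    have E: "?E (\<lambda>i. z i + t * v i) = ?E z - 2 * t * ((q - \<beta> * x) * dotp N z v) - (q - \<beta> * x) * t\<^sup>2"
      using quad_add_eigenvector[OF sym v, where z=z and t=t] by (simp add: algebra_simps)
    have "?E z \<le> - (real N * ((q - \<beta> * x) * d\<^sup>2)) + ?E (\<lambda>i. z i + t * v i)" if "d * sqrt (real N) \<le> dotp N z v"
    proof -
      have "t\<^sup>2 \<le> - t * dotp N z v"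
        unfolding power2_eq_square using mult_left_mono[OF that, of "- t"] d by (simp add: t_def)
      then have "(q - \<beta> * x) * t\<^sup>2 \<le> (q - \<beta> * x) * (- t * dotp N z v)" using k by (intro mult_left_mono)
      then show ?thesis unfolding E unfolding t2 by (simp add: algebra_simps)
    qed
    then show "ennreal (exp (?E z)) * indicator {d * sqrt (real N)..} (dotp N z v) \<le>
       ennreal (exp (- (real N * ((q - \<beta> * x) * d\<^sup>2)))) * ennreal (exp (?E (\<lambda>i. z i + t * v i)))"
      by (auto simp: indicator_def ennreal_mult[symmetric] exp_add[symmetric] intro!: ennreal_leI)
  qed
  also have "\<dots> = ennreal (exp (- (real N * ((q - \<beta> * x) * d\<^sup>2)))) * (\<integral>\<^sup>+z. ennreal (exp (?E (\<lambda>i. z i + t * v i))) \<partial>lebN N)"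
  proof (rule nn_integral_cmult)
    have "(\<lambda>z. restrict (\<lambda>i. z i + t * v i) {..<N}) \<in> measurable (lebN N) (lebN N)"
      by (intro measurable_lebN_restrict borel_measurable_add measurable_lebN_component) auto
    from measurable_compose[OF this, of "\<lambda>z. ennreal (exp (?E z))" borel]
    show "(\<lambda>z. ennreal (exp (?E (\<lambda>i. z i + t * v i)))) \<in> borel_measurable (lebN N)" by simp
  qed
  also have "(\<integral>\<^sup>+z. ennreal (exp (?E (\<lambda>i. z i + t * v i))) \<partial>lebN N) = gauss_int N A \<beta> q"
    unfolding gauss_int_def by (subst (2) nn_integral_lebN_translate[where w="\<lambda>i. t * v i"]) simp_all
  finally show ?thesis .
qed

lemma eventually_exp_small:
  fixes X :: "nat \<Rightarrow> real"
  assumes "X \<longlonglongrightarrow> c" "c < 0" "d > 0"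
  shows "eventually (\<lambda>N. exp (real N * X N) \<le> d) sequentially"
proof -
  have "eventually (\<lambda>N. X N < c / 2) sequentially"
    using assms by (intro order_tendstoD(2)[OF assms(1)]) auto
  moreover have "(\<lambda>N. exp (real N * (c / 2))) \<longlonglongrightarrow> 0"
    using assms(2) by real_asymp
  then have "eventually (\<lambda>N. exp (real N * (c / 2)) < d) sequentially"
    using assms(3) by (rule order_tendstoD(2))
  ultimately show ?thesis
  proof eventually_elim
    case (elim N)
    have "exp (real N * X N) \<le> exp (real N * (c / 2))" using elim(1) mult_left_mono[of "X N" "c / 2" "real N"] by simp
    then show ?case using less_imp_le[OF elim(2)] by (rule order_trans)
  qed
qed

locale spectral_sequence = semicircle_params +
  fixes A :: "nat \<Rightarrow> nat \<Rightarrow> nat \<Rightarrow> real"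
  assumes sym: "symmetric_on N (A N)"
    and edge: "a > lb \<Longrightarrow> eventually (\<lambda>N. \<forall>x. eigenvalue (fmat N (A N)) x \<longrightarrow> \<bar>x\<bar> \<le> a) sequentially"
    and esd: "continuous_on UNIV f \<Longrightarrow> bounded (range f) \<Longrightarrow>
      (\<lambda>N. (\<Sum>x\<in>#roots N (A N). f x) / real N) \<longlonglongrightarrow> (\<integral>\<mu>. f \<mu> \<partial>sc_measure lb)"
begin

definition G :: "nat \<Rightarrow> real \<Rightarrow> real" where
  "G N q = 1/2 * ln pi - 1/2 * ((\<Sum>x\<in>#roots N (A N). ln (q - \<beta> * x)) / real N)"

lemma eventually_quad_le:
  assumes "a > lb"
  shows "eventually (\<lambda>N. \<forall>z. \<bar>quad N (A N) z\<bar> \<le> a * sqnorm N z) sequentially"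
  using edge[OF assms] by eventually_elim (use abs_quad_le_spectral[OF sym] in blast)

lemma eventually_gauss_int_eq:
  assumes q: "q > \<beta> * lb"
  shows "eventually (\<lambda>N. gauss_int N (A N) \<beta> q = ennreal (exp (real N * G N q))) sequentially"
proof -
  define a where "a = (lb + q / \<beta>) / 2"
  have "lb < q / \<beta>" using q beta_pos by (simp add: field_simps)
  then have a: "a > lb" "\<beta> * a < q" using beta_pos by (auto simp: a_def field_simps)
  show ?thesis using eventually_quad_le[OF a(1)] eventually_gt_at_top[of 0]
    by eventually_elim (unfold G_def, rule gauss_int_eq[OF sym beta_pos a(2)], auto)
qed

lemma G_tendsto:
  assumes q: "q > \<beta> * lb"
  shows "(\<lambda>N. G N q) \<longlonglongrightarrow> g q"
proof -
  define a where "a = (lb + q / \<beta>) / 2"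
  have "lb < q / \<beta>" using q beta_pos by (simp add: field_simps)
  then have a: "a > lb" "\<beta> * a < q" using beta_pos by (auto simp: a_def field_simps)
  then have a0: "a > 0" using lb_pos by linarith
  define h where "h x = ln (q - \<beta> * max (- a) (min a x))" for x
  have clamp: "- a \<le> max (- a) (min a x)" "max (- a) (min a x) \<le> a" for x using a0 by auto
  have arg: "q - \<beta> * a \<le> q - \<beta> * max (- a) (min a x)" "q - \<beta> * max (- a) (min a x) \<le> q + \<beta> * a" for x
    using mult_left_mono[OF clamp(2), of \<beta> x] mult_left_mono[OF clamp(1), of \<beta> x] beta_pos by auto
  have "continuous_on UNIV h"
    unfolding h_def using arg(1) a by (intro continuous_intros) (smt (verit))
  moreover have "bounded (range h)"
  proof -
    have "\<bar>h x\<bar> \<le> \<bar>ln (q - \<beta> * a)\<bar> + \<bar>ln (q + \<beta> * a)\<bar>" for x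
    proof -
      have pos: "0 < q - \<beta> * a" using a by simp
      have pos2: "0 < q - \<beta> * max (- a) (min a x)" using pos arg(1)[of x] by linarith
      have "ln (q - \<beta> * a) \<le> h x" unfolding h_def using arg(1)[of x] pos by (intro ln_mono) auto
      moreover have "h x \<le> ln (q + \<beta> * a)" unfolding h_def using arg(2)[of x] pos2 by (intro ln_mono) auto
      ultimately show ?thesis by linarith
    qed
    then show ?thesis by (auto simp: bounded_iff)
  qed
  ultimately have lim: "(\<lambda>N. (\<Sum>x\<in>#roots N (A N). h x) / real N) \<longlonglongrightarrow> (\<integral>\<mu>. h \<mu> \<partial>sc_measure lb)"
    by (rule esd)
  have "(\<integral>\<mu>. h \<mu> \<partial>sc_measure lb) = (\<integral>\<mu>. ln (q - \<beta> * \<mu>) \<partial>sc_measure lb)"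
  proof (rule integral_cong_AE)
    show "AE x in S. h x = ln (q - \<beta> * x)"
      using AE_sc by eventually_elim (use a in \<open>auto simp: h_def max_def min_def\<close>)
    show "h \<in> borel_measurable S" unfolding h_def by measurable
  qed measurable
  then have "(\<lambda>N. 1/2 * ln pi - 1/2 * ((\<Sum>x\<in>#roots N (A N). h x) / real N)) \<longlonglongrightarrow> g q"
    unfolding g_def using lim by (intro tendsto_intros) simp
  moreover have "eventually (\<lambda>N. 1/2 * ln pi - 1/2 * ((\<Sum>x\<in>#roots N (A N). h x) / real N) = G N q) sequentially"
    using edge[OF a(1)]
  proof eventually_elim
    case (elim N)
    have "h x = ln (q - \<beta> * x)" if "x \<in># roots N (A N)" for x
    proof -
      have "\<bar>x\<bar> \<le> a" using elim proots_char_poly_eigenvalue[OF that] by blast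
      then show ?thesis by (auto simp: h_def max_def min_def)
    qed
    then have "image_mset h (roots N (A N)) =
        image_mset (\<lambda>x. ln (q - \<beta> * x)) (roots N (A N))"
      by (rule image_mset_cong)
    then show ?case by (simp add: G_def)
  qed
  ultimately show ?thesis by (rule Lim_transform_eventually)
qed

lemma eventually_large_eigenvalue:
  assumes c: "c < lb"
  shows "eventually (\<lambda>N. \<exists>x. eigenvalue (fmat N (A N)) x \<and> x > c) sequentially"
proof -
  define h where "h x = max 0 (min 1 (x - c))" for x :: real
  have "continuous_on UNIV h" unfolding h_def by (intro continuous_intros)
  moreover have h01: "0 \<le> h x" "h x \<le> 1" for x by (auto simp: h_def)
  then have "bounded (range h)" by (auto simp: bounded_iff intro!: exI[of _ 1])
  ultimately have lim: "(\<lambda>N. (\<Sum>x\<in>#roots N (A N). h x) / real N) \<longlonglongrightarrow> (\<integral>\<mu>. h \<mu> \<partial>sc_measure lb)"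
    by (rule esd)
  have [measurable]: "h \<in> borel_measurable borel" unfolding h_def by measurable
  have "0 < (\<integral>\<mu>. h \<mu> \<partial>sc_measure lb)"
  proof -
    define c' where "c' = (c + lb) / 2"
    have c': "c < c'" "c' < lb" using c by (auto simp: c'_def)
    define k where "k = min 1 (c' - c)"
    have k: "k > 0" using c' by (simp add: k_def)
    have "0 < k * measure S {c'<..}" using k measure_sc_right_pos[OF c'(2)] by simp
    also have "\<dots> = (\<integral>\<mu>. k * indicator {c'<..} \<mu> \<partial>S)" by simp
    also have "\<dots> \<le> (\<integral>\<mu>. h \<mu> \<partial>S)"
    proof (rule integral_mono)
      show "integrable S h" by (rule SC.integrable_const_bound[where B=1]) (use h01 in auto)
      show "integrable S (\<lambda>\<mu>. k * indicator {c'<..} \<mu>)"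
        by (intro integrable_mult_right SC.integrable_const_bound[where B=1]) (auto simp: indicator_def)
      show "k * indicator {c'<..} x \<le> h x" for x
        using h01[of x] by (auto simp: indicator_def k_def h_def)
    qed
    finally show ?thesis .
  qed
  then have "eventually (\<lambda>N. (\<Sum>x\<in>#roots N (A N). h x) / real N > 0) sequentially"
    by (rule order_tendstoD(1)[OF lim])
  then show ?thesis
  proof eventually_elim
    case (elim N)
    have "\<exists>x\<in>#roots N (A N). h x \<noteq> 0"
    proof (rule ccontr)
      assume "\<not> ?thesis"
      then have "image_mset h (roots N (A N)) =
         image_mset (\<lambda>_. 0) (roots N (A N))"
        by (intro image_mset_cong) auto
      then show False using elim by simp
    qed
    then obtain x where x: "x \<in># roots N (A N)" "h x \<noteq> 0" by blast
    then have "x > c" by (auto simp: h_def max_def min_def split: if_splits)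
    then show ?case using proots_char_poly_eigenvalue[OF x(1)] by blast
  qed
qed

lemma gauss_concentration:
  assumes q: "q > \<beta> * lb" and h: "h > 0"
  shows "eventually (\<lambda>N.
     (\<integral>\<^sup>+z. ennreal (exp (\<beta> * quad N (A N) z - q * sqnorm N z)) * indicator {real N * (slope q + h)<..} (sqnorm N z) \<partial>lebN N)
       \<le> ennreal (1/8 * exp (real N * G N q)) \<and>
     (\<integral>\<^sup>+z. ennreal (exp (\<beta> * quad N (A N) z - q * sqnorm N z)) * indicator {..real N * (slope q - h)} (sqnorm N z) \<partial>lebN N)
       \<le> ennreal (1/8 * exp (real N * G N q))) sequentially"
proof -
  obtain C where C: "\<And>e. \<bar>e\<bar> \<le> (q - \<beta> * lb) / 2 \<Longrightarrow> g (q + e) \<le> g q - slope q * e + C * e\<^sup>2"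
    using g_quadratic[OF q] by blast
  define e where "e = min ((q - \<beta> * lb) / 2) (h / (2 * (\<bar>C\<bar> + 1)))"
  have "e > 0" using q h by (simp add: e_def add_nonneg_pos)
  moreover have "e \<le> (q - \<beta> * lb) / 2" unfolding e_def by (rule min.cobounded1)
  moreover have "e \<le> h / (2 * (\<bar>C\<bar> + 1))" unfolding e_def by (rule min.cobounded2)
  ultimately have e: "e > 0" "e \<le> (q - \<beta> * lb) / 2" "e \<le> h / (2 * (\<bar>C\<bar> + 1))" by auto
  have "C * e < h"
  proof -
    have "C * e \<le> (\<bar>C\<bar> + 1) * e" using e(1) by (intro mult_right_mono) auto
    also have "\<dots> \<le> h / 2" using e(3) by (simp add: field_simps add_pos_nonneg)
    also have "\<dots> < h" using h by simp
    finally show ?thesis .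
  qed
  then have Ce: "C * e\<^sup>2 - e * h < 0"
    using e(1) by (simp add: power2_eq_square mult.assoc[symmetric] mult.commute[of e h])
  have qm: "q - e > \<beta> * lb" and qp: "q + e > \<beta> * lb" using e q by auto
  have up: "(\<lambda>N. G N (q - e) - e * (slope q + h) - G N q) \<longlonglongrightarrow> g (q - e) - e * (slope q + h) - g q"
    by (intro tendsto_intros G_tendsto qm q)
  have up0: "g (q - e) - e * (slope q + h) - g q < 0"
    using C[of "- e"] e Ce by (simp add: algebra_simps)
  have lo: "(\<lambda>N. G N (q + e) + e * (slope q - h) - G N q) \<longlonglongrightarrow> g (q + e) + e * (slope q - h) - g q"
    by (intro tendsto_intros G_tendsto qp q)
  have lo0: "g (q + e) + e * (slope q - h) - g q < 0"
    using C[of e] e Ce by (simp add: algebra_simps)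
  have "(1/8 :: real) > 0" by simp
  from eventually_exp_small[OF up up0 this] eventually_exp_small[OF lo lo0 this]
    eventually_gauss_int_eq[OF qm] eventually_gauss_int_eq[OF qp]
  show ?thesis
  proof eventually_elim
    case (elim N)
    have "exp (- (real N * (e * (slope q + h)))) * exp (real N * G N (q - e)) =
       exp (real N * (G N (q - e) - e * (slope q + h) - G N q)) * exp (real N * G N q)"
      unfolding exp_add[symmetric] by (simp add: algebra_simps)
    also have "\<dots> \<le> 1/8 * exp (real N * G N q)" using elim(1) by (intro mult_right_mono) auto
    finally have 1: "exp (- (real N * (e * (slope q + h)))) * exp (real N * G N (q - e)) \<le> 1/8 * exp (real N * G N q)" .
    have "exp (real N * (e * (slope q - h))) * exp (real N * G N (q + e)) =
       exp (real N * (G N (q + e) + e * (slope q - h) - G N q)) * exp (real N * G N q)"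
      unfolding exp_add[symmetric] by (simp add: algebra_simps)
    also have "\<dots> \<le> 1/8 * exp (real N * G N q)" using elim(2) by (intro mult_right_mono) auto
    finally have 2: "exp (real N * (e * (slope q - h))) * exp (real N * G N (q + e)) \<le> 1/8 * exp (real N * G N q)" .
    show ?case
      using gauss_upper_tail[of e N \<beta> "A N" q "slope q + h"] gauss_lower_tail[of e N \<beta> "A N" q "slope q - h"]
        ennreal_leI[OF 1] ennreal_leI[OF 2] e(1) unfolding elim(3,4)
      by (auto simp: ennreal_mult[symmetric] intro: order_trans)
  qed
qed

lemma shell_int_lower_shifted:
  assumes q: "q > \<beta> * lb" and t: "t \<ge> 0" and a: "a < slope q + t\<^sup>2" and b: "slope q + t\<^sup>2 < b" and h: "h > 0"
  shows "eventually (\<lambda>N. ennreal (exp (real N * (g q + q * slope q + \<beta> * lb * t\<^sup>2 - h))) \<le> shell_int N (A N) \<beta> a b) sequentially"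
proof -
  define r where "r = min (slope q + t\<^sup>2 - a) (b - (slope q + t\<^sup>2))"
  have r: "r > 0" using a b by (simp add: r_def)
  have "eventually (\<lambda>e. e + 2 * t * e < r) (at_right 0)"
    by (rule order_tendstoD(2)[of _ 0]) (use r in \<open>auto intro!: tendsto_eq_intros\<close>)
  moreover have "eventually (\<lambda>e. q * e + \<beta> * t\<^sup>2 * e + 2 * \<beta> * t * (lb + e) * e < h / 2) (at_right 0)"
    by (rule order_tendstoD(2)[of _ 0]) (use h in \<open>auto intro!: tendsto_eq_intros\<close>)
  moreover have "eventually (\<lambda>e. \<beta> * e < q - \<beta> * lb) (at_right 0)"
    by (rule order_tendstoD(2)[of _ 0]) (use q in \<open>auto intro!: tendsto_eq_intros\<close>)
  moreover have "eventually (\<lambda>e :: real. e > 0) (at_right 0)" by (rule eventually_at_right_less)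
  ultimately have "eventually (\<lambda>e. e > 0 \<and> e + 2 * t * e < r \<and>
      q * e + \<beta> * t\<^sup>2 * e + 2 * \<beta> * t * (lb + e) * e < h / 2 \<and> \<beta> * e < q - \<beta> * lb) (at_right 0)"
    by eventually_elim auto
  then obtain e where e: "e > 0" "e + 2 * t * e < r"
      "q * e + \<beta> * t\<^sup>2 * e + 2 * \<beta> * t * (lb + e) * e < h / 2" "\<beta> * e < q - \<beta> * lb"
    using eventually_happens'[OF trivial_limit_at_right_real] by blast
  define k where "k = q - \<beta> * (lb + e)"
  have k: "k > 0" using e(4) by (simp add: k_def algebra_simps)
  have ev_k: "eventually (\<lambda>N. exp (real N * - (k * e\<^sup>2)) \<le> 1/8) sequentially"
    by (rule eventually_exp_small[OF tendsto_const]) (use k e in auto)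
  have ev_h: "eventually (\<lambda>N. exp (real N * - (h / 4)) \<le> 1/2) sequentially"
    by (rule eventually_exp_small[OF tendsto_const]) (use h in auto)
  have ev_G: "eventually (\<lambda>N. G N q > g q - h / 4) sequentially"
    by (rule order_tendstoD(1)[OF G_tendsto[OF q]]) (use h in auto)
  have "lb - e < lb" "lb + e > lb" using e by auto
  from eventually_large_eigenvalue[OF this(1)] edge[OF this(2)] ev_k ev_h ev_G
    eventually_gauss_int_eq[OF q] gauss_concentration[OF q e(1)] eventually_gt_at_top[of 0]
  show ?thesis
  proof eventually_elim
    case (elim N)
    define n where "n = real N"
    have n: "n > 0" using elim(8) by (simp add: n_def)
    obtain x where x: "eigenvalue (fmat N (A N)) x" "x > lb - e" using elim(1) by blast
    have x_abs: "\<bar>x\<bar> \<le> lb + e" using elim(2) x(1) by blast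
    obtain v where v: "sqnorm N v = 1" "\<And>i. i < N \<Longrightarrow> matvec N (A N) v i = x * v i" "quad N (A N) v = x"
      using eigenvalue_quad[OF x(1)] by blast
    have k_le: "k \<le> q - \<beta> * x" using x_abs beta_pos by (simp add: k_def mult_left_mono)
    let ?E = "\<lambda>z. ennreal (exp (\<beta> * quad N (A N) z - q * sqnorm N z))"
    let ?good = "\<lambda>z. indicator {n * (slope q - e)<..n * (slope q + e)} (sqnorm N z) *
        (indicator {- (e * sqrt n)<..<e * sqrt n} (dotp N z v) :: ennreal)"
    let ?w = "\<lambda>i. - v i"
    define M where "M = exp (n * G N q)"
    have M: "M > 0" by (simp add: M_def)
    have w: "sqnorm N ?w = 1" "\<And>i. i < N \<Longrightarrow> matvec N (A N) ?w i = x * ?w i" "quad N (A N) ?w = x"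
      using v sqnorm_scale[of N "-1" v] quad_scale[of N "A N" "-1" v]
      by (auto simp: matvec_def sum_negf)
    have dw: "dotp N z ?w = - dotp N z v" for z by (simp add: dotp_def sum_negf)
    have tail: "(\<integral>\<^sup>+z. ?E z * indicator {e * sqrt n..} (dotp N z u) \<partial>lebN N) \<le> ennreal (1/8 * M)"
      if u: "sqnorm N u = 1" "\<And>i. i < N \<Longrightarrow> matvec N (A N) u i = x * u i" "quad N (A N) u = x" for u
    proof -
      have "(\<integral>\<^sup>+z. ?E z * indicator {e * sqrt n..} (dotp N z u) \<partial>lebN N)
          \<le> ennreal (exp (- (real N * ((q - \<beta> * x) * e\<^sup>2)))) * gauss_int N (A N) \<beta> q"
        unfolding n_def by (rule gauss_eigenvector_tail[OF sym u]) (use k k_le e in auto)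
      also have "\<dots> = ennreal (exp (- (real N * ((q - \<beta> * x) * e\<^sup>2))) * M)"
        unfolding elim(6) by (simp add: ennreal_mult M_def n_def)
      also have "\<dots> \<le> ennreal (1/8 * M)"
      proof (intro ennreal_leI mult_right_mono)
        have "- (real N * ((q - \<beta> * x) * e\<^sup>2)) \<le> real N * - (k * e\<^sup>2)"
          using k_le by (auto intro!: mult_left_mono mult_right_mono)
        then show "exp (- (real N * ((q - \<beta> * x) * e\<^sup>2))) \<le> 1/8"
          using elim(3) by (meson exp_le_cancel_iff order_trans)
      qed (use M in auto)
      finally show ?thesis .
    qed
    have good: "ennreal (1/2 * M) \<le> (\<integral>\<^sup>+z. ?E z * ?good z \<partial>lebN N)" (is "_ \<le> ?I")
    proof -
      have "ennreal M = (\<integral>\<^sup>+z. ?E z \<partial>lebN N)"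
        using elim(6) by (simp add: gauss_int_def M_def n_def)
      also have "\<dots> \<le> (\<integral>\<^sup>+z. ?E z * ?good z + (?E z * indicator {n * (slope q + e)<..} (sqnorm N z)
          + (?E z * indicator {..n * (slope q - e)} (sqnorm N z)
          + (?E z * indicator {e * sqrt n..} (dotp N z v) + ?E z * indicator {e * sqrt n..} (dotp N z ?w)))) \<partial>lebN N)"
        by (intro nn_integral_mono) (auto simp: indicator_def dw)
      also have "\<dots> = ?I + ((\<integral>\<^sup>+z. ?E z * indicator {n * (slope q + e)<..} (sqnorm N z) \<partial>lebN N)
          + ((\<integral>\<^sup>+z. ?E z * indicator {..n * (slope q - e)} (sqnorm N z) \<partial>lebN N)
          + ((\<integral>\<^sup>+z. ?E z * indicator {e * sqrt n..} (dotp N z v) \<partial>lebN N)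
          + (\<integral>\<^sup>+z. ?E z * indicator {e * sqrt n..} (dotp N z ?w) \<partial>lebN N))))"
        by (simp add: nn_integral_add)
      also have "\<dots> \<le> ?I + (ennreal (1/8 * M) + (ennreal (1/8 * M) + (ennreal (1/8 * M) + ennreal (1/8 * M))))"
        using elim(7) tail[OF v] tail[OF w] unfolding M_def n_def by (intro add_mono) auto
      also have "ennreal (1/8 * M) + (ennreal (1/8 * M) + (ennreal (1/8 * M) + ennreal (1/8 * M))) = ennreal (1/2 * M)"
        using M by (simp add: ennreal_plus[symmetric] del: ennreal_plus)
      finally have le: "ennreal M \<le> ?I + ennreal (1/2 * M)" .
      show ?thesis
      proof (cases ?I)
        case (real y)
        then have "ennreal M \<le> ennreal (y + 1/2 * M)" using le M by (simp add: ennreal_plus)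
        then have "M \<le> y + 1/2 * M" using M real(1) by (subst (asm) ennreal_le_iff) auto
        then show ?thesis unfolding real(2) by (intro ennreal_leI) auto
      qed simp
    qed
    define c where "c = n * (q * (slope q - e) + \<beta> * t\<^sup>2 * (lb - e) - 2 * \<beta> * t * (lb + e) * e)"
    have "ennreal (exp (real N * (g q + q * slope q + \<beta> * lb * t\<^sup>2 - h))) \<le> ennreal (exp c * (1/2 * M))"
    proof (rule ennreal_leI)
      have "g q + q * slope q + \<beta> * lb * t\<^sup>2 - h \<le>
         (q * (slope q - e) + \<beta> * t\<^sup>2 * (lb - e) - 2 * \<beta> * t * (lb + e) * e) + - (h / 4) + G N q"
        using e(3) elim(5) by (simp add: algebra_simps)
      from mult_left_mono[OF this less_imp_le[OF n]]
      have "n * (g q + q * slope q + \<beta> * lb * t\<^sup>2 - h) \<le> c + n * - (h / 4) + n * G N q"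
        unfolding c_def by (simp only: distrib_left)
      then have "exp (n * (g q + q * slope q + \<beta> * lb * t\<^sup>2 - h)) \<le> exp c * exp (n * - (h / 4)) * M"
        unfolding M_def exp_add[symmetric] by simp
      also have "\<dots> \<le> exp c * (1/2) * M"
        using elim(4) M unfolding n_def by (intro mult_right_mono mult_left_mono) auto
      finally show "exp (real N * (g q + q * slope q + \<beta> * lb * t\<^sup>2 - h)) \<le> exp c * (1/2 * M)"
        by (simp add: n_def mult.assoc)
    qed
    also have "\<dots> = ennreal (exp c) * ennreal (1/2 * M)" using M by (intro ennreal_mult) auto
    also have "\<dots> \<le> ennreal (exp c) * ?I" using good by (rule mult_left_mono) simp
    also have "\<dots> = (\<integral>\<^sup>+z. ennreal (exp c) * (?E z * ?good z) \<partial>lebN N)"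
      by (rule nn_integral_cmult[symmetric]) measurable
    also have "\<dots> \<le> (\<integral>\<^sup>+z. ennreal (exp (\<beta> * quad N (A N) (\<lambda>i. z i + (t * sqrt n) * v i))) *
        indicator {n * a<..n * b} (sqnorm N (\<lambda>i. z i + (t * sqrt n) * v i)) \<partial>lebN N)"
    proof (intro nn_integral_mono)
      fix z
      show "ennreal (exp c) * (?E z * ?good z) \<le> ennreal (exp (\<beta> * quad N (A N) (\<lambda>i. z i + (t * sqrt n) * v i))) *
        indicator {n * a<..n * b} (sqnorm N (\<lambda>i. z i + (t * sqrt n) * v i))"
      proof (cases "n * (slope q - e) < sqnorm N z \<and> sqnorm N z \<le> n * (slope q + e) \<and> \<bar>dotp N z v\<bar> < e * sqrt n")
        case False
        then have z0: "?good z = 0" by (auto simp: indicator_def abs_less_iff)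
        show ?thesis unfolding z0 by simp
      next
        case True
        define D where "D = dotp N z v"
        note qa = quad_add_eigenvector[OF sym v, where z=z and t="t * sqrt n", folded D_def]
        have sq: "(t * sqrt n)\<^sup>2 = n * t\<^sup>2" using n by (simp add: power_mult_distrib)
        have "\<bar>2 * (t * sqrt n) * D\<bar> \<le> 2 * (t * sqrt n) * (e * sqrt n)"
          unfolding abs_mult using True t n by (auto simp: D_def intro!: mult_left_mono)
        also have "\<dots> = n * (2 * t * e)" using n by (simp add: mult_ac)
        finally have D: "\<bar>2 * (t * sqrt n) * D\<bar> \<le> n * (2 * t * e)" .
        have r_le: "r \<le> slope q + t\<^sup>2 - a" "r \<le> b - (slope q + t\<^sup>2)" by (auto simp: r_def)
        have "a < slope q - e - 2 * t * e + t\<^sup>2" "slope q + e + 2 * t * e + t\<^sup>2 < b"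
          using e(2) r_le by auto
        then have "n * a < n * (slope q - e - 2 * t * e + t\<^sup>2)" "n * (slope q + e + 2 * t * e + t\<^sup>2) < n * b"
          using n by auto
        then have "n * a < n * (slope q - e) - n * (2 * t * e) + n * t\<^sup>2"
          "n * (slope q + e) + n * (2 * t * e) + n * t\<^sup>2 < n * b" by (simp_all add: algebra_simps)
        then have shell: "sqnorm N (\<lambda>i. z i + (t * sqrt n) * v i) \<in> {n * a<..n * b}"
          unfolding greaterThanAtMost_iff using True D qa(2) unfolding sq by linarith
        have "\<bar>2 * (t * sqrt n) * x * D\<bar> \<le> n * (2 * t * e) * (lb + e)"
        proof -
          have "\<bar>2 * (t * sqrt n) * x * D\<bar> = \<bar>2 * (t * sqrt n) * D\<bar> * \<bar>x\<bar>" by (simp add: abs_mult)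
          also have "\<dots> \<le> n * (2 * t * e) * (lb + e)" using D x_abs t n e(1) by (intro mult_mono) auto
          finally show ?thesis .
        qed
        then have "- (n * (2 * t * e) * (lb + e)) \<le> 2 * (t * sqrt n) * x * D" by linarith
        from mult_left_mono[OF this less_imp_le[OF beta_pos]]
        have 1: "\<beta> * - (n * (2 * t * e) * (lb + e)) \<le> \<beta> * (2 * (t * sqrt n) * x * D)" .
        have "n * t\<^sup>2 * (lb - e) \<le> n * t\<^sup>2 * x" using x(2) n by (intro mult_left_mono) auto
        from mult_left_mono[OF this less_imp_le[OF beta_pos]]
        have 2: "\<beta> * (n * t\<^sup>2 * (lb - e)) \<le> \<beta> * (n * t\<^sup>2 * x)" .
        have "q \<ge> 0" using q mult_pos_pos[OF beta_pos lb_pos] by linarith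
        then have 3: "q * (n * (slope q - e)) \<le> q * sqnorm N z" using True by (intro mult_left_mono) auto
        have "c + (\<beta> * quad N (A N) z - q * sqnorm N z) \<le> \<beta> * quad N (A N) (\<lambda>i. z i + (t * sqrt n) * v i)"
          unfolding c_def using 1 2 3 qa(1) unfolding sq by (simp add: algebra_simps)
        then have "ennreal (exp c) * ?E z \<le> ennreal (exp (\<beta> * quad N (A N) (\<lambda>i. z i + (t * sqrt n) * v i)))"
          by (simp add: ennreal_mult[symmetric] exp_add[symmetric])
        moreover have g1: "?good z = 1" using True by (auto simp: indicator_def abs_less_iff)
        ultimately show ?thesis unfolding g1 indicator_simps(1)[OF shell] by simp
      qed
    qed
    also have "\<dots> = shell_int N (A N) \<beta> a b"
      unfolding shell_int_def n_def[symmetric]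
      by (subst (2) nn_integral_lebN_translate[where w="\<lambda>i. (t * sqrt n) * v i"]) simp_all
    finally show ?case .
  qed
qed

lemma shell_int_lower:
  assumes s: "s > 0" and a: "a < s" and b: "s < b" and h: "h > 0"
  shows "eventually (\<lambda>N. ennreal (exp (real N * (legendre s - h))) \<le> shell_int N (A N) \<beta> a b) sequentially"
  using slope_dichotomy[OF s]
proof
  assume "\<exists>q>\<beta> * lb. slope q = s"
  then obtain q where q: "q > \<beta> * lb" "slope q = s" by blast
  have "legendre s \<le> g q + q * slope q"
    using legendre_le[OF s, of q] q by simp
  then have le: "legendre s - h \<le> g q + q * slope q + \<beta> * lb * 0\<^sup>2 - h" by simp
  have "eventually (\<lambda>N. ennreal (exp (real N * (g q + q * slope q + \<beta> * lb * 0\<^sup>2 - h))) \<le> shell_int N (A N) \<beta> a b) sequentially"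
    by (rule shell_int_lower_shifted) (use q a b h in auto)
  then show ?thesis
  proof eventually_elim
    case (elim N)
    have "ennreal (exp (real N * (legendre s - h))) \<le> ennreal (exp (real N * (g q + q * slope q + \<beta> * lb * 0\<^sup>2 - h)))"
      using mult_left_mono[OF le, of "real N"] by (intro ennreal_leI) simp
    then show ?case using elim by (rule order_trans)
  qed
next
  assume sl: "\<forall>q>\<beta> * lb. slope q < s"
  define e where "e = h / (2 * s)"
  have e: "e > 0" "e * s = h / 2" using s h by (auto simp: e_def)
  define q where "q = \<beta> * lb + e"
  have q: "q > \<beta> * lb" using e by (simp add: q_def)
  define t where "t = sqrt (s - slope q)"
  have "slope q < s" using sl q by blast
  then have t: "t \<ge> 0" "t\<^sup>2 = s - slope q" by (auto simp: t_def)
  have "legendre s \<le> q * s + g q" using legendre_le[OF s, of q] q by simp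
  moreover have "\<beta> * lb * slope q \<le> q * slope q"
    using slope_pos[OF q] q by (intro mult_right_mono) auto
  moreover have "\<beta> * lb * s = q * s - h / 2" using e by (simp add: q_def algebra_simps)
  ultimately have le: "legendre s - h \<le> g q + q * slope q + \<beta> * lb * t\<^sup>2 - h / 2"
    unfolding t(2) by (simp add: right_diff_distrib)
  have "eventually (\<lambda>N. ennreal (exp (real N * (g q + q * slope q + \<beta> * lb * t\<^sup>2 - h / 2))) \<le> shell_int N (A N) \<beta> a b) sequentially"
    by (rule shell_int_lower_shifted) (use q a b h t in auto)
  then show ?thesis
  proof eventually_elim
    case (elim N)
    have "ennreal (exp (real N * (legendre s - h))) \<le> ennreal (exp (real N * (g q + q * slope q + \<beta> * lb * t\<^sup>2 - h / 2)))"
      using mult_left_mono[OF le, of "real N"] by (intro ennreal_leI) simp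
    then show ?case using elim by (rule order_trans)
  qed
qed

end

section \<open>Limits of the partition functions\<close>

context semicircle_params
begin

definition pot_int :: "nat \<Rightarrow> (nat \<Rightarrow> nat \<Rightarrow> real) \<Rightarrow> real \<Rightarrow> ennreal" where
  "pot_int N A l = (\<integral>\<^sup>+z. ennreal (exp (\<beta> * quad N A z - real N * pot l (sqnorm N z / real N))) \<partial>lebN N)"

lemma pot_measurable [measurable]: "pot l \<in> borel_measurable borel"
  unfolding pot_def by measurable

lemma Z_g_eq:
  assumes N: "N > 0"
  shows "Z_g N J \<beta> l = enn2real (pot_int N (\<lambda>i j. J i j / sqrt (real N)) l) / (2 * pi) powr (real N / 2)"
proof -
  let ?A = "\<lambda>i j. J i j / sqrt (real N)"
  have "Z_g N J \<beta> l = (\<integral>z. exp (\<beta> * quad N ?A z - real N * pot l (sqnorm N z / real N)) / (2 * pi) powr (real N / 2) \<partial>lebN N)"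
    unfolding Z_g_def
  proof (intro Bochner_Integration.integral_cong refl)
    fix z
    have "- sqnorm N z / 2 + (- \<beta> * hamiltonian N J z - \<beta>\<^sup>2 / (4 * real N) * (sqnorm N z)\<^sup>2 + l / 2 * sqnorm N z) =
      \<beta> * quad N ?A z - real N * pot l (sqnorm N z / real N)"
      unfolding hamiltonian_eq pot_def using N by (simp add: field_simps power2_eq_square)
    then show "exp (- sqnorm N z / 2) / (2 * pi) powr (real N / 2) *
        exp (- \<beta> * hamiltonian N J z - \<beta>\<^sup>2 / (4 * real N) * (sqnorm N z)\<^sup>2 + l / 2 * sqnorm N z) =
      exp (\<beta> * quad N ?A z - real N * pot l (sqnorm N z / real N)) / (2 * pi) powr (real N / 2)"
      by (simp add: exp_add[symmetric])
  qed
  also have "\<dots> = (\<integral>z. exp (\<beta> * quad N ?A z - real N * pot l (sqnorm N z / real N)) \<partial>lebN N) / (2 * pi) powr (real N / 2)"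
    by (rule integral_divide_zero)
  also have "(\<integral>z. exp (\<beta> * quad N ?A z - real N * pot l (sqnorm N z / real N)) \<partial>lebN N) = enn2real (pot_int N ?A l)"
    unfolding pot_int_def by (rule integral_eq_nn_integral) auto
  finally show ?thesis .
qed

lemma pot_int_upper:
  assumes N: "N > 0"
  shows "pot_int N A l \<le> ennreal (exp (real N * pot_conj l q)) * gauss_int N A \<beta> q"
proof -
  have "pot_int N A l \<le> (\<integral>\<^sup>+z. ennreal (exp (real N * pot_conj l q)) * ennreal (exp (\<beta> * quad N A z - q * sqnorm N z)) \<partial>lebN N)"
    unfolding pot_int_def
  proof (intro nn_integral_mono)
    fix z
    have "q * (sqnorm N z / real N) - pot l (sqnorm N z / real N) \<le> pot_conj l q"
      by (rule pot_conj_ge) simp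
    from mult_left_mono[OF this, of "real N"]
    have "\<beta> * quad N A z - real N * pot l (sqnorm N z / real N) \<le> real N * pot_conj l q + (\<beta> * quad N A z - q * sqnorm N z)"
      using N by (simp add: right_diff_distrib)
    then show "ennreal (exp (\<beta> * quad N A z - real N * pot l (sqnorm N z / real N)))
        \<le> ennreal (exp (real N * pot_conj l q)) * ennreal (exp (\<beta> * quad N A z - q * sqnorm N z))"
      by (simp add: ennreal_mult[symmetric] exp_add[symmetric])
  qed
  also have "\<dots> = ennreal (exp (real N * pot_conj l q)) * gauss_int N A \<beta> q"
    unfolding gauss_int_def by (rule nn_integral_cmult) measurable
  finally show ?thesis .
qed

lemma pot_int_lower:
  assumes p: "\<And>x. a < x \<Longrightarrow> x \<le> b \<Longrightarrow> pot l x \<le> p" and N: "N > 0"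
  shows "ennreal (exp (- (real N * p))) * shell_int N A \<beta> a b \<le> pot_int N A l"
proof -
  have "ennreal (exp (- (real N * p))) * shell_int N A \<beta> a b =
      (\<integral>\<^sup>+z. ennreal (exp (- (real N * p))) * (ennreal (exp (\<beta> * quad N A z)) * indicator {real N * a<..real N * b} (sqnorm N z)) \<partial>lebN N)"
    unfolding shell_int_def by (rule nn_integral_cmult[symmetric]) measurable
  also have "\<dots> \<le> pot_int N A l"
    unfolding pot_int_def
  proof (intro nn_integral_mono)
    fix z
    have "real N * pot l (sqnorm N z / real N) \<le> real N * p" if "sqnorm N z \<in> {real N * a<..real N * b}"
      using that N by (intro mult_left_mono p) (auto simp: field_simps)
    then show "ennreal (exp (- (real N * p))) * (ennreal (exp (\<beta> * quad N A z)) * indicator {real N * a<..real N * b} (sqnorm N z))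
       \<le> ennreal (exp (\<beta> * quad N A z - real N * pot l (sqnorm N z / real N)))"
      by (auto simp: indicator_def ennreal_mult[symmetric] exp_add[symmetric] intro!: ennreal_leI)
  qed
  finally show ?thesis .
qed

lemma ln_Z_g_bounds:
  assumes N: "N > 0" and lo: "ennreal (exp (real N * x)) \<le> pot_int N (\<lambda>i j. J i j / sqrt (real N)) l"
    and up: "pot_int N (\<lambda>i j. J i j / sqrt (real N)) l \<le> ennreal (exp (real N * y))"
  shows "x - 1/2 * ln (2 * pi) \<le> ln (Z_g N J \<beta> l) / real N" "ln (Z_g N J \<beta> l) / real N \<le> y - 1/2 * ln (2 * pi)"
proof -
  let ?I = "pot_int N (\<lambda>i j. J i j / sqrt (real N)) l"
  have "?I < \<infinity>" using up by (simp add: le_less_trans[OF _ ennreal_less_top])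
  then obtain i where i: "?I = ennreal i" "i \<ge> 0" by (cases ?I) auto
  have b: "exp (real N * x) \<le> i" "i \<le> exp (real N * y)"
    using lo up i by (auto simp: ennreal_le_iff2 not_le[symmetric])
  then have pos: "i > 0" by (meson exp_gt_zero less_le_trans)
  have "ln (Z_g N J \<beta> l) = ln i - real N / 2 * ln (2 * pi)"
    unfolding Z_g_eq[OF N] i(1) using pos by (simp add: ln_div ln_powr)
  then have eq: "ln (Z_g N J \<beta> l) / real N = ln i / real N - 1/2 * ln (2 * pi)"
    using N by (simp add: field_simps)
  have "real N * x \<le> ln i" using b(1) pos by (metis exp_gt_zero ln_exp ln_le_cancel_iff)
  moreover have "ln i \<le> real N * y" using b(2) pos by (metis exp_gt_zero ln_exp ln_le_cancel_iff)
  ultimately have "x \<le> ln i / real N" "ln i / real N \<le> y" using N by (auto simp: field_simps)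
  then show "x - 1/2 * ln (2 * pi) \<le> ln (Z_g N J \<beta> l) / real N" "ln (Z_g N J \<beta> l) / real N \<le> y - 1/2 * ln (2 * pi)"
    unfolding eq by auto
qed

lemma ln_Z_g_growth:
  "\<exists>C. \<forall>N J L. N > 0 \<longrightarrow> L \<ge> 0 \<longrightarrow> (\<forall>z. \<bar>quad N (\<lambda>i j. J i j / sqrt (real N)) z\<bar> \<le> L * sqnorm N z) \<longrightarrow>
     \<bar>ln (Z_g N J \<beta> l) / real N\<bar> \<le> C * (1 + L\<^sup>2)"
proof -
  have "Bseq (\<lambda>n. ln (unit_ball_vol (real n)) / real n + ln (real n) / 2)"
    using unit_ball_vol_asymp by (rule convergent_imp_Bseq[OF convergentI])
  then obtain B where B: "B > 0" "\<And>n. \<bar>ln (unit_ball_vol (real n)) / real n + ln (real n) / 2\<bar> \<le> B"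
    by (auto simp: Bseq_def)
  define p where "p = \<beta>\<^sup>2 / 4 + \<bar>(1 - l) / 2\<bar>"
  define c where "c = 1 + \<bar>(1 - l) / 2\<bar>"
  define C where "C = \<beta> + p + B + ln (2 * pi) + 2 + 2 * c\<^sup>2 / \<beta>\<^sup>2 + ln pi"
  have lnpi: "ln pi \<ge> 0" "ln (2 * pi) \<ge> 0" using pi_gt3 by auto
  have p0: "p \<ge> 0" by (simp add: p_def)
  show ?thesis
  proof (intro exI[of _ C] allI impI)
    fix N :: nat and J :: "nat \<Rightarrow> nat \<Rightarrow> real" and L :: real
    assume N: "N > 0" and L: "L \<ge> 0" and bd: "\<forall>z. \<bar>quad N (\<lambda>i j. J i j / sqrt (real N)) z\<bar> \<le> L * sqnorm N z"
    let ?A = "\<lambda>i j. J i j / sqrt (real N)"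
    have bq: "\<beta> * quad N ?A z \<le> \<beta> * L * sqnorm N z" "- (\<beta> * L * sqnorm N z) \<le> \<beta> * quad N ?A z" for z
    proof -
      have "quad N ?A z \<le> L * sqnorm N z" "- (L * sqnorm N z) \<le> quad N ?A z" using bd[rule_format, of z] by linarith+
      from this[THEN mult_left_mono, of \<beta>]
      show "\<beta> * quad N ?A z \<le> \<beta> * L * sqnorm N z" "- (\<beta> * L * sqnorm N z) \<le> \<beta> * quad N ?A z"
        using beta_pos by (auto simp: mult.assoc)
    qed
    have up: "pot_int N ?A l \<le> ennreal (exp (real N * (pot_conj l (\<beta> * L + 1) + 1/2 * ln pi)))"
    proof -
      have "gauss_int N ?A \<beta> (\<beta> * L + 1) \<le> (\<integral>\<^sup>+z. ennreal (exp (- quad N (\<lambda>i j. (if i = j then 1 else 0) - 0 * 0) z)) \<partial>lebN N)"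
        unfolding gauss_int_def quad_diag using bq(1)
        by (intro nn_integral_mono ennreal_leI) (simp add: algebra_simps)
      also have "\<dots> = ennreal (sqrt (pi ^ N / Determinant.det (mat N N (\<lambda>(i, j). (if i = j then 1 else 0) - 0 * 0))))"
      proof (rule conjunct2[OF nn_integral_gauss])
        show "pos_def N (\<lambda>i j. (if i = j then 1 else 0) - 0 * 0)"
          unfolding pos_def_def quad_diag by (simp add: sqnorm_pos_iff)
      qed auto
      also have "mat N N (\<lambda>(i, j). (if i = j then 1 else 0) - 0 * 0) = (1\<^sub>m N :: real mat)"
        by (intro eq_matI) auto
      also have "sqrt (pi ^ N / Determinant.det (1\<^sub>m N)) = exp (real N * (1/2 * ln pi))"
      proof -
        have h: "1/2 * ln pi = ln (sqrt pi)" by (simp add: ln_sqrt)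
        show ?thesis unfolding h exp_of_nat_mult by (simp add: real_sqrt_power)
      qed
      finally have G: "gauss_int N ?A \<beta> (\<beta> * L + 1) \<le> ennreal (exp (real N * (1/2 * ln pi)))" .
      have "pot_int N ?A l \<le> ennreal (exp (real N * pot_conj l (\<beta> * L + 1))) * gauss_int N ?A \<beta> (\<beta> * L + 1)"
        by (rule pot_int_upper[OF N])
      also have "\<dots> \<le> ennreal (exp (real N * pot_conj l (\<beta> * L + 1))) * ennreal (exp (real N * (1/2 * ln pi)))"
        using G by (rule mult_left_mono) simp
      finally show ?thesis by (simp add: ennreal_mult[symmetric] exp_add[symmetric] distrib_left)
    qed
    have lo: "ennreal (exp (real N * (- (\<beta> * L) - p - B))) \<le> pot_int N ?A l"
    proof -
      have s: "sqrt (real N) > 0" "(sqrt (real N))\<^sup>2 = real N" using N by auto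
      have "- (real N * B) \<le> ln (unit_ball_vol (real N)) + real N * ln (real N) / 2"
      proof -
        have "- B \<le> ln (unit_ball_vol (real N)) / real N + ln (real N) / 2" using B(2)[of N] by linarith
        from mult_left_mono[OF this, of "real N"] show ?thesis using N by (simp add: distrib_left)
      qed
      also have "\<dots> = ln (sqrt (real N) ^ N * unit_ball_vol (real N))"
        using N by (subst ln_mult_pos) (auto simp: ln_realpow ln_sqrt)
      finally have "exp (- (real N * B)) \<le> sqrt (real N) ^ N * unit_ball_vol (real N)"
        using s by (subst ln_ge_iff[symmetric]) auto
      then have "ennreal (exp (- (real N * B))) \<le> ennreal (sqrt (real N) ^ N) * ennreal (unit_ball_vol (real N))"
        by (simp add: ennreal_mult[symmetric] ennreal_leI)
      also have "\<dots> \<le> ennreal (sqrt (real N) ^ N) * ball_int N ?A 0"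
        using ball_int_bounds(1)[of N ?A L 0] bd L by (intro mult_left_mono) auto
      also have "\<dots> = (\<integral>\<^sup>+z. indicator {..real N} (sqnorm N z) \<partial>lebN N)"
        using ball_int_scale[OF s(1), of N 0 ?A] s(2) by simp
      finally have ball: "ennreal (exp (- (real N * B))) \<le> (\<integral>\<^sup>+z. indicator {..real N} (sqnorm N z) \<partial>lebN N)" .
      have "ennreal (exp (real N * (- (\<beta> * L) - p - B))) = ennreal (exp (real N * (- (\<beta> * L) - p))) * ennreal (exp (- (real N * B)))"
        by (simp add: ennreal_mult[symmetric] exp_add[symmetric] algebra_simps)
      also have "\<dots> \<le> ennreal (exp (real N * (- (\<beta> * L) - p))) * (\<integral>\<^sup>+z. indicator {..real N} (sqnorm N z) \<partial>lebN N)"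
        using ball by (rule mult_left_mono) simp
      also have "\<dots> = (\<integral>\<^sup>+z. ennreal (exp (real N * (- (\<beta> * L) - p))) * indicator {..real N} (sqnorm N z) \<partial>lebN N)"
        by (rule nn_integral_cmult[symmetric]) measurable
      also have "\<dots> \<le> pot_int N ?A l"
        unfolding pot_int_def
      proof (intro nn_integral_mono)
        fix z
        have "real N * (- (\<beta> * L) - p) \<le> \<beta> * quad N ?A z - real N * pot l (sqnorm N z / real N)" if "sqnorm N z \<le> real N"
        proof -
          define x where "x = sqnorm N z / real N"
          have x: "0 \<le> x" "x \<le> 1" using that N by (auto simp: x_def)
          have "\<beta>\<^sup>2 * x\<^sup>2 \<le> \<beta>\<^sup>2 * 1" using x by (intro mult_left_mono) (auto simp: power_le_one)
          moreover have "(1 - l) / 2 * x \<le> \<bar>(1 - l) / 2\<bar> * x" using x by (intro mult_right_mono abs_ge_self)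
          moreover have "\<bar>(1 - l) / 2\<bar> * x \<le> \<bar>(1 - l) / 2\<bar> * 1" using x by (intro mult_left_mono) auto
          ultimately have "pot l x \<le> p" by (simp add: pot_def p_def)
          then have "real N * pot l x \<le> real N * p" by (intro mult_left_mono) auto
          moreover have "\<beta> * L * sqnorm N z \<le> \<beta> * L * real N" using that beta_pos L by (intro mult_left_mono) auto
          ultimately show ?thesis using bq(2)[of z] by (simp add: x_def algebra_simps)
        qed
        then show "ennreal (exp (real N * (- (\<beta> * L) - p))) * indicator {..real N} (sqnorm N z) \<le>
           ennreal (exp (\<beta> * quad N ?A z - real N * pot l (sqnorm N z / real N)))"
          by (auto simp: indicator_def intro!: ennreal_leI)
      qed
      finally show ?thesis .
    qed
    note b = ln_Z_g_bounds[OF N lo up]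
    have L1: "L \<le> 1 + L\<^sup>2"
    proof -
      have "0 \<le> (L - 1)\<^sup>2" by simp
      then show ?thesis using L by (simp add: power2_diff)
    qed
    have one: "1 \<le> 1 + L\<^sup>2" by simp
    have pc: "pot_conj l (\<beta> * L + 1) \<le> (2 + 2 * c\<^sup>2 / \<beta>\<^sup>2) * (1 + L\<^sup>2)"
    proof -
      have "max 0 (\<beta> * L + 1 - (1 - l) / 2) \<le> \<beta> * L + c"
      proof (rule max.boundedI)
        have "0 \<le> \<beta> * L" using L beta_pos by simp
        then show "0 \<le> \<beta> * L + c" "\<beta> * L + 1 - (1 - l) / 2 \<le> \<beta> * L + c" unfolding c_def by linarith+
      qed
      then have "(max 0 (\<beta> * L + 1 - (1 - l) / 2))\<^sup>2 \<le> (\<beta> * L + c)\<^sup>2" by (intro power_mono) auto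
      also have "\<dots> \<le> 2 * (\<beta> * L)\<^sup>2 + 2 * c\<^sup>2"
        using zero_le_power2[of "\<beta> * L - c"] by (simp add: power2_sum power2_diff)
      finally have "pot_conj l (\<beta> * L + 1) \<le> (2 * (\<beta> * L)\<^sup>2 + 2 * c\<^sup>2) / \<beta>\<^sup>2"
        unfolding pot_conj_def by (rule divide_right_mono) simp
      also have "\<dots> = 2 * L\<^sup>2 + 2 * c\<^sup>2 / \<beta>\<^sup>2 * 1"
        using beta_pos by (simp add: power_mult_distrib add_divide_distrib)
      also have "\<dots> \<le> 2 * (1 + L\<^sup>2) + 2 * c\<^sup>2 / \<beta>\<^sup>2 * (1 + L\<^sup>2)"
        by (intro add_mono mult_left_mono) auto
      finally show ?thesis by (simp add: algebra_simps)
    qed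
    have scale: "x \<le> x * (1 + L\<^sup>2)" if "x \<ge> 0" for x using mult_left_mono[OF one that] by simp
    have cb: "0 \<le> 2 * c\<^sup>2 / \<beta>\<^sup>2 * (1 + L\<^sup>2)" by simp
    have bL: "\<beta> * L \<le> \<beta> * (1 + L\<^sup>2)" using L1 beta_pos by (intro mult_left_mono) auto
    have Ceq: "C * (1 + L\<^sup>2) = \<beta> * (1 + L\<^sup>2) + p * (1 + L\<^sup>2) + B * (1 + L\<^sup>2) + ln (2 * pi) * (1 + L\<^sup>2)
        + 2 * (1 + L\<^sup>2) + 2 * c\<^sup>2 / \<beta>\<^sup>2 * (1 + L\<^sup>2) + ln pi * (1 + L\<^sup>2)"
      unfolding C_def by (simp only: distrib_right)
    have b0: "0 \<le> \<beta> * (1 + L\<^sup>2)" "0 \<le> L\<^sup>2" using beta_pos by simp_all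
    have pc': "pot_conj l (\<beta> * L + 1) \<le> 2 * (1 + L\<^sup>2) + 2 * c\<^sup>2 / \<beta>\<^sup>2 * (1 + L\<^sup>2)"
      using pc by (simp only: distrib_right)
    define U where "U = 1 + L\<^sup>2"
    define X where "X = ln (Z_g N J \<beta> l) / real N"
    have "U \<ge> 0" by (simp add: U_def)
    then have "X \<le> C * U" "- X \<le> C * U"
      using b b0 pc' bL scale[OF p0] scale[OF less_imp_le[OF B(1)]] scale[OF lnpi(1)] scale[OF lnpi(2)] lnpi p0 B(1) cb
      unfolding Ceq[folded U_def] U_def[symmetric] X_def[symmetric] by linarith+
    then show "\<bar>ln (Z_g N J \<beta> l) / real N\<bar> \<le> C * (1 + L\<^sup>2)"
      unfolding U_def X_def by linarith
  qed
qed

end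

context spectral_sequence
begin

lemma pot_int_limit_bounds:
  assumes e: "e > 0"
  shows "eventually (\<lambda>N. ennreal (exp (real N * (A_g lb \<beta> l + 1/2 * ln (2 * pi) - e))) \<le> pot_int N (A N) l \<and>
    pot_int N (A N) l \<le> ennreal (exp (real N * (A_g lb \<beta> l + 1/2 * ln (2 * pi) + e)))) sequentially"
proof -
  obtain q s where qs: "q \<ge> \<beta> * lb" "s > 0" "legendre s = q * s + g q"
    "g_functional lb \<beta> l s = A_g lb \<beta> l" "A_g lb \<beta> l = g q + pot_conj l q - 1/2 * ln (2 * pi)"
    using A_g_dual[of l] by blast
  have "isCont (pot l) s" unfolding pot_def by (intro continuous_intros) auto
  then have "eventually (\<lambda>x. pot l x < pot l s + e / 2) (nhds s)"
    using e order_tendstoD(2)[of "pot l" "pot l s" "nhds s" "pot l s + e / 2"]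
    by (simp add: continuous_at tendsto_nhds_iff isCont_def)
  then obtain d where d: "d > 0" "\<And>x. dist x s < d \<Longrightarrow> pot l x < pot l s + e / 2"
    by (auto simp: eventually_nhds_metric)
  define a where "a = s - d / 2"
  define b where "b = s + d / 2"
  have ab: "a < s" "s < b" using d by (auto simp: a_def b_def)
  have pab: "pot l x \<le> pot l s + e / 2" if "a < x" "x \<le> b" for x
  proof -
    have "dist x s < d" using that d(1) unfolding a_def b_def dist_real_def by linarith
    then show ?thesis using d(2) by (intro less_imp_le)
  qed
  have Ag: "A_g lb \<beta> l + 1/2 * ln (2 * pi) = legendre s - pot l s"
    using qs(4) g_functional_eq[OF qs(2), of l] by simp
  have "continuous_on UNIV (pot_conj l)" unfolding pot_conj_def using beta_pos by (intro continuous_intros) auto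
  then have "(pot_conj l \<longlongrightarrow> pot_conj l q) (at_right q)"
    by (simp add: continuous_on_eq_continuous_at isCont_def filterlim_at_split)
  then have "eventually (\<lambda>x. pot_conj l x < pot_conj l q + e / 2) (at_right q)"
    using e by (intro order_tendstoD(2)) auto
  moreover have "eventually (\<lambda>x. x > q) (at_right q)" by (rule eventually_at_right_less)
  ultimately have "eventually (\<lambda>x. pot_conj l x < pot_conj l q + e / 2 \<and> x > q) (at_right q)"
    by eventually_elim auto
  then obtain q' where q': "q' > q" "pot_conj l q' < pot_conj l q + e / 2"
    using eventually_happens'[OF trivial_limit_at_right_real] by blast
  have q'lb: "q' > \<beta> * lb" using q' qs by simp
  have gq': "g q' \<le> g q" using g_antimono[OF qs(1), of q'] q' by simp
  have ev_G: "eventually (\<lambda>N. G N q' < g q' + e / 2) sequentially"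
    using e by (intro order_tendstoD(2)[OF G_tendsto[OF q'lb]]) auto
  have e2: "e / 2 > 0" using e by simp
  from ev_G shell_int_lower[OF qs(2) ab e2] eventually_gauss_int_eq[OF q'lb] eventually_gt_at_top[of 0]
  show ?thesis
  proof eventually_elim
    case (elim N)
    have "ennreal (exp (real N * (A_g lb \<beta> l + 1/2 * ln (2 * pi) - e))) =
       ennreal (exp (- (real N * (pot l s + e / 2)))) * ennreal (exp (real N * (legendre s - e / 2)))"
      unfolding Ag by (simp add: ennreal_mult[symmetric] exp_add[symmetric] algebra_simps)
    also have "\<dots> \<le> ennreal (exp (- (real N * (pot l s + e / 2)))) * shell_int N (A N) \<beta> a b"
      using elim(2) by (rule mult_left_mono) simp
    also have "\<dots> \<le> pot_int N (A N) l" using pab elim(4) by (intro pot_int_lower) auto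
    finally have lo: "ennreal (exp (real N * (A_g lb \<beta> l + 1/2 * ln (2 * pi) - e))) \<le> pot_int N (A N) l" .
    have "pot_int N (A N) l \<le> ennreal (exp (real N * pot_conj l q')) * gauss_int N (A N) \<beta> q'"
      by (rule pot_int_upper[OF elim(4)])
    also have "\<dots> = ennreal (exp (real N * (pot_conj l q' + G N q')))"
      unfolding elim(3) by (simp add: ennreal_mult[symmetric] exp_add[symmetric] distrib_left)
    also have "\<dots> \<le> ennreal (exp (real N * (A_g lb \<beta> l + 1/2 * ln (2 * pi) + e)))"
      using elim(1) q'(2) gq' qs(5) by (intro ennreal_leI) (auto intro!: mult_left_mono)
    finally have "pot_int N (A N) l \<le> ennreal (exp (real N * (A_g lb \<beta> l + 1/2 * ln (2 * pi) + e)))" .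
    with lo show ?case ..
  qed
qed

theorem Z_g_limit:
  assumes A: "\<And>N. A N = (\<lambda>i j. J N i j / sqrt (real N))"
  shows "(\<lambda>N. ln (Z_g N (J N) \<beta> l) / real N) \<longlonglongrightarrow> A_g lb \<beta> l"
proof (rule tendstoI)
  fix e :: real assume "e > 0"
  then have "e / 2 > 0" by simp
  from pot_int_limit_bounds[OF this, of l] eventually_gt_at_top[of 0]
  show "eventually (\<lambda>N. dist (ln (Z_g N (J N) \<beta> l) / real N) (A_g lb \<beta> l) < e) sequentially"
  proof eventually_elim
    case (elim N)
    note b = ln_Z_g_bounds[OF elim(2) elim(1)[unfolded A, THEN conjunct1] elim(1)[unfolded A, THEN conjunct2]]
    have "\<bar>ln (Z_g N (J N) \<beta> l) / real N - A_g lb \<beta> l\<bar> \<le> e / 2" using b by linarith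
    then show ?case using \<open>e > 0\<close> by (simp add: dist_real_def)
  qed
qed

theorem Z_sf_limit:
  assumes A: "\<And>N. A N = (\<lambda>i j. J N i j / sqrt (real N))" and R: "R > 0"
  shows "(\<lambda>N. ln (Z_sf N (J N) \<beta> R) / real N) \<longlonglongrightarrow> A_sf lb \<beta> (R\<^sup>2)"
proof (rule tendstoI)
  fix e :: real assume e: "e > 0"
  define s where "s = R\<^sup>2"
  have s: "s > 0" using R by (simp add: s_def)
  define K where "K = 1/2 * ln pi + 1/2 + 1/2 * ln (2 :: real)"
  define L where "L = lb + 1"
  have L: "L > lb" "L \<ge> 0" using lb_pos by (auto simp: L_def)
  have Asf: "A_sf lb \<beta> s = legendre s - K - 1/2 * ln s"
    using A_sf_attained(2)[OF s] by (simp add: K_def)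
  obtain q0 where q0: "q0 \<ge> \<beta> * lb" "q0 * s + g q0 = legendre s" using legendre_attained[OF s] by blast
  define q where "q = q0 + e / (4 * s)"
  have es: "e / (4 * s) > 0" using e s by simp
  have q: "q > \<beta> * lb" using q0(1) es unfolding q_def by linarith
  have q_nn: "q \<ge> 0" using q mult_pos_pos[OF beta_pos lb_pos] by linarith
  have qleg: "q * s + g q \<le> legendre s + e / 4"
  proof -
    have "g q \<le> g q0" using g_antimono[OF q0(1), of q] e s by (simp add: q_def)
    moreover have "q * s = q0 * s + e / 4" using s by (simp add: q_def field_simps)
    ultimately show ?thesis using q0(2) by simp
  qed
  have "eventually (\<lambda>d. \<beta> * L * d * s + q * s * d + 1/2 * ln (1 + d) < e / 4) (at_right 0)"
    by (rule order_tendstoD(2)[of _ 0]) (use e in \<open>auto intro!: tendsto_eq_intros\<close>)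
  moreover have "eventually (\<lambda>d :: real. d < 1) (at_right 0)"
    by (rule order_tendstoD(2)[of _ 0]) (auto intro!: tendsto_eq_intros)
  moreover have "eventually (\<lambda>d :: real. d > 0) (at_right 0)" by (rule eventually_at_right_less)
  ultimately have "eventually (\<lambda>d. 0 < d \<and> d < 1 \<and> \<beta> * L * d * s + q * s * d + 1/2 * ln (1 + d) < e / 4) (at_right 0)"
    by eventually_elim auto
  then obtain d where d: "0 < d" "d < 1" and small: "\<beta> * L * d * s + q * s * d + 1/2 * ln (1 + d) < e / 4"
    using eventually_happens'[OF trivial_limit_at_right_real] by blast
  have terms: "0 \<le> \<beta> * L * d * s" "0 \<le> q * s * d" "0 \<le> ln (1 + d)"
    using beta_pos L d s q_nn by auto
  define v where "v N = unit_ball_vol (real N) * (sqrt (real N * (s * (1 + d))) ^ N - sqrt (real N * (s * (1 - d))) ^ N)" for N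
  have v_lim: "(\<lambda>N. ln (v N) / real N) \<longlonglongrightarrow> K + 1/2 * ln (s * (1 + d))"
    unfolding v_def K_def using shell_volume_asymp(1)[OF s d] by simp
  have v_pos: "v N > 0" if "N > 0" for N unfolding v_def using shell_volume_asymp(2)[OF s d that] .
  have ln_sd: "1/2 * ln (s * (1 + d)) = 1/2 * ln s + 1/2 * ln (1 + d)" using s d by (simp add: ln_mult_pos)
  have ab: "s * (1 - d) < s" "s < s * (1 + d)" using s d by auto
  have e4: "e / 4 > 0" using e by simp
  have ev_v1: "eventually (\<lambda>N. ln (v N) / real N < K + 1/2 * ln (s * (1 + d)) + e / 4) sequentially"
    using e by (intro order_tendstoD(2)[OF v_lim]) auto
  have ev_v2: "eventually (\<lambda>N. ln (v N) / real N > K + 1/2 * ln (s * (1 + d)) - e / 4) sequentially"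
    using e by (intro order_tendstoD(1)[OF v_lim]) auto
  have ev_G: "eventually (\<lambda>N. G N q < g q + e / 4) sequentially"
    using e by (intro order_tendstoD(2)[OF G_tendsto[OF q]]) auto
  from ev_v1 ev_v2 ev_G shell_int_lower[OF s ab e4] eventually_gauss_int_eq[OF q] eventually_quad_le[OF L(1)] eventually_gt_at_top[of 0]
  show "eventually (\<lambda>N. dist (ln (Z_sf N (J N) \<beta> R) / real N) (A_sf lb \<beta> (R\<^sup>2)) < e) sequentially"
  proof eventually_elim
    case (elim N)
    have bd: "\<And>z. \<bar>quad N (\<lambda>i j. J N i j / sqrt (real N)) z\<bar> \<le> L * sqnorm N z" using elim(6) unfolding A by blast
    define Z where "Z = Z_sf N (J N) \<beta> R"
    have Z: "Z > 0"
      using Z_sf_bounds(1)[OF R beta_pos L(2) bd] unfolding Z_def by (meson exp_gt_zero less_le_trans)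
    have vN: "v N > 0" using v_pos elim(7) by blast
    note sh = shell_int_Z_sf[OF R beta_pos L(2) bd d elim(7), folded s_def, folded v_def Z_def A]
    have "ennreal (exp (real N * (legendre s - e / 4))) \<le> ennreal (exp (\<beta> * L * d * s * real N) * (Z * v N))"
      using order_trans[OF elim(4) sh(2)] .
    then have "exp (real N * (legendre s - e / 4)) \<le> exp (\<beta> * L * d * s * real N) * (Z * v N)"
      using Z vN by (subst (asm) ennreal_le_iff) auto
    then have "ln (exp (real N * (legendre s - e / 4))) \<le> ln (exp (\<beta> * L * d * s * real N) * (Z * v N))"
      using Z vN by (subst ln_le_cancel_iff) auto
    then have "real N * (legendre s - e / 4) \<le> \<beta> * L * d * s * real N + (ln Z + ln (v N))"
      using Z vN by (simp add: ln_mult_pos)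
    then have lo: "legendre s - e / 4 \<le> \<beta> * L * d * s + (ln Z / real N + ln (v N) / real N)"
      using elim(7) by (simp add: field_simps)
    have "ennreal (exp (- (\<beta> * L * d * s * real N)) * (Z * v N)) \<le> ennreal (exp (real N * (q * (s * (1 + d))))) * gauss_int N (A N) \<beta> q"
      using order_trans[OF sh(1) shell_int_le_gauss[OF q_nn]] .
    then have "ennreal (exp (- (\<beta> * L * d * s * real N)) * (Z * v N)) \<le> ennreal (exp (real N * (q * (s * (1 + d)) + G N q)))"
      unfolding elim(5) by (simp add: ennreal_mult[symmetric] exp_add[symmetric] distrib_left)
    then have "exp (- (\<beta> * L * d * s * real N)) * (Z * v N) \<le> exp (real N * (q * (s * (1 + d)) + G N q))"
      by (subst (asm) ennreal_le_iff) auto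
    then have "ln (exp (- (\<beta> * L * d * s * real N)) * (Z * v N)) \<le> ln (exp (real N * (q * (s * (1 + d)) + G N q)))"
      using Z vN by (subst ln_le_cancel_iff) auto
    then have "- (\<beta> * L * d * s * real N) + (ln Z + ln (v N)) \<le> real N * (q * (s * (1 + d)) + G N q)"
      using Z vN by (simp add: ln_mult_pos)
    then have up: "ln Z / real N + ln (v N) / real N \<le> \<beta> * L * d * s + q * (s * (1 + d)) + G N q"
      using elim(7) by (simp add: field_simps)
    have qsd: "q * (s * (1 + d)) = q * s + q * s * d" by (simp add: algebra_simps)
    define y where "y = ln Z / real N"
    define w where "w = ln (v N) / real N"
    have "\<bar>y - A_sf lb \<beta> s\<bar> < e"
      using lo up[unfolded qsd] elim(1,2)[unfolded ln_sd] elim(3) small terms qleg e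
      unfolding Asf y_def[symmetric] w_def[symmetric] abs_less_iff by (intro conjI) linarith+
    then show ?case by (simp add: dist_real_def y_def Z_def s_def)
  qed
qed

end

section \<open>Random matrices\<close>

lemma hamiltonian_joint_measurable:
  assumes "\<And>i j. (\<lambda>w. J w i j) \<in> borel_measurable M"
  shows "(\<lambda>p. hamiltonian N (J (fst p)) (snd p)) \<in> borel_measurable (M \<Otimes>\<^sub>M lebN N)"
proof -
  have "(\<lambda>p. J (fst p) i j) \<in> borel_measurable (M \<Otimes>\<^sub>M lebN N)" for i j
    using measurable_compose[OF measurable_fst assms[of i j]] .
  moreover have "(\<lambda>p. snd p i) \<in> borel_measurable (M \<Otimes>\<^sub>M lebN N)" if "i < N" for i
    using measurable_compose[OF measurable_snd measurable_lebN_component[OF that]] .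
  ultimately show ?thesis unfolding hamiltonian_def
    by (intro borel_measurable_times borel_measurable_const borel_measurable_sum) auto
qed

lemma prob_space_sphere_measure: "prob_space (sphere_measure N r)"
  unfolding sphere_measure_def
proof (intro prob_space.prob_space_distr prob_space_uniform_measure)
  show "emeasure (lebN N) {z \<in> space (lebN N). sqnorm N z \<le> 1} \<noteq> 0"
    unfolding emeasure_lebN_unit_ball by (simp add: less_imp_neq[symmetric])
  show "emeasure (lebN N) {z \<in> space (lebN N). sqnorm N z \<le> 1} \<noteq> \<infinity>"
    unfolding emeasure_lebN_unit_ball by simp
qed simp

lemma Z_sf_measurable:
  assumes "\<And>i j. (\<lambda>w. J w i j) \<in> borel_measurable M"
  shows "(\<lambda>w. Z_sf N (J w) \<beta> R) \<in> borel_measurable M"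
proof -
  interpret S: prob_space "sphere_measure N (R * sqrt (real N))" by (rule prob_space_sphere_measure)
  have "sets (M \<Otimes>\<^sub>M sphere_measure N (R * sqrt (real N))) = sets (M \<Otimes>\<^sub>M lebN N)"
    by (intro sets_pair_measure_cong) (auto simp: sphere_measure_def)
  then have [measurable]: "(\<lambda>p. hamiltonian N (J (fst p)) (snd p)) \<in> borel_measurable (M \<Otimes>\<^sub>M sphere_measure N (R * sqrt (real N)))"
    using hamiltonian_joint_measurable[OF assms] by (simp cong: measurable_cong_sets)
  show ?thesis unfolding Z_sf_def
    by (rule S.borel_measurable_lebesgue_integral) (simp add: split_beta')
qed

lemma Z_g_measurable:
  assumes "\<And>i j. (\<lambda>w. J w i j) \<in> borel_measurable M"
  shows "(\<lambda>w. Z_g N (J w) \<beta> l) \<in> borel_measurable M"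
proof -
  interpret S: sigma_finite_measure "lebN N" by (rule sigma_finite_lebN)
  note [measurable] = hamiltonian_joint_measurable[OF assms]
  show ?thesis unfolding Z_g_def
    by (rule S.borel_measurable_lebesgue_integral) (simp add: split_beta')
qed

lemma large_eigenvalue_event_measurable:
  assumes "\<And>i j. (\<lambda>w. J w i j) \<in> borel_measurable M" "\<And>w. w \<in> space M \<Longrightarrow> symmetric_on N (J w)" and a: "a > 0"
  shows "{w \<in> space M. \<exists>x. eigenvalue (fmat N (J w)) x \<and> \<bar>x\<bar> \<ge> a} \<in> sets M"
proof -
  have "{w \<in> space M. \<exists>x. eigenvalue (fmat N (J w)) x \<and> \<bar>x\<bar> \<ge> a} =
    {w \<in> space M. \<forall>n. \<exists>z\<in>rat_vectors N. (a - 1 / real (Suc n)) * sqnorm N z < \<bar>quad N (J w) z\<bar>}"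
    using large_eigenvalue_iff_rat_vectors[OF assms(2) a] by auto
  also have "\<dots> \<in> sets M"
  proof -
    have [measurable]: "(\<lambda>w. quad N (J w) z) \<in> borel_measurable M" for z
      unfolding quad_def by (intro borel_measurable_sum borel_measurable_times assms(1)) auto
    have "{w \<in> space M. (a - 1 / real (Suc n)) * sqnorm N z < \<bar>quad N (J w) z\<bar>} \<in> sets M" for n z
      by measurable
    then have "(\<Union>z\<in>rat_vectors N. {w \<in> space M. (a - 1 / real (Suc n)) * sqnorm N z < \<bar>quad N (J w) z\<bar>}) \<in> sets M" for n
      by (intro sets.countable_UN'[OF countable_rat_vectors]) auto
    also have "(\<Union>z\<in>rat_vectors N. {w \<in> space M. (a - 1 / real (Suc n)) * sqnorm N z < \<bar>quad N (J w) z\<bar>}) =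
       {w \<in> space M. \<exists>z\<in>rat_vectors N. (a - 1 / real (Suc n)) * sqnorm N z < \<bar>quad N (J w) z\<bar>}" for n
      by auto
    finally have "{w \<in> space M. \<exists>z\<in>rat_vectors N. (a - 1 / real (Suc n)) * sqnorm N z < \<bar>quad N (J w) z\<bar>} \<in> sets M" for n .
    then show ?thesis by (rule sets.sets_Collect_countable_All)
  qed
  finally show ?thesis .
qed

lemma summable_square_exp:
  fixes a t :: real assumes "t > 0"
  shows "summable (\<lambda>k. (a + real k + 1)\<^sup>2 * exp (- t * real k))"
proof (rule summable_comparison_test_bigo)
  have "summable (\<lambda>k. exp (- t / 2) ^ k)" using assms by (intro summable_geometric) simp
  moreover have "(\<lambda>k. exp (- t / 2) ^ k) = (\<lambda>k. norm (exp (- t / 2 * real k)))"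
  proof
    show "exp (- t / 2) ^ k = norm (exp (- t / 2 * real k))" for k
      by (subst exp_of_nat_mult[symmetric]) (simp add: mult.commute)
  qed
  ultimately show "summable (\<lambda>k. norm (exp (- t / 2 * real k)))" by (simp only:)
  show "(\<lambda>k. (a + real k + 1)\<^sup>2 * exp (- t * real k)) \<in> O(\<lambda>k. exp (- t / 2 * real k))"
    using assms by real_asymp
qed

text \<open>A single integrable function controls all the squared spectral norms at once; it sums
  the squared unit steps of the norms above the level \<open>a\<close>.\<close>

lemma sup_spectral_norm_integrable:
  fixes E :: "nat \<Rightarrow> real \<Rightarrow> 'w set"
  assumes "prob_space M" and E: "\<And>N a. a > 0 \<Longrightarrow> E N a \<in> sets M"
    and tail: "\<And>N b. N \<ge> 1 \<Longrightarrow> b \<ge> a \<Longrightarrow> measure M (E N b) \<le> C * exp (- \<theta> * b\<^sup>2 * real N)"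
    and a: "a > 0" and \<theta>: "\<theta> > 0"
  obtains D where "integrable M D" "\<And>w. D w \<ge> 0"
    "AE w in M. \<forall>N\<ge>1. \<forall>k. w \<in> E N (a + real k) \<longrightarrow> (a + real k + 1)\<^sup>2 \<le> D w"
proof -
  interpret prob_space M by fact
  define f where "f n k w = ennreal ((a + real k + 1)\<^sup>2) * indicator (E (Suc n) (a + real k)) w" for n k w
  define D where "D w = (\<Sum>n. \<Sum>k. f n k w)" for w
  have Es [measurable]: "E N (a + real k) \<in> sets M" for N k using E a by (simp add: add_pos_nonneg)
  have f [measurable]: "f n k \<in> borel_measurable M" for n k unfolding f_def by measurable
  have D [measurable]: "D \<in> borel_measurable M" unfolding D_def by measurable
  have C: "C \<ge> 0"
    using order_trans[OF measure_nonneg tail[of 1 a]] by (simp add: zero_le_mult_iff)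
  define u where "u n = C * exp (- \<theta> * a\<^sup>2) ^ Suc n" for n
  define v where "v k = (a + real k + 1)\<^sup>2 * exp (- \<theta> * real k)" for k
  have u0: "u n \<ge> 0" and v0: "v k \<ge> 0" for n k using C by (auto simp: u_def v_def)
  have su: "summable u" unfolding u_def using a \<theta>
    by (intro summable_mult summable_Suc_iff[THEN iffD2] summable_geometric) simp
  have sv: "summable v" unfolding v_def using \<theta> by (rule summable_square_exp)
  have fi: "(\<integral>\<^sup>+w. f n k w \<partial>M) \<le> ennreal (u n) * ennreal (v k)" for n k
  proof -
    have "(\<integral>\<^sup>+w. f n k w \<partial>M) = ennreal ((a + real k + 1)\<^sup>2) * emeasure M (E (Suc n) (a + real k))"
      unfolding f_def by (rule nn_integral_cmult_indicator) simp
    also have "\<dots> = ennreal ((a + real k + 1)\<^sup>2 * measure M (E (Suc n) (a + real k)))"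
      by (simp add: emeasure_eq_measure ennreal_mult)
    also have "\<dots> \<le> ennreal (u n * v k)"
    proof (rule ennreal_leI)
      have "real k + a\<^sup>2 \<le> (a + real k)\<^sup>2"
      proof -
        have "real k \<le> (real k)\<^sup>2"
          by (cases k) (auto simp: power2_eq_square)
        moreover have "0 \<le> 2 * a * real k" using a by simp
        ultimately show ?thesis unfolding power2_sum by linarith
      qed
      then have "real k + a\<^sup>2 * real (Suc n) \<le> (a + real k)\<^sup>2 * real (Suc n)"
      proof -
        assume "real k + a\<^sup>2 \<le> (a + real k)\<^sup>2"
        then have "(real k + a\<^sup>2) * real (Suc n) \<le> (a + real k)\<^sup>2 * real (Suc n)" by (intro mult_right_mono) auto
        moreover have "real k * 1 \<le> real k * real (Suc n)" by (intro mult_left_mono) auto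
        ultimately show ?thesis by (simp add: distrib_right)
      qed
      then have "\<theta> * (real k + a\<^sup>2 * real (Suc n)) \<le> \<theta> * ((a + real k)\<^sup>2 * real (Suc n))"
        using \<theta> by (intro mult_left_mono) auto
      then have ex: "exp (- \<theta> * (a + real k)\<^sup>2 * real (Suc n)) \<le> exp (- \<theta> * a\<^sup>2) ^ Suc n * exp (- \<theta> * real k)"
        unfolding exp_of_nat_mult[symmetric] exp_add[symmetric] by (simp add: algebra_simps)
      have "measure M (E (Suc n) (a + real k)) \<le> C * exp (- \<theta> * (a + real k)\<^sup>2 * real (Suc n))"
        by (rule tail) auto
      also have "\<dots> \<le> C * (exp (- \<theta> * a\<^sup>2) ^ Suc n * exp (- \<theta> * real k))"
        using ex C by (rule mult_left_mono)
      finally have "(a + real k + 1)\<^sup>2 * measure M (E (Suc n) (a + real k)) \<le>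
          (a + real k + 1)\<^sup>2 * (C * (exp (- \<theta> * a\<^sup>2) ^ Suc n * exp (- \<theta> * real k)))"
        by (intro mult_left_mono) auto
      then show "(a + real k + 1)\<^sup>2 * measure M (E (Suc n) (a + real k)) \<le> u n * v k"
        by (simp add: u_def v_def mult_ac)
    qed
    finally show ?thesis using u0 v0 by (simp add: ennreal_mult)
  qed
  have "(\<integral>\<^sup>+w. D w \<partial>M) = (\<Sum>n. \<Sum>k. \<integral>\<^sup>+w. f n k w \<partial>M)"
    unfolding D_def by (subst nn_integral_suminf) (auto intro!: suminf_cong nn_integral_suminf)
  also have "\<dots> \<le> (\<Sum>n. \<Sum>k. ennreal (u n) * ennreal (v k))"
    by (intro suminf_le fi) auto
  also have "\<dots> = (\<Sum>n. ennreal (u n)) * (\<Sum>k. ennreal (v k))"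
    by simp
  also have "\<dots> = ennreal (suminf u) * ennreal (suminf v)"
    using su sv u0 v0 by (simp add: suminf_ennreal2)
  also have "\<dots> < \<infinity>" by (simp add: ennreal_mult_less_top)
  finally have fin: "(\<integral>\<^sup>+w. D w \<partial>M) < \<infinity>" .
  have AEfin: "AE w in M. D w \<noteq> \<infinity>" using fin by (intro nn_integral_PInf_AE) auto
  show ?thesis
  proof (rule that[of "\<lambda>w. enn2real (D w)"])
    show "integrable M (\<lambda>w. enn2real (D w))"
    proof (rule integrableI_bounded)
      have "(\<integral>\<^sup>+w. ennreal (norm (enn2real (D w))) \<partial>M) \<le> (\<integral>\<^sup>+w. D w \<partial>M)"
        by (intro nn_integral_mono) (simp add: ennreal_enn2real_if)
      then show "(\<integral>\<^sup>+w. ennreal (norm (enn2real (D w))) \<partial>M) < \<infinity>" using fin by (rule le_less_trans)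
    qed measurable
    show "AE w in M. \<forall>N\<ge>1. \<forall>k. w \<in> E N (a + real k) \<longrightarrow> (a + real k + 1)\<^sup>2 \<le> enn2real (D w)"
      using AEfin
    proof eventually_elim
      case (elim w)
      show ?case
      proof (intro allI impI)
        fix N k assume N: "1 \<le> N" and w: "w \<in> E N (a + real k)"
        obtain n where n: "N = Suc n" using N by (cases N) auto
        have "ennreal ((a + real k + 1)\<^sup>2) = f n k w" using w by (simp add: f_def n)
        also have "\<dots> \<le> (\<Sum>k. f n k w)" using sum_le_suminf[of "\<lambda>k. f n k w" "{k}"] by simp
        also have "\<dots> \<le> D w" unfolding D_def using sum_le_suminf[of "\<lambda>n. \<Sum>k. f n k w" "{n}"] by simp
        also have "\<dots> = ennreal (enn2real (D w))" using elim by (simp add: less_top)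
        finally show "(a + real k + 1)\<^sup>2 \<le> enn2real (D w)" by (subst (asm) ennreal_le_iff) auto
      qed
    qed
  qed auto
qed

theorem mainTheorem1:
  fixes M :: "'w measure"
    and J :: "nat \<Rightarrow> 'w \<Rightarrow> nat \<Rightarrow> nat \<Rightarrow> real"
    and Jsq lb \<beta> R l :: real
  assumes prob: "prob_space M"
    and meas: "\<And>N i j. (\<lambda>w. J N w i j) \<in> borel_measurable M"
    and indep: "\<And>N. prob_space.indep_vars M (\<lambda>_. borel) (\<lambda>(i, j) w. J N w i j)
                      {(i, j). i \<le> j \<and> j < N}"
    and symm: "\<And>N w i j. w \<in> space M \<Longrightarrow> J N w i j = J N w j i"
    and mean0: "\<And>N i j. N \<ge> 1 \<Longrightarrow> i < N \<Longrightarrow> j < N \<Longrightarrow>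
                  prob_space.expectation M (\<lambda>w. J N w i j) = 0"
    and var: "\<And>N i j. N \<ge> 1 \<Longrightarrow> i < N \<Longrightarrow> j < N \<Longrightarrow>
                  prob_space.expectation M (\<lambda>w. (J N w i j)\<^sup>2) = Jsq"
    and Jsq_pos: "Jsq > 0"
    and subg: "\<exists>\<theta>0 > 0. \<exists>C. \<forall>N \<ge> 1. \<forall>i < N. \<forall>j < N.
                  integrable M (\<lambda>w. exp (\<theta>0 * (J N w i j)\<^sup>2 / real N)) \<and>
                  prob_space.expectation M (\<lambda>w. exp (\<theta>0 * (J N w i j)\<^sup>2 / real N)) \<le> C"
    and lb_pos: "lb > 0"
    and edge: "\<exists>C1 > 0. \<exists>\<theta> > 0. \<forall>N \<ge> 1. \<forall>a > lb.
                  measure M {w \<in> space M. \<exists>x. eigenvalue (scaled_mat N (J N w)) x \<and> \<bar>x\<bar> \<ge> a}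
                    \<le> C1 * exp (- \<theta> * a\<^sup>2 * real N)"
    and esd: "AE w in M. \<forall>f :: real \<Rightarrow> real. continuous_on UNIV f \<and> bounded (range f) \<longrightarrow>
                  (\<lambda>N. (\<Sum>x\<in>#proots (char_poly (scaled_mat N (J N w))). f x) / real N)
                    \<longlonglongrightarrow> (LBINT \<mu>:{-lb..lb}. semicircle lb \<mu> * f \<mu>)"
    and beta_pos: "\<beta> > 0"
    and R_pos: "R > 0"
  shows
    "(\<exists>q \<ge> \<beta> * lb. sf_functional lb \<beta> (R\<^sup>2) q = A_sf lb \<beta> (R\<^sup>2)) \<and>
     (AE w in M. (\<lambda>N. ln (Z_sf N (J N w) \<beta> R) / real N) \<longlonglongrightarrow> A_sf lb \<beta> (R\<^sup>2)) \<and>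
     (\<lambda>N. prob_space.expectation M (\<lambda>w. ln (Z_sf N (J N w) \<beta> R)) / real N)
        \<longlonglongrightarrow> A_sf lb \<beta> (R\<^sup>2) \<and>
     (\<exists>s > 0. g_functional lb \<beta> l s = A_g lb \<beta> l) \<and>
     (AE w in M. (\<lambda>N. ln (Z_g N (J N w) \<beta> l) / real N) \<longlonglongrightarrow> A_g lb \<beta> l) \<and>
     (\<lambda>N. prob_space.expectation M (\<lambda>w. ln (Z_g N (J N w) \<beta> l)) / real N)
        \<longlonglongrightarrow> A_g lb \<beta> l"
proof -
  interpret prob_space M by fact
  interpret semicircle_params lb \<beta> by standard (fact lb_pos, fact beta_pos)
  define A where "A N w i j = J N w i j / sqrt (real N)" for N w i j
  have scaled: "scaled_mat N (J N w) = fmat N (A N w)" for N w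
    by (simp add: scaled_mat_def A_def)
  have A_eq: "A N w = (\<lambda>i j. J N w i j / sqrt (real N))" for N w by (simp add: A_def fun_eq_iff)
  have A_meas: "(\<lambda>w. A N w i j) \<in> borel_measurable M" for N i j
    unfolding A_def using meas by measurable
  have A_sym: "symmetric_on N (A N w)" if "w \<in> space M" for N w
    using symm[OF that] by (simp add: symmetric_on_def A_def)
  define E where "E N a = {w \<in> space M. \<exists>x. eigenvalue (fmat N (A N w)) x \<and> \<bar>x\<bar> \<ge> a}" for N a
  have E_sets: "E N a \<in> sets M" if "a > 0" for N a
    unfolding E_def by (rule large_eigenvalue_event_measurable[OF A_meas A_sym that])
  obtain C1 \<theta> where C1: "C1 > 0" and \<theta>: "\<theta> > 0"
    and tail: "\<And>N a. N \<ge> 1 \<Longrightarrow> a > lb \<Longrightarrow> measure M (E N a) \<le> C1 * exp (- \<theta> * a\<^sup>2 * real N)"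
    using edge unfolding scaled E_def by blast
  have ev_edge: "AE w in M. eventually (\<lambda>N. w \<in> space M - E N a) sequentially" if a: "a > lb" for a
  proof (rule borel_cantelli_AE1)
    show "E N a \<in> sets M" for N using E_sets a lb_pos by simp
    have "norm (exp (- \<theta> * a\<^sup>2)) < 1" using \<theta> a lb_pos by simp
    then have "summable (\<lambda>N. C1 * exp (- \<theta> * a\<^sup>2) ^ N)" by (intro summable_mult summable_geometric)
    then show "summable (\<lambda>N. measure M (E N a))"
    proof (rule summable_comparison_test'[where N=1])
      fix N :: nat assume "N \<ge> 1"
      have "exp (- \<theta> * a\<^sup>2) ^ N = exp (- \<theta> * a\<^sup>2 * real N)"
        by (subst exp_of_nat_mult[symmetric]) (simp add: mult.commute)
      then show "norm (measure M (E N a)) \<le> C1 * exp (- \<theta> * a\<^sup>2) ^ N" using tail[OF \<open>N \<ge> 1\<close> a] by simp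
    qed
  qed (auto simp: emeasure_eq_measure)
  have "AE w in M. \<forall>k::nat. eventually (\<lambda>N. w \<in> space M - E N (lb + 1 / real (Suc k))) sequentially"
    unfolding AE_all_countable using ev_edge by auto
  with esd AE_space have AE_seq: "AE w in M. spectral_sequence lb \<beta> (\<lambda>N. A N w)"
  proof eventually_elim
    case (elim w)
    show ?case
    proof
      show "symmetric_on N (A N w)" for N using A_sym elim(2) by blast
      show "eventually (\<lambda>N. \<forall>x. eigenvalue (fmat N (A N w)) x \<longrightarrow> \<bar>x\<bar> \<le> a) sequentially" if a: "a > lb" for a
      proof -
        obtain k where k: "1 / real (Suc k) < a - lb"
          using reals_Archimedean[of "a - lb"] a by (auto simp: inverse_eq_divide)
        show ?thesis using elim(3)[rule_format, of k]
        proof eventually_elim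
          case (elim N)
          then have "\<forall>x. eigenvalue (fmat N (A N w)) x \<longrightarrow> \<bar>x\<bar> < lb + 1 / real (Suc k)"
            by (auto simp: E_def not_le)
          moreover have "lb + 1 / real (Suc k) < a" using k by linarith
          ultimately show ?case by (meson less_imp_le less_trans)
        qed
      qed
      show "(\<lambda>N. (\<Sum>x\<in>#proots (char_poly (fmat N (A N w))). f x) / real N) \<longlonglongrightarrow> (\<integral>\<mu>. f \<mu> \<partial>sc_measure lb)"
        if f: "continuous_on UNIV f" "bounded (range f)" for f :: "real \<Rightarrow> real"
      proof -
        have "f \<in> borel_measurable borel" using f(1) by (rule borel_measurable_continuous_onI)
        from integral_sc[OF this] show ?thesis
          using elim(1)[unfolded scaled, rule_format, OF conjI[OF f]] by (simp only:)
      qed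
    qed
  qed
  have sf_AE: "AE w in M. (\<lambda>N. ln (Z_sf N (J N w) \<beta> R) / real N) \<longlonglongrightarrow> A_sf lb \<beta> (R\<^sup>2)"
    using AE_seq by eventually_elim (rule spectral_sequence.Z_sf_limit[OF _ A_eq R_pos])
  have g_AE: "AE w in M. (\<lambda>N. ln (Z_g N (J N w) \<beta> l) / real N) \<longlonglongrightarrow> A_g lb \<beta> l"
    using AE_seq by eventually_elim (rule spectral_sequence.Z_g_limit[OF _ A_eq])
  define a where "a = lb + 1"
  have a: "a > 0" "a > lb" using lb_pos by (auto simp: a_def)
  obtain D where D: "integrable M D" "\<And>w. D w \<ge> 0"
      "AE w in M. \<forall>N\<ge>1. \<forall>k. w \<in> E N (a + real k) \<longrightarrow> (a + real k + 1)\<^sup>2 \<le> D w"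
    by (rule sup_spectral_norm_integrable[of M E a C1 \<theta>])
      (use a tail E_sets \<theta> in \<open>auto intro: prob_space_axioms\<close>)
  have dom: "AE w in M. \<forall>N\<ge>1. \<exists>L\<ge>0. (\<forall>z. \<bar>quad N (A N w) z\<bar> \<le> L * sqnorm N z) \<and> L\<^sup>2 \<le> a\<^sup>2 + D w"
    using D(3) AE_space
  proof eventually_elim
    case (elim w)
    show ?case
    proof (intro allI impI)
      fix N :: nat assume N: "N \<ge> 1"
      define P where "P k \<longleftrightarrow> (\<forall>x. eigenvalue (fmat N (A N w)) x \<longrightarrow> \<bar>x\<bar> \<le> a + real k)" for k :: nat
      have "\<exists>k. P k"
      proof -
        have "finite (abs ` {x. eigenvalue (fmat N (A N w)) x})"
          by (intro finite_imageI finite_eigenvalues)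
        then have "bdd_above (abs ` {x. eigenvalue (fmat N (A N w)) x})"
          by (rule bdd_above_finite)
        then obtain B where B: "\<bar>x\<bar> \<le> B" if "eigenvalue (fmat N (A N w)) x" for x
          by (auto simp: bdd_above_def)
        obtain k :: nat where "B \<le> real k" using real_arch_simple by blast
        then have "P k" unfolding P_def using B a by (force intro: order_trans)
        then show ?thesis by blast
      qed
      then have Pk: "P (LEAST k. P k)" by (rule LeastI_ex)
      define k where "k = (LEAST k. P k)"
      define L where "L = a + real k"
      have "L \<ge> 0" using a by (simp add: L_def)
      moreover have "\<bar>quad N (A N w) z\<bar> \<le> L * sqnorm N z" for z
        by (rule abs_quad_le_spectral[OF A_sym[OF elim(2)]]) (use Pk in \<open>auto simp: P_def k_def L_def\<close>)
      moreover have "L\<^sup>2 \<le> a\<^sup>2 + D w"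
      proof (cases k)
        case 0
        then show ?thesis using D(2)[of w] by (simp add: L_def)
      next
        case (Suc m)
        then have "\<not> P m" using not_less_Least[of m P] by (simp add: k_def)
        then have "w \<in> E N (a + real m)" using elim(2) by (auto simp: P_def E_def not_le intro: less_imp_le)
        then have "(a + real m + 1)\<^sup>2 \<le> D w" using elim(1) N by blast
        moreover have "L = a + real m + 1" by (simp add: L_def Suc)
        ultimately have "L\<^sup>2 \<le> D w" by (simp only:)
        then show ?thesis using zero_le_power2[of a] by linarith
      qed
      ultimately show "\<exists>L\<ge>0. (\<forall>z. \<bar>quad N (A N w) z\<bar> \<le> L * sqnorm N z) \<and> L\<^sup>2 \<le> a\<^sup>2 + D w" by blast
    qed
  qed
  have limit: "(\<lambda>N. expectation (\<lambda>w. ln (Z N w)) / real N) \<longlonglongrightarrow> c"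
    if meas_Z: "\<And>N. Z N \<in> borel_measurable M"
      and conv: "AE w in M. (\<lambda>N. ln (Z N w) / real N) \<longlonglongrightarrow> c"
      and K: "K \<ge> 0" "\<And>N w L. N > 0 \<Longrightarrow> L \<ge> 0 \<Longrightarrow> (\<forall>z. \<bar>quad N (A N w) z\<bar> \<le> L * sqnorm N z) \<Longrightarrow>
        \<bar>ln (Z N w) / real N\<bar> \<le> K * (1 + L\<^sup>2)"
    for Z :: "nat \<Rightarrow> 'w \<Rightarrow> real" and c K :: real
  proof -
    have "(\<lambda>N. expectation (\<lambda>w. ln (Z N w) / real N)) \<longlonglongrightarrow> expectation (\<lambda>_. c)"
    proof (rule integral_dominated_convergence[where w="\<lambda>w. K * (1 + (a\<^sup>2 + D w))"])
      show "integrable M (\<lambda>w. K * (1 + (a\<^sup>2 + D w)))"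
        using D(1) by (intro integrable_mult_right Bochner_Integration.integrable_add) auto
      show "(\<lambda>w. ln (Z N w) / real N) \<in> borel_measurable M" for N using meas_Z[of N] by measurable
      show "AE w in M. norm (ln (Z N w) / real N) \<le> K * (1 + (a\<^sup>2 + D w))" for N
      proof (cases "N = 0")
        case True
        then show ?thesis using K(1) D(2) by (auto intro!: mult_nonneg_nonneg add_nonneg_nonneg)
      next
        case False
        show ?thesis using dom
        proof eventually_elim
          case (elim w)
          obtain L where L: "L \<ge> 0" "\<forall>z. \<bar>quad N (A N w) z\<bar> \<le> L * sqnorm N z" "L\<^sup>2 \<le> a\<^sup>2 + D w"
            using elim False by (metis One_nat_def Suc_leI neq0_conv)
          have "norm (ln (Z N w) / real N) \<le> K * (1 + L\<^sup>2)" using K(2)[OF _ L(1,2)] False by simp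
          also have "\<dots> \<le> K * (1 + (a\<^sup>2 + D w))" using L(3) K(1) by (intro mult_left_mono) auto
          finally show ?case .
        qed
      qed
    qed (use conv in auto)
    then show ?thesis by (simp add: prob_space)
  qed
  have sf_E: "(\<lambda>N. expectation (\<lambda>w. ln (Z_sf N (J N w) \<beta> R)) / real N) \<longlonglongrightarrow> A_sf lb \<beta> (R\<^sup>2)"
  proof (rule limit[of _ _ "\<beta> * R\<^sup>2"])
    show "(\<lambda>w. Z_sf N (J N w) \<beta> R) \<in> borel_measurable M" for N by (rule Z_sf_measurable[OF meas])
    show "AE w in M. (\<lambda>N. ln (Z_sf N (J N w) \<beta> R) / real N) \<longlonglongrightarrow> A_sf lb \<beta> (R\<^sup>2)" by (rule sf_AE)
    show "\<beta> * R\<^sup>2 \<ge> 0" using beta_pos by simp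
    fix N :: nat and w and L :: real
    assume N: "N > 0" and L: "L \<ge> 0" "\<forall>z. \<bar>quad N (A N w) z\<bar> \<le> L * sqnorm N z"
    have bd: "\<And>z. \<bar>quad N (\<lambda>i j. J N w i j / sqrt (real N)) z\<bar> \<le> L * sqnorm N z" using L(2) unfolding A_eq by blast
    note Z = Z_sf_bounds(1,2)[OF R_pos beta_pos L(1) bd]
    have Zp: "Z_sf N (J N w) \<beta> R > 0" using Z(1) by (meson exp_gt_zero less_le_trans)
    have "ln (Z_sf N (J N w) \<beta> R) \<le> \<beta> * (R\<^sup>2 * real N) * L"
      using Z(2) Zp by (metis exp_gt_zero ln_exp ln_le_cancel_iff)
    moreover have "- (\<beta> * (R\<^sup>2 * real N) * L) \<le> ln (Z_sf N (J N w) \<beta> R)"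
      using Z(1) Zp by (metis exp_gt_zero ln_exp ln_le_cancel_iff)
    ultimately have "\<bar>ln (Z_sf N (J N w) \<beta> R)\<bar> \<le> (\<beta> * R\<^sup>2 * L) * real N"
      unfolding abs_le_iff by (simp add: mult_ac)
    then have "\<bar>ln (Z_sf N (J N w) \<beta> R) / real N\<bar> \<le> \<beta> * R\<^sup>2 * L" using N by (simp add: abs_divide pos_divide_le_eq)
    also have "\<dots> \<le> \<beta> * R\<^sup>2 * (1 + L\<^sup>2)"
    proof (rule mult_left_mono)
      have "0 \<le> (L - 1)\<^sup>2" by simp
      then show "L \<le> 1 + L\<^sup>2" using L(1) by (simp add: power2_diff)
    qed (use beta_pos in simp)
    finally show "\<bar>ln (Z_sf N (J N w) \<beta> R) / real N\<bar> \<le> \<beta> * R\<^sup>2 * (1 + L\<^sup>2)" .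
  qed
  obtain K where K: "\<And>N J L. N > 0 \<Longrightarrow> L \<ge> 0 \<Longrightarrow> (\<forall>z. \<bar>quad N (\<lambda>i j. J i j / sqrt (real N)) z\<bar> \<le> L * sqnorm N z) \<Longrightarrow>
      \<bar>ln (Z_g N J \<beta> l) / real N\<bar> \<le> K * (1 + L\<^sup>2)"
    using ln_Z_g_growth[of l] by blast
  have g_E: "(\<lambda>N. expectation (\<lambda>w. ln (Z_g N (J N w) \<beta> l)) / real N) \<longlonglongrightarrow> A_g lb \<beta> l"
  proof (rule limit[of _ _ "\<bar>K\<bar>"])
    show "(\<lambda>w. Z_g N (J N w) \<beta> l) \<in> borel_measurable M" for N by (rule Z_g_measurable[OF meas])
    show "AE w in M. (\<lambda>N. ln (Z_g N (J N w) \<beta> l) / real N) \<longlonglongrightarrow> A_g lb \<beta> l" by (rule g_AE)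
    show "\<bar>K\<bar> \<ge> 0" by simp
    fix N :: nat and w and L :: real
    assume N: "N > 0" and L: "L \<ge> 0" "\<forall>z. \<bar>quad N (A N w) z\<bar> \<le> L * sqnorm N z"
    have "\<bar>ln (Z_g N (J N w) \<beta> l) / real N\<bar> \<le> K * (1 + L\<^sup>2)" by (rule K[OF N L(1)]) (use L(2) A_eq in simp)
    also have "\<dots> \<le> \<bar>K\<bar> * (1 + L\<^sup>2)" by (intro mult_right_mono) auto
    finally show "\<bar>ln (Z_g N (J N w) \<beta> l) / real N\<bar> \<le> \<bar>K\<bar> * (1 + L\<^sup>2)" .
  qed
  have s: "R\<^sup>2 > 0" using R_pos by simp
  obtain q s where "s > 0" "g_functional lb \<beta> l s = A_g lb \<beta> l" using A_g_dual[of l] by blast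
  then have "\<exists>s>0. g_functional lb \<beta> l s = A_g lb \<beta> l" by blast
  then show ?thesis
    using A_sf_attained(1)[OF s] sf_AE sf_E g_AE g_E by blast
qed

end
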